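(* Let $N,\ell$ be positive integers with $\ell\le N$, let $U_0\in H^N(\mathbb{R})\cap L^1(\mathbb{R})$, and let $U$ be the solution of the Cauchy problem (S') (described in the context) with initial datum $U_0$. Then, for any $j\in\{0,\dots,N-\ell\}$, there exists $c_0>0$ such that, for any $t\ge 0$, the following holds. (1) If $(\tau_1,\tau_2,\tau_3)=(1,0,0)$ and $\chi:=k_3-k_2\ne 0$, then $$\|\partial_x^jU(\cdot,t)\|_{L^2(\mathbb{R})}\le c_0(1+t)^{-1/12-j/6}\|U_0\|_{L^1(\mathbb{R})}+c_0(1+t)^{-\ell/4}\|\partial_x^{j+\ell}U_0\|_{L^2(\mathbb{R})}\quad\text{when }\epsilon_0=1,$$ $$\|\partial_x^jU(\cdot,t)\|_{L^2(\mathbb{R})}\le c_0(1+t)^{-1/8-j/4}\|U_0\|_{L^1(\mathbb{R})}+c_0(1+t)^{-\ell/4}\|\partial_x^{j+\ell}U_0\|_{L^2(\mathbb{R})}\quad\text{when }\epsilon_0=0.$$ (2) If $(\tau_1,\tau_2,\tau_3)\in\{(0,1,0),(0,0,1)\}$ and $k_1=k_2=k_3$, then $$\|\partial_x^jU(\cdot,t)\|_{L^2(\mathbb{R})}\le c_0(1+t)^{-1/8-j/4}\|U_0\|_{L^1(\mathbb{R})}+c_0(1+t)^{-\ell/2}\|\partial_x^{j+\ell}U_0\|_{L^2(\mathbb{R})}\quad\text{when }\epsilon_0=1,$$ $$\|\partial_x^jU(\cdot,t)\|_{L^2(\mathbb{R})}\le c_0(1+t)^{-1/4-j/2}\|U_0\|_{L^1(\mathbb{R})}+c_0(1+t)^{-\ell/2}\|\partial_x^{j+\ell}U_0\|_{L^2(\mathbb{R})}\quad\text{when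 }\epsilon_0=0.$$ (3) If $(\tau_1,\tau_2,\tau_3)\in\{(0,1,0),(0,0,1)\}$ and the condition $k_1=k_2=k_3$ does not hold, then $$\|\partial_x^jU(\cdot,t)\|_{L^2(\mathbb{R})}\le c_0(1+t)^{-1/8-j/4}\|U_0\|_{L^1(\mathbb{R})}+c_0(1+t)^{-\ell/6}\|\partial_x^{j+\ell}U_0\|_{L^2(\mathbb{R})}\quad\text{when }\epsilon_0=1,$$ $$\|\partial_x^jU(\cdot,t)\|_{L^2(\mathbb{R})}\le c_0(1+t)^{-1/4-j/2}\|U_0\|_{L^1(\mathbb{R})}+c_0(1+t)^{-\ell/6}\|\partial_x^{j+\ell}U_0\|_{L^2(\mathbb{R})}\quad\text{when }\epsilon_0=0.$$
   Context: Constants: $k_1,k_2,k_3,k_4,k_5>0$, $\gamma\in\mathbb{R}\setminus\{0\}$, $(\tau_1,\tau_2,\tau_3)\in\{(1,0,0),(0,1,0),(0,0,1)\}$, $\epsilon_0\in\{0,1\}$. Cauchy problem (S'): for $x\in\mathbb{R}$, $t>0$, the unknown is $U=(v,u,z,y,\phi,\theta,\sigma,\eta)^T$, with $U(\cdot,0)=U_0$ and $$\begin{cases} v_t-u_x-y-\theta=0,\\ u_t-k_1v_x+\tau_1\gamma\eta=0,\\ z_t-y_x=0,\\ y_t-k_2z_x+k_1v+\tau_2\gamma\eta=0,\\ \phi_t-\theta_x=0,\\ \theta_t-k_3\phi_x+k_1v+\tau_3\gamma\eta=0,\\ \sigma_t-\eta_x=0,\\ \eta_t-k_4\sigma_x+(-1)^{\epsilon_0}k_5\partial_x^{2\epsilon_0}\eta-\gamma(\tau_1u+\tau_2y+\tau_3\theta)=0.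 \end{cases}$$ So the dissipation term is $-k_5\eta_{xx}$ if $\epsilon_0=1$ and $k_5\eta$ if $\epsilon_0=0$. (It arises from a laminated Timoshenko beam $(\varphi,\psi,w)$ coupled to a temperature variable $q$ by $u=\varphi_t$, $y=\psi_t$, $\theta=w_t$, $\eta=q_t$, $v=\varphi_x+\psi+w$, $z=\psi_x$, $\phi=w_x$, $\sigma=q_x$.) Taking the Fourier transform $\widehat{\cdot}$ in $x$ (so $\partial_x$ becomes multiplication by $i\xi$), (S') becomes for each $\xi\in\mathbb{R}$ a linear constant-coefficient ODE system $\widehat U_t(\xi,t)=A(\xi)\widehat U(\xi,t)$ in $\mathbb{C}^8$, and the solution $U$ of (S') is the one given by $\widehat U(\xi,t)=e^{tA(\xi)}\widehat U_0(\xi)$. Norms of vector-valued functions are the usual ones (built from the Euclidean norm on $\mathbb{C}^8$). *)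

theory Defs
  imports "HOL-Analysis.Analysis"
begin

text \<open>
  Elements of \<open>L\<^sup>1\<close> and \<open>L\<^sup>2\<close> are represented by Borel functions
  (every a.e. class contains one).
\<close>

definition square_integrable :: "(real \<Rightarrow> complex ^ 8) \<Rightarrow> bool" where
  "square_integrable f \<longleftrightarrow>
     f \<in> borel_measurable lborel \<and> integrable lborel (\<lambda>x. (norm (f x))\<^sup>2)"

text \<open>Only meaningful for integrable, respectively square-integrable, functions.\<close>

definition L1_norm :: "(real \<Rightarrow> complex ^ 8) \<Rightarrow> real" where
  "L1_norm f = (\<integral>x. norm (f x) \<partial>lborel)"

definition L2_norm :: "(real \<Rightarrow> complex ^ 8) \<Rightarrow> real" where
  "L2_norm f = sqrt (\<integral>x. (norm (f x))\<^sup>2 \<partial>lborel)"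

definition locally_integrable :: "(real \<Rightarrow> complex ^ 8) \<Rightarrow> bool" where
  "locally_integrable f \<longleftrightarrow> (\<forall>a b. set_integrable lborel {a..b} f)"

definition test_function :: "(real \<Rightarrow> real) \<Rightarrow> bool" where
  "test_function \<phi> \<longleftrightarrow>
     (\<forall>n x. (deriv ^^ n) \<phi> differentiable at x) \<and>
     (\<exists>R. \<forall>x. \<bar>x\<bar> > R \<longrightarrow> \<phi> x = 0)"

definition has_weak_deriv ::
    "nat \<Rightarrow> (real \<Rightarrow> complex ^ 8) \<Rightarrow> (real \<Rightarrow> complex ^ 8) \<Rightarrow> bool" where
  "has_weak_deriv n f g \<longleftrightarrow>
     locally_integrable f \<and> locally_integrable g \<and>
     (\<forall>\<phi>. test_function \<phi> \<longrightarrow>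
        (\<integral>x. (deriv ^^ n) \<phi> x *\<^sub>R f x \<partial>lborel)
          = (- 1) ^ n *\<^sub>R (\<integral>x. \<phi> x *\<^sub>R g x \<partial>lborel))"

text \<open>
  Weak derivatives are unique only up to null sets, so this picks an arbitrary
  representative; it is unspecified where no weak derivative exists.
\<close>

definition weak_deriv :: "nat \<Rightarrow> (real \<Rightarrow> complex ^ 8) \<Rightarrow> real \<Rightarrow> complex ^ 8" where
  "weak_deriv n f = (SOME g. has_weak_deriv n f g)"

definition sobolev_H :: "nat \<Rightarrow> (real \<Rightarrow> complex ^ 8) set" where
  "sobolev_H N =
     {f. square_integrable f \<and> (\<forall>n\<le>N. \<exists>g. square_integrable g \<and> has_weak_deriv n f g)}"

text \<open>
  With this sign convention \<open>\<partial>\<^sub>x\<close> becomes multiplication by \<open>\<i>\<xi>\<close>.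
  The normalisation only affects the constants of \<open>L\<^sup>2\<close> estimates.
\<close>

definition fourier :: "(real \<Rightarrow> complex ^ 8) \<Rightarrow> real \<Rightarrow> complex ^ 8" where
  "fourier f \<xi> = (\<integral>x. exp (- (\<i> * of_real (\<xi> * x))) *s f x \<partial>lborel)"

text \<open>
  The Fourier-Plancherel transform of an \<open>L\<^sup>2\<close> function, as the \<open>L\<^sup>2\<close> limit of the
  Fourier integrals over \<open>[-R, R]\<close> as \<open>R\<close> tends to infinity. The distance is measured
  by a nonnegative Lebesgue integral, which is infinite (not 0) when it diverges.
\<close>

definition has_L2_fourier ::
    "(real \<Rightarrow> complex ^ 8) \<Rightarrow> (real \<Rightarrow> complex ^ 8) \<Rightarrow> bool" where
  "has_L2_fourier f g \<longleftrightarrow>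
     square_integrable f \<and> square_integrable g \<and>
     ((\<lambda>R. \<integral>\<^sup>+\<xi>. ennreal ((norm (fourier (\<lambda>x. indicat_real {- R..R} x *\<^sub>R f x) \<xi> - g \<xi>))\<^sup>2)
        \<partial>lborel) \<longlongrightarrow> 0) at_top"

text \<open>
  The library makes square matrices a normed space but not a normed algebra under \<open>**\<close>,
  so the generic \<open>exp\<close> does not apply to them.
\<close>

definition matrix_exp :: "complex ^ 'n ^ 'n \<Rightarrow> complex ^ 'n ^ ('n::finite)" where
  "matrix_exp M = (\<Sum>n. (1 / fact n) *\<^sub>R (((**) M) ^^ n) (mat 1))"

text \<open>
  The right-hand side of the Fourier-transformed system solved for the time derivatives.
  The components 1, ..., 8 of \<open>w\<close> are
  \<open>v\<close>, \<open>u\<close>, \<open>z\<close>, \<open>y\<close>, \<open>\<phi>\<close>, \<open>\<theta>\<close>, \<open>\<sigma>\<close>, \<open>\<eta>\<close>, in this order.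
\<close>

definition symbol ::
    "real \<Rightarrow> real \<Rightarrow> real \<Rightarrow> real \<Rightarrow> real \<Rightarrow> real \<Rightarrow> real \<times> real \<times> real \<Rightarrow> nat \<Rightarrow> real
      \<Rightarrow> complex ^ 8 \<Rightarrow> complex ^ 8" where
  "symbol k1 k2 k3 k4 k5 \<gamma> \<tau> \<epsilon>0 \<xi> w =
    (let (\<tau>1, \<tau>2, \<tau>3) = \<tau>; d = \<i> * of_real \<xi>;
         v = w $ 1; u = w $ 2; z = w $ 3; y = w $ 4;
         \<phi> = w $ 5; \<theta> = w $ 6; \<sigma> = w $ 7; \<eta> = w $ 8
     in vector
      [d * u + y + \<theta>,
       k1 * (d * v) - \<tau>1 * \<gamma> * \<eta>,
       d * y,
       k2 * (d * z) - k1 * v - \<tau>2 * \<gamma> * \<eta>,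
       d * \<theta>,
       k3 * (d * \<phi>) - k1 * v - \<tau>3 * \<gamma> * \<eta>,
       d * \<eta>,
       k4 * (d * \<sigma>) - (- 1) ^ \<epsilon>0 * k5 * (d ^ (2 * \<epsilon>0) * \<eta>)
         + \<gamma> * (\<tau>1 * u + \<tau>2 * y + \<tau>3 * \<theta>)])"

definition symbol_matrix ::
    "real \<Rightarrow> real \<Rightarrow> real \<Rightarrow> real \<Rightarrow> real \<Rightarrow> real \<Rightarrow> real \<times> real \<times> real \<Rightarrow> nat \<Rightarrow> real
      \<Rightarrow> complex ^ 8 ^ 8" where
  "symbol_matrix k1 k2 k3 k4 k5 \<gamma> \<tau> \<epsilon>0 \<xi> = matrix (symbol k1 k2 k3 k4 k5 \<gamma> \<tau> \<epsilon>0 \<xi>)"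

text \<open>\<open>U t x\<close> stands for \<open>U(x,t)\<close>; at each time it is determined up to null sets.\<close>

definition cauchy_solution ::
    "real \<Rightarrow> real \<Rightarrow> real \<Rightarrow> real \<Rightarrow> real \<Rightarrow> real \<Rightarrow> real \<times> real \<times> real \<Rightarrow> nat
      \<Rightarrow> (real \<Rightarrow> complex ^ 8) \<Rightarrow> (real \<Rightarrow> real \<Rightarrow> complex ^ 8) \<Rightarrow> bool" where
  "cauchy_solution k1 k2 k3 k4 k5 \<gamma> \<tau> \<epsilon>0 U0 U \<longleftrightarrow>
     (\<forall>t\<ge>0. has_L2_fourier (U t)
        (\<lambda>\<xi>. matrix_exp (t *\<^sub>R symbol_matrix k1 k2 k3 k4 k5 \<gamma> \<tau> \<epsilon>0 \<xi>) *v fourier U0 \<xi>))"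

lemma UNIV_8: "(UNIV :: 8 set) = {1, 2, 3, 4, 5, 6, 7, 8}"
proof -
  have "card {1, 2, 3, 4, 5, 6, 7, 8 :: 8} = CARD(8)"
    by simp
  then show ?thesis
    by (metis card_subset_eq finite subset_UNIV)
qed

lemma vector_8:
  fixes a1 a2 a3 a4 a5 a6 a7 a8 :: "'a::zero"
  defines "w \<equiv> vector [a1, a2, a3, a4, a5, a6, a7, a8] :: 'a ^ 8"
  shows "w $ 1 = a1" "w $ 2 = a2" "w $ 3 = a3" "w $ 4 = a4"
    "w $ 5 = a5" "w $ 6 = a6" "w $ 7 = a7" "w $ 8 = a8"
  unfolding w_def vector_def by simp_all

lemma symbol_matrix_mult:
  "symbol_matrix k1 k2 k3 k4 k5 \<gamma> \<tau> \<epsilon>0 \<xi> *v w = symbol k1 k2 k3 k4 k5 \<gamma> \<tau> \<epsilon>0 \<xi> w"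
proof -
  let ?f = "symbol k1 k2 k3 k4 k5 \<gamma> \<tau> \<epsilon>0 \<xi>"
  have forall_8: "(\<forall>i. P i) \<longleftrightarrow> P 1 \<and> P 2 \<and> P 3 \<and> P 4 \<and> P 5 \<and> P 6 \<and> P 7 \<and> P 8"
    for P :: "8 \<Rightarrow> bool"
    using UNIV_8 by (metis UNIV_I empty_iff insert_iff)
  obtain \<tau>1 \<tau>2 \<tau>3 where \<tau>: "\<tau> = (\<tau>1, \<tau>2, \<tau>3)"
    by (cases \<tau>)
  have "Vector_Spaces.linear (*s) (*s) ?f"
  proof (unfold_locales)
    show "?f (x + y) = ?f x + ?f y" for x y
      unfolding vec_eq_iff forall_8 symbol_def \<tau> Let_def prod.case vector_add_component vector_8
      by (intro conjI; simp add: ring_distribs)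
    show "?f (c *s x) = c *s ?f x" for c x
      unfolding vec_eq_iff forall_8 symbol_def \<tau> Let_def prod.case vector_smult_component vector_8
      by (intro conjI; simp add: ring_distribs mult_ac)
  qed
  then show ?thesis
    unfolding symbol_matrix_def by (rule matrix_works)
qed

end

theory Submission
  imports Defs "HOL-Probability.Characteristic_Functions" "HOL-Probability.Sinc_Integral"
begin

text \<open>
  Write \<open>F\<close> for the Fourier transform. Everything rests on a pointwise bound \<open>|e\<^bsup>t A(\<xi>)\<^esup>
  w|\<^sup>2 \<le> C exp (- c \<rho>(\<xi>) t) |w|\<^sup>2\<close>, where \<open>\<rho>\<close> is a power of \<open>|\<xi>|\<close> near \<open>0\<close> and an inverse
  power at infinity. Up to scaling, \<open>A(\<xi>)\<close> is a skew-Hermitian matrix plus a damping of the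
  component \<open>\<eta>\<close> alone. Multipliers transfer the damping along the couplings from one
  component to the next, each with its own \<open>\<xi>\<close>-dependent weight; a product that cannot be
  absorbed is a time derivative up to absorbable terms, because for instance \<open>i\<xi>y\<close> is the
  derivative of \<open>z\<close>. The worst weight is \<open>\<rho>\<close>.

  At low frequencies the bound is combined with \<open>sup |F U\<^sub>0| \<le> \<parallel>U\<^sub>0\<parallel>\<^sub>1\<close>, at high frequencies
  with the square-integrability of \<open>\<xi>\<^bsup>j+l\<^esup> F U\<^sub>0\<close>. For the latter Bessel's inequality on
  \<open>L\<^sup>1\<close>, proved by Gaussian regularisation, is enough. Conversely, since \<open>l \<ge> 1\<close>, the
  functions \<open>\<xi>\<^sup>n F U(t)\<close>, \<open>n \<le> j\<close>, are integrable, so that the weak derivatives of \<open>U(t)\<close>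
  are absolutely convergent inverse Fourier integrals.
\<close>

section \<open>Uniform Lyapunov estimates\<close>

text \<open>The rate is of order \<open>|\<xi>| ^ p\<close> near \<open>0\<close>, with
  \<open>p = 4 + 2 * \<epsilon>0\<close> for coupling through \<open>u\<close> and
  \<open>p = 2 + 2 * \<epsilon>0\<close> otherwise, and of order \<open>1 / |\<xi>| ^ q\<close> at
  infinity, with \<open>q\<close> equal to \<open>4\<close>, \<open>2\<close> or \<open>6\<close>.
  By scaling, the first turns into \<open>(1 + t)\<close> to the power
  \<open>- (2 * j + 1) / (2 * p)\<close>; the second trades \<open>l\<close> derivatives for the
  power \<open>- l / q\<close>. The kind of damping is felt at low frequencies alone: at high ones
  only \<open>k5 \<le> d\<close> and \<open>d \<le> k5 * \<xi> ^ 2\<close> are used of the damping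
  coefficient \<open>d\<close>. For coupling through \<open>y\<close> or \<open>\<theta>\<close>,
  two products carry factors that vanish for equal wave speeds. Without this cancellation each of
  them costs another factor \<open>1 / \<xi> ^ 2\<close>, whence \<open>6\<close> instead of
  \<open>2\<close>. For coupling through \<open>u\<close>, the damping reaches the remaining
  components only through \<open>y + \<theta>\<close>. If \<open>k2 = k3\<close>, then
  \<open>y - \<theta>\<close> and \<open>z - \<phi>\<close> form a closed system that conserves its
  energy, so there is no decay; this is the origin of the condition on
  \<open>\<chi>\<close>.\<close>

definition dominated ::
  "('r \<Rightarrow> real \<Rightarrow> real) \<Rightarrow> ('r \<Rightarrow> real \<Rightarrow> real) \<Rightarrow> ('r \<Rightarrow> real \<Rightarrow> real)
    \<Rightarrow> real \<Rightarrow> real \<Rightarrow> 'r \<Rightarrow> bool" where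
  "dominated E T X \<delta> C r \<longleftrightarrow> (\<exists>F F'. \<forall>t. (F has_real_derivative F' t) (at t) \<and>
     \<bar>F t\<bar> \<le> C * E r t \<and> X r t \<le> F' t + \<delta> * T r t)"

text \<open>
  \<open>r\<close> ranges over trajectories, \<open>E\<close> is their energy and \<open>T\<close> the total quantity to be controlled.
  The constant \<open>C\<close> is uniform in \<open>r\<close>; that \<open>\<delta>\<close> is arbitrary is what makes products with one
  controlled factor controlled.
\<close>

definition controlled ::
  "'r set \<Rightarrow> ('r \<Rightarrow> real \<Rightarrow> real) \<Rightarrow> ('r \<Rightarrow> real \<Rightarrow> real) \<Rightarrow> ('r \<Rightarrow> real \<Rightarrow> real) \<Rightarrow> bool" where
  "controlled R E T X \<longleftrightarrow> (\<forall>\<delta>>0. \<exists>C\<ge>0. \<forall>r\<in>R. dominated E T X \<delta> C r)"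

section \<open>Rules for controlled quantities, ending in exponential decay\<close>

lemma dominatedI:
  assumes "\<And>t. (F has_real_derivative F' t) (at t)" "\<And>t. \<bar>F t\<bar> \<le> C * E r t"
    "\<And>t. X r t \<le> F' t + \<delta> * T r t"
  shows "dominated E T X \<delta> C r"
  unfolding dominated_def using assms by blast

lemma dominatedE:
  assumes "dominated E T X \<delta> C r"
  obtains F F' where "\<And>t. (F has_real_derivative F' t) (at t)" "\<And>t. \<bar>F t\<bar> \<le> C * E r t"
    "\<And>t. X r t \<le> F' t + \<delta> * T r t"
  using assms unfolding dominated_def by blast

lemma controlledE:
  assumes "controlled R E T X" "\<delta> > 0"
  obtains C where "C \<ge> 0" "\<And>r. r \<in> R \<Longrightarrow> dominated E T X \<delta> C r"
  using assms unfolding controlled_def by blast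

lemma controlled_deriv:
  assumes "\<And>r t. r \<in> R \<Longrightarrow> (F r has_real_derivative F' r t) (at t)"
    and "\<And>r t. r \<in> R \<Longrightarrow> \<bar>F r t\<bar> \<le> C * E r t" "C \<ge> 0"
    and "\<And>r t. r \<in> R \<Longrightarrow> T r t \<ge> (0::real)"
  shows "controlled R E T F'"
  unfolding controlled_def
proof (intro allI impI exI[of _ C] conjI ballI)
  show "dominated E T F' \<delta> C r" if "\<delta> > 0" "r \<in> R" for \<delta> r
    by (rule dominatedI[where F = "F r" and F' = "F' r"]) (use assms that in auto)
qed (use assms in simp)

lemma controlled_mono:
  assumes "controlled R E T X" and le: "\<And>r t. r \<in> R \<Longrightarrow> Y r t \<le> X r t"
  shows "controlled R E T Y"
  unfolding controlled_def
proof (intro allI impI)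
  fix \<delta> :: real assume "\<delta> > 0"
  then obtain C where C: "C \<ge> 0" "\<And>r. r \<in> R \<Longrightarrow> dominated E T X \<delta> C r"
    using controlledE[OF assms(1)] by blast
  have "dominated E T Y \<delta> C r" if "r \<in> R" for r
    using C(2)[OF that] by (rule dominatedE) (rule dominatedI, auto intro: order_trans[OF le[OF
      that]])
  with C(1) show "\<exists>C\<ge>0. \<forall>r\<in>R. dominated E T Y \<delta> C r" by blast
qed

lemma controlled_add:
  assumes "controlled R E T X" "controlled R E T Y"
  shows "controlled R E T (\<lambda>r t. X r t + Y r t)"
  unfolding controlled_def
proof (intro allI impI)
  fix \<delta> :: real assume "\<delta> > 0"
  then have h: "\<delta>/2 > 0" by simp
  obtain C where C: "C \<ge> 0" "\<And>r. r \<in> R \<Longrightarrow> dominated E T X (\<delta>/2) C r"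
    using controlledE[OF assms(1) h] by blast
  obtain D where D: "D \<ge> 0" "\<And>r. r \<in> R \<Longrightarrow> dominated E T Y (\<delta>/2) D r"
    using controlledE[OF assms(2) h] by blast
  have "dominated E T (\<lambda>r t. X r t + Y r t) \<delta> (C + D) r" if r: "r \<in> R" for r
  proof -
    obtain F F' where F: "\<And>t. (F has_real_derivative F' t) (at t)" "\<And>t. \<bar>F t\<bar> \<le> C * E r t"
       "\<And>t. X r t \<le> F' t + \<delta>/2 * T r t" using C(2)[OF r] by (rule dominatedE) blast
    obtain G G' where G: "\<And>t. (G has_real_derivative G' t) (at t)" "\<And>t. \<bar>G t\<bar> \<le> D * E r t"
       "\<And>t. Y r t \<le> G' t + \<delta>/2 * T r t" using D(2)[OF r] by (rule dominatedE) blast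
    show ?thesis
    proof (rule dominatedI)
      fix t
      show "((\<lambda>t. F t + G t) has_real_derivative F' t + G' t) (at t)"
        by (intro derivative_intros F G)
      show "\<bar>F t + G t\<bar> \<le> (C + D) * E r t" using F(2)[of t] G(2)[of t] by (simp add: algebra_simps)
      show "X r t + Y r t \<le> F' t + G' t + \<delta> * T r t"
        using F(3)[of t] G(3)[of t] by (simp add: algebra_simps)
    qed
  qed
  then show "\<exists>C\<ge>0. \<forall>r\<in>R. dominated E T (\<lambda>r t. X r t + Y r t) \<delta> C r"
    using C(1) D(1) by (intro exI[of _ "C + D"]) auto
qed

lemma controlled_cmult:
  assumes "controlled R E T X" "c > 0"
  shows "controlled R E T (\<lambda>r t. c * X r t)"
  unfolding controlled_def
proof (intro allI impI)
  fix \<delta> :: real assume "\<delta> > 0"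
  then have h: "\<delta>/c > 0" using assms by simp
  obtain C where C: "C \<ge> 0" "\<And>r. r \<in> R \<Longrightarrow> dominated E T X (\<delta>/c) C r"
    using controlledE[OF assms(1) h] by blast
  have "dominated E T (\<lambda>r t. c * X r t) \<delta> (c * C) r" if r: "r \<in> R" for r
  proof -
    obtain F F' where F: "\<And>t. (F has_real_derivative F' t) (at t)" "\<And>t. \<bar>F t\<bar> \<le> C * E r t"
       "\<And>t. X r t \<le> F' t + \<delta>/c * T r t" using C(2)[OF r] by (rule dominatedE) blast
    show ?thesis
    proof (rule dominatedI)
      fix t
      show "((\<lambda>t. c * F t) has_real_derivative c * F' t) (at t)" by (rule DERIV_cmult) (rule F)
      show "\<bar>c * F t\<bar> \<le> c * C * E r t" using F(2)[of t] assms(2) by (simp add: abs_mult)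
      show "c * X r t \<le> c * F' t + \<delta> * T r t"
        using mult_left_mono[OF F(3)[of t], of c] assms(2) by (simp add: algebra_simps)
    qed
  qed
  then show "\<exists>C\<ge>0. \<forall>r\<in>R. dominated E T (\<lambda>r t. c * X r t) \<delta> C r"
    using C(1) assms(2) by (intro exI[of _ "c * C"]) auto
qed

lemma controlled_small:
  assumes "\<And>\<delta>. \<delta> > 0 \<Longrightarrow> \<exists>X. controlled R E T X \<and> (\<forall>r\<in>R. \<forall>t. Y r t \<le> X r t + \<delta> * T r t)"
  shows "controlled R E T Y"
  unfolding controlled_def
proof (intro allI impI)
  fix \<delta> :: real assume "\<delta> > 0"
  then have h: "\<delta>/2 > 0" by simp
  obtain X where X: "controlled R E T X" "\<And>r t. r \<in> R \<Longrightarrow> Y r t \<le> X r t + \<delta>/2 * T r t"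
    using assms[OF h] by blast
  obtain C where C: "C \<ge> 0" "\<And>r. r \<in> R \<Longrightarrow> dominated E T X (\<delta>/2) C r"
    using controlledE[OF X(1) h] by blast
  have "dominated E T Y \<delta> C r" if r: "r \<in> R" for r
  proof -
    obtain F F' where F: "\<And>t. (F has_real_derivative F' t) (at t)" "\<And>t. \<bar>F t\<bar> \<le> C * E r t"
       "\<And>t. X r t \<le> F' t + \<delta>/2 * T r t" using C(2)[OF r] by (rule dominatedE) blast
    show ?thesis
    proof (rule dominatedI)
      show "(F has_real_derivative F' t) (at t)" "\<bar>F t\<bar> \<le> C * E r t" for t by (rule F)+
      show "Y r t \<le> F' t + \<delta> * T r t" for t
        using X(2)[OF r, of t] F(3)[of t] by (simp add: algebra_simps)
    qed
  qed
  then show "\<exists>C\<ge>0. \<forall>r\<in>R. dominated E T Y \<delta> C r" using C(1) by blast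
qed

text \<open>Young's inequality. The square of \<open>x\<close> may get a large constant because it
  is already controlled, and the square of \<open>y\<close> gets the small one because it is bounded
  by \<open>T\<close>. The condition on \<open>w\<close> says that the weight of the product is, up
  to a constant, at most the geometric mean of the weights of the two squares.\<close>

lemma controlled_prod:
  assumes X: "controlled R E T (\<lambda>r t. A r * (x r t)\<^sup>2)"
    and Y: "\<And>r t. r \<in> R \<Longrightarrow> B r * (y r t)\<^sup>2 \<le> L * T r t" "L > 0"
    and w: "\<And>r. r \<in> R \<Longrightarrow> (w r)\<^sup>2 \<le> K * (A r * B r)"
    and pos: "\<And>r. r \<in> R \<Longrightarrow> A r \<ge> 0" "\<And>r. r \<in> R \<Longrightarrow> B r \<ge> 0" "K > 0"
  shows "controlled R E T (\<lambda>r t. c * (w r * (x r t * y r t)))"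
proof (rule controlled_small)
  fix \<delta> :: real assume d: "\<delta> > 0"
  \<comment> \<open>This value makes \<open>p\<^sup>2\<close> at most \<open>4 * (P * Q)\<close>,
    hence at most \<open>(P + Q)\<^sup>2\<close>. The summand \<open>1\<close> in
    \<open>c\<^sup>2 + 1\<close> keeps it positive for \<open>c = 0\<close>.\<close>
  define M where "M = (c\<^sup>2 + 1) * K * L / (4 * \<delta>)"
  have M: "M > 0" unfolding M_def using d pos Y by (simp add: add_nonneg_pos)
  show "\<exists>X. controlled R E T X \<and> (\<forall>r\<in>R. \<forall>t. c * (w r * (x r t * y r t)) \<le> X r t + \<delta> * T r t)"
  proof (intro exI[of _ "\<lambda>r t. M * (A r * (x r t)\<^sup>2)"] conjI ballI allI controlled_cmult X M)
    fix r t assume r: "r \<in> R"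
    define p where "p = c * w r * x r t * y r t"
    define P where "P = M * (A r * (x r t)\<^sup>2)"
    define Q where "Q = \<delta> / L * (B r * (y r t)\<^sup>2)"
    have P0: "P \<ge> 0" "Q \<ge> 0" using r pos d Y(2) M unfolding P_def Q_def by auto
    have "p\<^sup>2 = c\<^sup>2 * (w r)\<^sup>2 * ((x r t)\<^sup>2 * (y r t)\<^sup>2)"
      unfolding p_def by (simp add: power_mult_distrib)
    also have "\<dots> \<le> (c\<^sup>2 + 1) * (K * (A r * B r)) * ((x r t)\<^sup>2 * (y r t)\<^sup>2)"
      using w[OF r] by (intro mult_right_mono mult_mono) auto
    also have "\<dots> = 4 * (P * Q)"
      unfolding P_def Q_def M_def using d Y(2) by (simp add: field_simps)
    also have "\<dots> \<le> (P + Q)\<^sup>2"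
      using sum_squares_bound[of P Q] by (simp add: power2_eq_square algebra_simps)
    finally have "\<bar>p\<bar> \<le> P + Q"
      using P0 by (simp add: abs_le_square_iff[symmetric])
    moreover have "Q \<le> \<delta> * T r t"
    proof -
      have "Q \<le> \<delta> / L * (L * T r t)" unfolding Q_def using Y d r
        by (intro mult_left_mono) auto
      then show ?thesis using Y(2) by simp
    qed
    ultimately show "c * (w r * (x r t * y r t)) \<le> M * (A r * (x r t)\<^sup>2) + \<delta> * T r t"
      unfolding p_def P_def by (simp add: mult_ac)
  qed
qed

lemma controlled_square:
  assumes X: "controlled R E T (\<lambda>r t. A r * (x r t)\<^sup>2)"
    and w: "\<And>r. r \<in> R \<Longrightarrow> w r \<le> K * A r" "K > 0"
    and pos: "\<And>r. r \<in> R \<Longrightarrow> A r \<ge> 0" and c: "c \<ge> 0"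
  shows "controlled R E T (\<lambda>r t. c * (w r * (x r t)\<^sup>2))"
proof -
  have "controlled R E T (\<lambda>r t. ((c+1) * K) * (A r * (x r t)\<^sup>2))"
    using c w by (intro controlled_cmult X) auto
  then show ?thesis
  proof (rule controlled_mono)
    fix r t assume r: "r \<in> R"
    have "c * (w r * (x r t)\<^sup>2) \<le> c * (K * A r * (x r t)\<^sup>2)"
      using r w c by (intro mult_left_mono mult_right_mono) auto
    also have "\<dots> \<le> (c+1) * (K * A r * (x r t)\<^sup>2)"
      using r w c pos by (intro mult_right_mono) auto
    finally show "c * (w r * (x r t)\<^sup>2) \<le> ((c+1) * K) * (A r * (x r t)\<^sup>2)" by (simp add: mult_ac)
  qed
qed

text \<open>With \<open>\<delta> = 1/2\<close> the quantity \<open>T\<close> absorbs half of itself,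
  so that \<open>T / 2 \<le> F'\<close>. As \<open>|F|\<close> is bounded by a multiple of the
  energy, a large multiple of \<open>E\<close> minus \<open>F\<close> is comparable with
  \<open>E\<close>, and its derivative is at most \<open>- \<rho> * E / 2\<close>: it is a Lyapunov
  functional.\<close>

lemma exponential_decay:
  assumes T: "controlled R E T T"
    and E: "\<And>r t. r \<in> R \<Longrightarrow> (E r has_real_derivative E' r t) (at t)" "\<And>r t. r \<in> R \<Longrightarrow> E' r t \<le> 0"
      "\<And>r t. r \<in> R \<Longrightarrow> E r t \<ge> 0"
    and \<rho>: "\<And>r t. r \<in> R \<Longrightarrow> \<rho> r * E r t \<le> T r t" "\<And>r. r \<in> R \<Longrightarrow> \<rho> r \<ge> 0"
  obtains c where "c > 0" "\<And>r t. r \<in> R \<Longrightarrow> t \<ge> 0 \<Longrightarrow> E r t \<le> 3 * exp (- c * \<rho> r * t) * E r 0"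
proof -
  obtain C where C: "C \<ge> 0" "\<And>r. r \<in> R \<Longrightarrow> dominated E T T (1/2) C r"
    using controlledE[OF T, of "1/2"] by auto
  \<comment> \<open>\<open>D\<close> is positive even if \<open>C = 0\<close>. Since
    \<open>2 * D * E - F\<close> lies between \<open>D * E\<close> and \<open>3 * D * E\<close>, the
    final estimate has the factor \<open>3\<close>, and \<open>3 * D * c\<close> must be
    \<open>1/2\<close>.\<close>
  define D where "D = C + 1"
  have D: "D > 0" "C \<le> D" using C(1) by (auto simp: D_def)
  define c where "c = 1 / (6 * D)"
  show ?thesis
  proof (rule that[of c])
    show "c > 0" using D by (simp add: c_def)
    fix r and t :: real assume r: "r \<in> R" and t: "t \<ge> 0"
    obtain F F' where F: "\<And>t. (F has_real_derivative F' t) (at t)" "\<And>t. \<bar>F t\<bar> \<le> C * E r t"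
       "\<And>t. T r t \<le> F' t + 1/2 * T r t" using C(2)[OF r] by (rule dominatedE) blast
    have F2: "\<bar>F t\<bar> \<le> D * E r t" for t
      using F(2)[of t] E(3)[OF r, of t] D(2) by (meson mult_right_mono order_trans)
    define G where "G = (\<lambda>t. (2 * D * E r t - F t) * exp (c * \<rho> r * t))"
    have dG: "(G has_real_derivative (2 * D * E' r t - F' t) * exp (c * \<rho> r * t)
         + (2 * D * E r t - F t) * (c * \<rho> r * exp (c * \<rho> r * t))) (at t)" for t
      unfolding G_def by (auto intro!: derivative_eq_intros E(1)[OF r] F(1) simp: algebra_simps)
    have neg: "(2 * D * E' r t - F' t) * exp (c * \<rho> r * t)
         + (2 * D * E r t - F t) * (c * \<rho> r * exp (c * \<rho> r * t)) \<le> 0" for t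
    proof -
      have "(2 * D * E r t - F t) * (c * \<rho> r) \<le> (3 * D * E r t) * (c * \<rho> r)"
        using F2[of t] \<rho>(2)[OF r] D by (intro mult_right_mono) (auto simp: c_def)
      also have "\<dots> = \<rho> r * E r t / 2" using D by (simp add: c_def field_simps)
      also have "\<dots> \<le> T r t / 2" using \<rho>(1)[OF r, of t] by simp
      also have "\<dots> \<le> F' t" using F(3)[of t] by simp
      finally have 1: "(2 * D * E r t - F t) * (c * \<rho> r) \<le> F' t" .
      have 2: "2 * D * E' r t \<le> 0" using D E(2)[OF r, of t] by (simp add: mult_nonneg_nonpos)
      have "((2 * D * E' r t - F' t) + (2 * D * E r t - F t) * (c * \<rho> r)) * exp (c * \<rho> r * t) \<le> 0"
        using 1 2 by (intro mult_nonpos_nonneg) auto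
      then show ?thesis by (simp add: algebra_simps)
    qed
    have "G t \<le> G 0"
      using DERIV_nonpos_imp_nonincreasing[OF t, of G] dG neg by blast
    then have "(D * E r t) * exp (c * \<rho> r * t) \<le> 3 * D * E r 0"
    proof -
      have "(D * E r t) * exp (c * \<rho> r * t) \<le> (2 * D * E r t - F t) * exp (c * \<rho> r * t)"
        using F2[of t] by (intro mult_right_mono) auto
      also have "\<dots> \<le> G 0" using \<open>G t \<le> G 0\<close> by (simp add: G_def)
      also have "\<dots> \<le> 3 * D * E r 0" using F2[of 0] by (simp add: G_def)
      finally show ?thesis .
    qed
    then have "E r t * exp (c * \<rho> r * t) \<le> 3 * E r 0" using D by simp
    then have "E r t * exp (c * \<rho> r * t) * exp (- (c * \<rho> r * t))
      \<le> 3 * E r 0 * exp (- (c * \<rho> r * t))"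
      by (intro mult_right_mono) auto
    then show "E r t \<le> 3 * exp (- c * \<rho> r * t) * E r 0"
      by (simp add: exp_minus field_simps)
  qed
qed


text \<open>A total derivative is controlled with either sign, so \<open>c\<close> is arbitrary
  here, whereas \<open>controlled_cmult\<close> needs a positive factor. All multipliers below have
  this form.\<close>

lemma controlled_deriv_prod:
  assumes "\<And>r t. r \<in> R \<Longrightarrow> (x r has_real_derivative x' r t) (at t)"
    and "\<And>r t. r \<in> R \<Longrightarrow> (y r has_real_derivative y' r t) (at t)"
    and "\<And>r t. r \<in> R \<Longrightarrow> (x r t)\<^sup>2 \<le> E r t" "\<And>r t. r \<in> R \<Longrightarrow> (y r t)\<^sup>2 \<le> E r t"
    and "\<And>r. r \<in> R \<Longrightarrow> \<bar>w r\<bar> \<le> K" "K \<ge> 0"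
    and "\<And>r t. r \<in> R \<Longrightarrow> T r t \<ge> 0"
  shows "controlled R E T (\<lambda>r t. c * (w r * (x' r t * y r t + x r t * y' r t)))"
proof (rule controlled_deriv[where F = "\<lambda>r t. c * (w r * (x r t * y r t))" and C = "\<bar>c\<bar> * K"])
  fix r t assume r: "r \<in> R"
  show "((\<lambda>t. c * (w r * (x r t * y r t))) has_real_derivative
      c * (w r * (x' r t * y r t + x r t * y' r t))) (at t)"
    by (auto intro!: derivative_eq_intros assms(1,2) r simp: algebra_simps)
  have "2 * \<bar>x r t * y r t\<bar> \<le> (x r t)\<^sup>2 + (y r t)\<^sup>2"
    using sum_squares_bound[of "\<bar>x r t\<bar>" "\<bar>y r t\<bar>"] by (simp add: abs_mult)
  then have "\<bar>x r t * y r t\<bar> \<le> E r t" using assms(3,4)[OF r, of t] by linarith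
  then have "\<bar>w r\<bar> * \<bar>x r t * y r t\<bar> \<le> K * E r t"
    using assms(5)[OF r] assms(6) by (intro mult_mono) auto
  then have "\<bar>c\<bar> * (\<bar>w r\<bar> * \<bar>x r t * y r t\<bar>) \<le> \<bar>c\<bar> * (K * E r t)"
    by (intro mult_left_mono) auto
  then show "\<bar>c * (w r * (x r t * y r t))\<bar> \<le> \<bar>c\<bar> * K * E r t"
    by (simp add: abs_mult mult_ac)
qed (use assms in auto)

lemma controlled_damping:
  assumes "\<And>r t. r \<in> R \<Longrightarrow> (E r has_real_derivative - 2 * X r t) (at t)"
    and "\<And>r t. r \<in> R \<Longrightarrow> E r t \<ge> 0" "\<And>r t. r \<in> R \<Longrightarrow> T r t \<ge> 0"
  shows "controlled R E T X"
proof (rule controlled_deriv[where F = "\<lambda>r t. - E r t / 2" and C = 1])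
  show "((\<lambda>t. - E r t / 2) has_real_derivative X r t) (at t)" if "r \<in> R" for r t
    by (auto intro!: derivative_eq_intros assms(1) that)
  show "\<bar>- E r t / 2\<bar> \<le> 1 * E r t" if "r \<in> R" for r t
    using assms(2)[OF that, of t] by simp
qed (use assms in auto)

text \<open>
  \<open>d, s, m, n, q, \<kappa>, p, f\<close> are the weights of \<open>H\<^sup>2, S\<^sup>2, Y\<^sup>2, V\<^sup>2, Z\<^sup>2, \<Theta>\<^sup>2, U\<^sup>2, \<Phi>\<^sup>2\<close> in the
    dissipation below.
  Each group of conditions says that the multiplier producing the respective square is bounded by
  the energy and that its error terms can be absorbed.
\<close>

definition weights_y ::
    "real \<Rightarrow> real \<Rightarrow> real \<Rightarrow> real \<Rightarrow> real \<Rightarrow> real \<Rightarrow> real \<Rightarrow> real \<Rightarrow> real \<Rightarrow> real \<Rightarrow> real \<Rightarrow> real \<Rightarrow> real \<Rightarrow>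
      real \<Rightarrow> bool" where
  "weights_y a b c K \<xi> d s m n q \<kappa> p f \<rho> \<longleftrightarrow>
     \<xi> \<noteq> 0 \<and>
     (0 \<le> d \<and> 0 \<le> s \<and> 0 \<le> m \<and> 0 \<le> n \<and> 0 \<le> q \<and> 0 \<le> \<kappa> \<and> 0 \<le> p \<and> 0 \<le> f \<and> 0 \<le> \<rho>) \<and>
     (\<bar>s / \<xi>\<bar> \<le> K \<and> \<bar>s / \<xi>\<^sup>2\<bar> \<le> K \<and> s \<le> K * d \<and> (s * d / \<xi>)\<^sup>2 \<le> K * (d * s) \<and>
      (s / \<xi>)\<^sup>2 \<le> K * (d * q)) \<and>
     (\<bar>m\<bar> \<le> K \<and> m \<le> K * d \<and> (m * \<xi>)\<^sup>2 \<le> K * (s * m) \<and> (m * d)\<^sup>2 \<le> K * (d * m) \<and>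
      (m * \<xi>)\<^sup>2 \<le> K * (d * q) \<and> m\<^sup>2 \<le> K * (d * n)) \<and>
     (\<bar>n\<bar> \<le> K \<and> n\<^sup>2 \<le> K * (d * n) \<and> n \<le> K * m \<and> n\<^sup>2 \<le> K * (m * \<kappa>) \<and>
      (a = b \<or> (n * \<xi>)\<^sup>2 \<le> K * (m * p))) \<and>
     (\<bar>q / \<xi>\<bar> \<le> K \<and> q \<le> K * m \<and> (q / \<xi>)\<^sup>2 \<le> K * (n * q) \<and> (q / \<xi>)\<^sup>2 \<le> K * (d * q)) \<and>
     (\<bar>\<kappa>\<bar> \<le> K \<and> \<kappa>\<^sup>2 \<le> K * (m * \<kappa>) \<and> \<kappa> \<le> K * n \<and> (a = c \<or> (\<kappa> * \<xi>)\<^sup>2 \<le> K * (n * f))) \<and>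
     (\<bar>p / \<xi>\<bar> \<le> K \<and> p \<le> K * n \<and> (p / \<xi>)\<^sup>2 \<le> K * (m * p) \<and> (p / \<xi>)\<^sup>2 \<le> K * (\<kappa> * p)) \<and>
     (\<bar>f / \<xi>\<bar> \<le> K \<and> f \<le> K * \<kappa> \<and> (f / \<xi>)\<^sup>2 \<le> K * (n * f)) \<and>
     (\<rho> \<le> d \<and> \<rho> \<le> s \<and> \<rho> \<le> m \<and> \<rho> \<le> n \<and> \<rho> \<le> q \<and> \<rho> \<le> \<kappa> \<and> \<rho> \<le> p \<and> \<rho> \<le> f)"

text \<open>The variables are scaled so that all couplings cancel in the derivative of
  \<open>E\<close> and only the damping of \<open>H\<close> is left. Control passes from
  \<open>H\<close> to \<open>S\<close> and \<open>Y\<close>, then to \<open>V\<close>, and from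
  there to the other components. Each nested \<open>add[...]\<close> spells out an identity for one
  weighted square in terms of controlled squares, products with one controlled factor, and total
  derivatives; the concluding simplification verifies the identity and the conditions on the
  weights.\<close>

proposition decay_coupled_y:
  fixes a b c e g K :: real and R :: "'r set" and \<xi> d s m n q \<kappa> p f \<rho> :: "'r \<Rightarrow> real"
    and V U Z Y \<Phi> \<Theta> S H :: "'r \<Rightarrow> real \<Rightarrow> real"
  assumes pos: "a > 0" "b > 0" "c > 0" "e > 0" "g \<noteq> 0" "K > 0"
    and V': "\<And>r t. r \<in> R \<Longrightarrow> (V r has_real_derivative a * (Y r t + \<Theta> r t - \<xi> r * U r t)) (at t)"
    and U': "\<And>r t. r \<in> R \<Longrightarrow> (U r has_real_derivative a * \<xi> r * V r t) (at t)"
    and Z': "\<And>r t. r \<in> R \<Longrightarrow> (Z r has_real_derivative b * \<xi> r * Y r t) (at t)"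
    and Y': "\<And>r t. r \<in> R \<Longrightarrow>
      (Y r has_real_derivative - b * \<xi> r * Z r t - a * V r t - g * H r t) (at t)"
    and \<Phi>': "\<And>r t. r \<in> R \<Longrightarrow> (\<Phi> r has_real_derivative c * \<xi> r * \<Theta> r t) (at t)"
    and \<Theta>': "\<And>r t. r \<in> R \<Longrightarrow> (\<Theta> r has_real_derivative - c * \<xi> r * \<Phi> r t - a * V r t) (at t)"
    and S': "\<And>r t. r \<in> R \<Longrightarrow> (S r has_real_derivative e * \<xi> r * H r t) (at t)"
    and H': "\<And>r t. r \<in> R \<Longrightarrow>
      (H r has_real_derivative - e * \<xi> r * S r t - d r * H r t + g * Y r t) (at t)"
    and W: "\<And>r. r \<in> R \<Longrightarrow> weights_y a b c K (\<xi> r) (d r) (s r) (m r) (n r) (q r) (\<kappa> r) (p r) (f r)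
      (\<rho> r)"
  defines "E \<equiv> \<lambda>r t. (V r t)\<^sup>2 + (U r t)\<^sup>2 + (Z r t)\<^sup>2 + (Y r t)\<^sup>2 + (\<Phi> r t)\<^sup>2 + (\<Theta> r t)\<^sup>2
    + (S r t)\<^sup>2 + (H r t)\<^sup>2"
  obtains \<omega> where "\<omega> > 0" "\<And>r t. r \<in> R \<Longrightarrow> t \<ge> 0 \<Longrightarrow> E r t \<le> 3 * exp (- \<omega> * \<rho> r * t) * E r 0"
proof -
  note W0 = W[unfolded weights_y_def]
  note \<xi> = W0[THEN conjunct1] and W1 = W0[THEN conjunct2]
  note w0 = W1[THEN conjunct1] and W2 = W1[THEN conjunct2]
  note ws = W2[THEN conjunct1] and W3 = W2[THEN conjunct2]
  note wm = W3[THEN conjunct1] and W4 = W3[THEN conjunct2]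
  note wn = W4[THEN conjunct1] and W5 = W4[THEN conjunct2]
  note wq = W5[THEN conjunct1] and W6 = W5[THEN conjunct2]
  note w\<kappa> = W6[THEN conjunct1] and W7 = W6[THEN conjunct2]
  note wp = W7[THEN conjunct1] and W8 = W7[THEN conjunct2]
  note wf = W8[THEN conjunct1] and \<rho> = W8[THEN conjunct2]
  define T where "T = (\<lambda>r t. d r * (H r t)\<^sup>2 + (s r * (S r t)\<^sup>2 + (m r * (Y r t)\<^sup>2
    + (n r * (V r t)\<^sup>2 +
    (q r * (Z r t)\<^sup>2 + (\<kappa> r * (\<Theta> r t)\<^sup>2 + (p r * (U r t)\<^sup>2 + f r * (\<Phi> r t)\<^sup>2)))))))"
  note w0 [simp]
  have T0: "T r t \<ge> 0" if "r \<in> R" for r t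
    using that by (auto simp: T_def)
  have E0: "E r t \<ge> 0" for r t by (auto simp: E_def)
  have TH: "d r * (H r t)\<^sup>2 \<le> 1 * T r t" and TS: "s r * (S r t)\<^sup>2 \<le> 1 * T r t"
    and TY: "m r * (Y r t)\<^sup>2 \<le> 1 * T r t" and TV: "n r * (V r t)\<^sup>2 \<le> 1 * T r t"
    and TZ: "q r * (Z r t)\<^sup>2 \<le> 1 * T r t" and T\<Theta>: "\<kappa> r * (\<Theta> r t)\<^sup>2 \<le> 1 * T r t"
    and TU: "p r * (U r t)\<^sup>2 \<le> 1 * T r t" and T\<Phi>: "f r * (\<Phi> r t)\<^sup>2 \<le> 1 * T r t"
    if "r \<in> R" for r t
    using that by (auto simp: T_def intro!: add_increasing add_increasing2)
  have EV: "(V r t)\<^sup>2 \<le> E r t" and EU: "(U r t)\<^sup>2 \<le> E r t" and EZ: "(Z r t)\<^sup>2 \<le> E r t"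
    and EY: "(Y r t)\<^sup>2 \<le> E r t" and E\<Phi>: "(\<Phi> r t)\<^sup>2 \<le> E r t" and E\<Theta>: "(\<Theta> r t)\<^sup>2 \<le> E r t"
    and ES: "(S r t)\<^sup>2 \<le> E r t" and EH: "(H r t)\<^sup>2 \<le> E r t"
    if "r \<in> R" for r t
    by (auto simp: E_def intro!: add_increasing add_increasing2)
  have E': "(E r has_real_derivative - 2 * (d r * (H r t)\<^sup>2)) (at t)" if "r \<in> R" for r t
    unfolding E_def using that
    by (auto intro!: derivative_eq_intros V' U' Z' Y' \<Phi>' \<Theta>' S' H'
      simp: algebra_simps power2_eq_square)
  have K0: "K \<ge> 0" using pos by simp
  note prod = controlled_prod[where R = R and E = E and T = T and K = K and L = 1,
      OF _ _ zero_less_one _ _ _ pos(6)]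
  note square = controlled_square[where R = R and E = E and T = T and K = K, OF _ _ pos(6)]
  note dprod = controlled_deriv_prod[where R = R and E = E and T = T and K = K, OF _ _ _ _ _ K0 T0]
  note add = controlled_add[where R = R and E = E and T = T]
  have cH: "controlled R E T (\<lambda>r t. d r * (H r t)\<^sup>2)"
    by (rule controlled_damping[OF E' E0 T0])
  \<comment> \<open>The error term \<open>SY\<close> is not small, but \<open>\<xi>Y = Z'/b\<close> makes it a derivative up to \<open>HZ\<close>.\<close>
  have cS: "controlled R E T (\<lambda>r t. s r * (S r t)\<^sup>2)"
    by (rule controlled_mono, rule add[OF square[OF cH, of s 1]
          add[OF prod[OF cH TS, of "\<lambda>r. s r * d r / \<xi> r" "- 1 / e"]
          add[OF prod[OF cH TZ, of "\<lambda>r. s r / \<xi> r" "- g / b"]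
          add[OF dprod[OF S' H' ES EH, of "\<lambda>r. s r / \<xi> r" "- 1 / e"]
              dprod[OF S' Z' ES EZ, of "\<lambda>r. s r / (\<xi> r)\<^sup>2" "g / (b * e)"]]]]])
       (use ws pos \<xi> in \<open>auto simp: field_simps power2_eq_square\<close>)
  \<comment> \<open>The multiplier is \<open>H * Y\<close>: the term \<open>g * Y\<close> in the
    equation of \<open>H\<close> produces the square.\<close>
  have cY: "controlled R E T (\<lambda>r t. m r * (Y r t)\<^sup>2)"
    by (rule controlled_mono, rule add[OF square[OF cH, of m 1]
          add[OF prod[OF cS TY, of "\<lambda>r. m r * \<xi> r" "e / g"]
          add[OF prod[OF cH TY, of "\<lambda>r. m r * d r" "1 / g"]
          add[OF prod[OF cH TZ, of "\<lambda>r. m r * \<xi> r" "b / g"]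
          add[OF prod[OF cH TV, of "\<lambda>r. m r" "a / g"]
              dprod[OF H' Y' EH EY, of "\<lambda>r. m r" "1 / g"]]]]]])
       (use wm pos \<xi> in \<open>auto simp: field_simps power2_eq_square\<close>)
  \<comment> \<open>The prefactors here and in \<open>cV\<Phi>\<close> vanish for equal wave speeds.\<close>
  have cYU: "controlled R E T (\<lambda>r t. (b\<^sup>2 / a\<^sup>2 - 1) * (n r * \<xi> r * (Y r t * U r t)))"
  proof (cases "a = b")
    case True
    \<comment> \<open>The claim is now that the zero function is controlled; a multiplier with
      constant \<open>0\<close> provides this.\<close>
    then show ?thesis using pos dprod[OF H' Y' EH EY, of m 0] wm by simp
  next
    case False
    then show ?thesis
      by (intro prod[OF cY TU]) (use wn in auto)
  qed
  \<comment> \<open>The derivative of \<open>Y * V\<close> yields the square together with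
    \<open>\<xi> * Z * V\<close> and \<open>\<xi> * Y * U\<close>. That of \<open>Z * U\<close>
    trades the former for the latter, and the coefficients of \<open>\<xi> * Y * U\<close> add up to
    \<open>b\<^sup>2 / a\<^sup>2 - 1\<close>.\<close>
  have cV: "controlled R E T (\<lambda>r t. n r * (V r t)\<^sup>2)"
    by (rule controlled_mono, rule add[OF square[OF cY, of n 1]
          add[OF prod[OF cH TV, of "\<lambda>r. n r" "- g / a"]
          add[OF prod[OF cY T\<Theta>, of "\<lambda>r. n r" 1]
          add[OF cYU
          add[OF dprod[OF Y' V' EY EV, of "\<lambda>r. n r" "- 1 / a"]
              dprod[OF Z' U' EZ EU, of "\<lambda>r. n r" "- b / a\<^sup>2"]]]]]])
       (use wn pos \<xi> in \<open>auto simp: field_simps power2_eq_square\<close>)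
  \<comment> \<open>Equipartition: the derivative of \<open>Y * Z\<close> contains
    \<open>Y\<^sup>2\<close> and \<open>Z\<^sup>2\<close> with opposite signs, so control of one
    square gives control of the other. The arguments for \<open>U\<close> and \<open>\<Phi>\<close>
    are of the same kind.\<close>
  have cZ: "controlled R E T (\<lambda>r t. q r * (Z r t)\<^sup>2)"
    by (rule controlled_mono, rule add[OF square[OF cY, of q 1]
          add[OF prod[OF cV TZ, of "\<lambda>r. q r / \<xi> r" "- a / b"]
          add[OF prod[OF cH TZ, of "\<lambda>r. q r / \<xi> r" "- g / b"]
              dprod[OF Y' Z' EY EZ, of "\<lambda>r. q r / \<xi> r" "- 1 / b"]]]])
       (use wq pos \<xi> in \<open>auto simp: field_simps power2_eq_square\<close>)
  have cV\<Phi>: "controlled R E T (\<lambda>r t. (c / a - a / c) * (\<kappa> r * \<xi> r * (V r t * \<Phi> r t)))"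
  proof (cases "a = c")
    case True
    then show ?thesis using pos dprod[OF H' Y' EH EY, of m 0] wm by simp
  next
    case False
    then show ?thesis
      by (intro prod[OF cV T\<Phi>]) (use w\<kappa> in auto)
  qed
  \<comment> \<open>The derivative of \<open>V * \<Theta>\<close> leaves
    \<open>\<xi> * U * \<Theta>\<close> and \<open>\<xi> * V * \<Phi>\<close>, and that of
    \<open>U * \<Phi>\<close> trades the first for the second.\<close>
  have c\<Theta>: "controlled R E T (\<lambda>r t. \<kappa> r * (\<Theta> r t)\<^sup>2)"
    by (rule controlled_mono, rule add[OF square[OF cV, of \<kappa> 1]
          add[OF prod[OF cY T\<Theta>, of "\<lambda>r. \<kappa> r" "- 1"]
          add[OF cV\<Phi>
          add[OF dprod[OF V' \<Theta>' EV E\<Theta>, of "\<lambda>r. \<kappa> r" "1 / a"]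
              dprod[OF U' \<Phi>' EU E\<Phi>, of "\<lambda>r. \<kappa> r" "1 / c"]]]]])
       (use w\<kappa> pos \<xi> in \<open>auto simp: field_simps power2_eq_square\<close>)
  have cU: "controlled R E T (\<lambda>r t. p r * (U r t)\<^sup>2)"
    by (rule controlled_mono, rule add[OF square[OF cV, of p 1]
          add[OF prod[OF cY TU, of "\<lambda>r. p r / \<xi> r" 1]
          add[OF prod[OF c\<Theta> TU, of "\<lambda>r. p r / \<xi> r" 1]
              dprod[OF U' V' EU EV, of "\<lambda>r. p r / \<xi> r" "- 1 / a"]]]])
       (use wp pos \<xi> in \<open>auto simp: field_simps power2_eq_square\<close>)
  have c\<Phi>: "controlled R E T (\<lambda>r t. f r * (\<Phi> r t)\<^sup>2)"
    by (rule controlled_mono, rule add[OF square[OF c\<Theta>, of f 1]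
          add[OF prod[OF cV T\<Phi>, of "\<lambda>r. f r / \<xi> r" "- a / c"]
              dprod[OF \<Theta>' \<Phi>' E\<Theta> E\<Phi>, of "\<lambda>r. f r / \<xi> r" "- 1 / c"]]])
       (use wf pos \<xi> in \<open>auto simp: field_simps power2_eq_square\<close>)
  have cT: "controlled R E T T"
    unfolding T_def by (intro controlled_add; unfold T_def[symmetric]; fact)
  have \<rho>E: "\<rho> r * E r t \<le> T r t" if r: "r \<in> R" for r t
  proof -
    have w: "\<rho> r \<le> d r" "\<rho> r \<le> s r" "\<rho> r \<le> m r" "\<rho> r \<le> n r" "\<rho> r \<le> q r" "\<rho> r \<le> \<kappa> r"
      "\<rho> r \<le> p r" "\<rho> r \<le> f r"
      using \<rho> r by auto
    have "\<rho> r * (H r t)\<^sup>2 \<le> d r * (H r t)\<^sup>2" "\<rho> r * (S r t)\<^sup>2 \<le> s r * (S r t)\<^sup>2"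
      "\<rho> r * (Y r t)\<^sup>2 \<le> m r * (Y r t)\<^sup>2" "\<rho> r * (V r t)\<^sup>2 \<le> n r * (V r t)\<^sup>2"
      "\<rho> r * (Z r t)\<^sup>2 \<le> q r * (Z r t)\<^sup>2" "\<rho> r * (\<Theta> r t)\<^sup>2 \<le> \<kappa> r * (\<Theta> r t)\<^sup>2"
      "\<rho> r * (U r t)\<^sup>2 \<le> p r * (U r t)\<^sup>2" "\<rho> r * (\<Phi> r t)\<^sup>2 \<le> f r * (\<Phi> r t)\<^sup>2"
      by (rule mult_right_mono[OF w(1)] mult_right_mono[OF w(2)] mult_right_mono[OF w(3)]
          mult_right_mono[OF w(4)] mult_right_mono[OF w(5)] mult_right_mono[OF w(6)]
          mult_right_mono[OF w(7)] mult_right_mono[OF w(8)], simp)+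
    then show ?thesis unfolding E_def T_def by (simp add: distrib_left)
  qed
  show ?thesis
    by (rule exponential_decay[where T = T and \<rho> = \<rho>, OF cT E' _ E0 \<rho>E])
      (auto intro: that)
qed

text \<open>\<open>d, s, \<mu>, m, n, k\<close> weigh the squares of \<open>H\<close>,
  \<open>S\<close>, \<open>g * U - e * \<xi> * S\<close>, \<open>U\<close>, \<open>V\<close> and
  \<open>Y + \<Theta>\<close>, and \<open>q\<close> weighs those of \<open>Y\<close>,
  \<open>\<Theta>\<close>, \<open>Z\<close> and \<open>\<Phi>\<close>. The two combinations are
  auxiliary, so the rate \<open>\<rho>\<close> is compared with the weights of the components only.
  As for \<open>weights_y\<close>, the groups of conditions belong to the successive
  multipliers.\<close>

definition weights_u ::
    "real \<Rightarrow> real \<Rightarrow> real \<Rightarrow> real \<Rightarrow> real \<Rightarrow> real \<Rightarrow> real \<Rightarrow> real \<Rightarrow> real \<Rightarrow> real \<Rightarrow> bool" where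
  "weights_u K \<xi> d s \<mu> m n k q \<rho> \<longleftrightarrow>
     \<xi> \<noteq> 0 \<and>
     (0 \<le> d \<and> 0 \<le> s \<and> 0 \<le> \<mu> \<and> 0 \<le> m \<and> 0 \<le> n \<and> 0 \<le> k \<and> 0 \<le> q \<and> 0 \<le> \<rho>) \<and>
     (\<bar>s / \<xi>\<bar> \<le> K \<and> \<bar>s / \<xi>\<^sup>2\<bar> \<le> K \<and> \<bar>s / \<xi>^3\<bar> \<le> K \<and> s \<le> K * d \<and>
      (s * d / \<xi>)\<^sup>2 \<le> K * (d * s) \<and> (s / \<xi>)\<^sup>2 \<le> K * (d * n) \<and> (s / \<xi>\<^sup>2)\<^sup>2 \<le> K * (d * q)) \<and>
     (\<bar>\<mu>\<bar> \<le> K \<and> \<bar>\<mu> * \<xi>\<bar> \<le> K \<and> \<mu> \<le> K * d \<and> \<mu> * \<xi>\<^sup>2 \<le> K * d \<and> (\<mu> * d)\<^sup>2 \<le> K * (d * \<mu>) \<and>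
      (\<mu> * \<xi>)\<^sup>2 \<le> K * (d * n)) \<and>
     (m \<le> K * \<mu> \<and> m * \<xi>\<^sup>2 \<le> K * s) \<and>
     (\<bar>n / \<xi>\<bar> \<le> K \<and> (n / \<xi>)\<^sup>2 \<le> K * (d * n) \<and> n \<le> K * m \<and> (n / \<xi>)\<^sup>2 \<le> K * (\<mu> * k) \<and>
      n\<^sup>2 \<le> K * (d * q)) \<and>
     (\<bar>k\<bar> \<le> K \<and> (k * \<xi>)\<^sup>2 \<le> K * (m * k) \<and> (k * \<xi>)\<^sup>2 \<le> K * (n * q) \<and> k \<le> K * n) \<and>
     (\<bar>q / \<xi>\<bar> \<le> K \<and> (q / \<xi>)\<^sup>2 \<le> K * (n * q) \<and> q \<le> K * k \<and> q\<^sup>2 \<le> K * (k * q) \<and> q \<le> K * q \<and>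
      q\<^sup>2 \<le> K * (q * q)) \<and>
     (\<rho> \<le> d \<and> \<rho> \<le> s \<and> \<rho> \<le> m \<and> \<rho> \<le> n \<and> \<rho> \<le> q)"

text \<open>From \<open>V\<close> the control first reaches the sum \<open>W = Y + \<Theta>\<close>,
  and the difficulty is to separate its summands. With \<open>B = b * Z + c * \<Phi>\<close> one has
  \<open>W' = - \<xi> * B - 2 * a * V\<close> and
  \<open>B' = \<xi> * (b\<^sup>2 * Y + c\<^sup>2 * \<Theta>)\<close>. Hence a second combination of
  \<open>Y\<close> and \<open>\<Theta>\<close> becomes accessible, and it is independent of
  \<open>W\<close> precisely because \<open>b\<^sup>2 \<noteq> c\<^sup>2\<close>.\<close>

proposition decay_coupled_u:
  fixes a b c e g K :: real and R :: "'r set" and \<xi> d s \<mu> m n k q \<rho> :: "'r \<Rightarrow> real"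
    and V U Z Y \<Phi> \<Theta> S H :: "'r \<Rightarrow> real \<Rightarrow> real"
  assumes pos: "a > 0" "b > 0" "c > 0" "e > 0" "g \<noteq> 0" "K > 0" and bc: "b\<^sup>2 \<noteq> c\<^sup>2"
    and V': "\<And>r t. r \<in> R \<Longrightarrow> (V r has_real_derivative a * (Y r t + \<Theta> r t - \<xi> r * U r t)) (at t)"
    and U': "\<And>r t. r \<in> R \<Longrightarrow> (U r has_real_derivative a * \<xi> r * V r t - g * H r t) (at t)"
    and Z': "\<And>r t. r \<in> R \<Longrightarrow> (Z r has_real_derivative b * \<xi> r * Y r t) (at t)"
    and Y': "\<And>r t. r \<in> R \<Longrightarrow> (Y r has_real_derivative - b * \<xi> r * Z r t - a * V r t) (at t)"
    and \<Phi>': "\<And>r t. r \<in> R \<Longrightarrow> (\<Phi> r has_real_derivative c * \<xi> r * \<Theta> r t) (at t)"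
    and \<Theta>': "\<And>r t. r \<in> R \<Longrightarrow> (\<Theta> r has_real_derivative - c * \<xi> r * \<Phi> r t - a * V r t) (at t)"
    and S': "\<And>r t. r \<in> R \<Longrightarrow> (S r has_real_derivative e * \<xi> r * H r t) (at t)"
    and H': "\<And>r t. r \<in> R \<Longrightarrow>
      (H r has_real_derivative - e * \<xi> r * S r t - d r * H r t + g * U r t) (at t)"
    and W: "\<And>r. r \<in> R \<Longrightarrow> weights_u K (\<xi> r) (d r) (s r) (\<mu> r) (m r) (n r) (k r) (q r) (\<rho> r)"
  defines "E \<equiv> \<lambda>r t. (V r t)\<^sup>2 + (U r t)\<^sup>2 + (Z r t)\<^sup>2 + (Y r t)\<^sup>2 + (\<Phi> r t)\<^sup>2 + (\<Theta> r t)\<^sup>2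
    + (S r t)\<^sup>2 + (H r t)\<^sup>2"
  obtains \<omega> where "\<omega> > 0" "\<And>r t. r \<in> R \<Longrightarrow> t \<ge> 0 \<Longrightarrow> E r t \<le> 3 * exp (- \<omega> * \<rho> r * t) * E r 0"
proof -
  note W0 = W[unfolded weights_u_def]
  note \<xi> = W0[THEN conjunct1] and W1 = W0[THEN conjunct2]
  note w0 = W1[THEN conjunct1] and W2 = W1[THEN conjunct2]
  note ws = W2[THEN conjunct1] and W3 = W2[THEN conjunct2]
  note w\<mu> = W3[THEN conjunct1] and W4 = W3[THEN conjunct2]
  note wm = W4[THEN conjunct1] and W5 = W4[THEN conjunct2]
  note wn = W5[THEN conjunct1] and W6 = W5[THEN conjunct2]
  note wk = W6[THEN conjunct1] and W7 = W6[THEN conjunct2]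
  note wq = W7[THEN conjunct1] and \<rho> = W7[THEN conjunct2]
  define X where "X = (\<lambda>r t. g * U r t - e * \<xi> r * S r t)"
  define W where "W = (\<lambda>r t. Y r t + \<Theta> r t)"
  define B where "B = (\<lambda>r t. b * Z r t + c * \<Phi> r t)"
  define T where "T = (\<lambda>r t. d r * (H r t)\<^sup>2 + (s r * (S r t)\<^sup>2 + (\<mu> r * (X r t)\<^sup>2
    + (m r * (U r t)\<^sup>2 +
    (n r * (V r t)\<^sup>2 + (k r * (W r t)\<^sup>2 + (q r * (Y r t)\<^sup>2 + (q r * (\<Theta> r t)\<^sup>2 +
    (q r * (Z r t)\<^sup>2 + q r * (\<Phi> r t)\<^sup>2)))))))))"
  note w0 [simp]
  have T0: "T r t \<ge> 0" if "r \<in> R" for r t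
    using that by (auto simp: T_def)
  have E0: "E r t \<ge> 0" for r t by (auto simp: E_def)
  have TH: "d r * (H r t)\<^sup>2 \<le> 1 * T r t" and TS: "s r * (S r t)\<^sup>2 \<le> 1 * T r t"
    and TX: "\<mu> r * (X r t)\<^sup>2 \<le> 1 * T r t" and TU: "m r * (U r t)\<^sup>2 \<le> 1 * T r t"
    and TV: "n r * (V r t)\<^sup>2 \<le> 1 * T r t" and TW: "k r * (W r t)\<^sup>2 \<le> 1 * T r t"
    and TY: "q r * (Y r t)\<^sup>2 \<le> 1 * T r t" and T\<Theta>: "q r * (\<Theta> r t)\<^sup>2 \<le> 1 * T r t"
    and TZ: "q r * (Z r t)\<^sup>2 \<le> 1 * T r t" and T\<Phi>: "q r * (\<Phi> r t)\<^sup>2 \<le> 1 * T r t"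
    if "r \<in> R" for r t
    using that by (auto simp: T_def intro!: add_increasing add_increasing2)
  have EV: "(V r t)\<^sup>2 \<le> E r t" and EU: "(U r t)\<^sup>2 \<le> E r t" and EZ: "(Z r t)\<^sup>2 \<le> E r t"
    and EY: "(Y r t)\<^sup>2 \<le> E r t" and E\<Phi>: "(\<Phi> r t)\<^sup>2 \<le> E r t" and E\<Theta>: "(\<Theta> r t)\<^sup>2 \<le> E r t"
    and ES: "(S r t)\<^sup>2 \<le> E r t" and EH: "(H r t)\<^sup>2 \<le> E r t"
    if "r \<in> R" for r t
    by (auto simp: E_def intro!: add_increasing add_increasing2)
  have E': "(E r has_real_derivative - 2 * (d r * (H r t)\<^sup>2)) (at t)" if "r \<in> R" for r t
    unfolding E_def using that
    by (auto intro!: derivative_eq_intros V' U' Z' Y' \<Phi>' \<Theta>' S' H'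
      simp: algebra_simps power2_eq_square)
  have K0: "K \<ge> 0" using pos by simp
  have bc0: "b\<^sup>2 - c\<^sup>2 \<noteq> 0" using bc by simp
  note prod = controlled_prod[where R = R and E = E and T = T and K = K and L = 1,
      OF _ _ zero_less_one _ _ _ pos(6)]
  note square = controlled_square[where R = R and E = E and T = T and K = K, OF _ _ pos(6)]
  note dprod = controlled_deriv_prod[where R = R and E = E and T = T and K = K, OF _ _ _ _ _ K0 T0]
  note add = controlled_add[where R = R and E = E and T = T]
  have cH: "controlled R E T (\<lambda>r t. d r * (H r t)\<^sup>2)"
    by (rule controlled_damping[OF E' E0 T0])
  \<comment> \<open>The error term \<open>S * U\<close> is not small. The equations give
    \<open>\<xi> * U = Z' / (b * \<xi>) + \<Phi>' / (c * \<xi>) - V' / a\<close>, and moving these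
    derivatives onto \<open>S\<close> leaves products with \<open>H\<close>. This explains the high
    powers of \<open>\<xi>\<close> in the denominators.\<close>
  have cS: "controlled R E T (\<lambda>r t. s r * (S r t)\<^sup>2)"
    by (rule controlled_mono, rule add[OF square[OF cH, of s 1]
          add[OF prod[OF cH TS, of "\<lambda>r. s r * d r / \<xi> r" "- 1 / e"]
          add[OF prod[OF cH TZ, of "\<lambda>r. s r / (\<xi> r)\<^sup>2" "- g / b"]
          add[OF prod[OF cH T\<Phi>, of "\<lambda>r. s r / (\<xi> r)\<^sup>2" "- g / c"]
          add[OF prod[OF cH TV, of "\<lambda>r. s r / \<xi> r" "g / a"]
          add[OF dprod[OF S' H' ES EH, of "\<lambda>r. s r / \<xi> r" "- 1 / e"]
          add[OF dprod[OF S' Z' ES EZ, of "\<lambda>r. s r / (\<xi> r)^3" "g / (b * e)"]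
          add[OF dprod[OF S' \<Phi>' ES E\<Phi>, of "\<lambda>r. s r / (\<xi> r)^3" "g / (c * e)"]
              dprod[OF S' V' ES EV, of "\<lambda>r. s r / (\<xi> r)\<^sup>2" "- g / (a * e)"]]]]]]]]])
       (use ws pos \<xi> in \<open>auto simp: field_simps power2_eq_square power3_eq_cube\<close>)
  \<comment> \<open>\<open>X\<close> is \<open>H'\<close> up to damping, so it has a better weight than \<open>U\<close> and \<open>S\<close> separately.\<close>
  have cX: "controlled R E T (\<lambda>r t. \<mu> r * (X r t)\<^sup>2)"
    by (rule controlled_mono, rule add[OF square[OF cH, of \<mu> "g\<^sup>2"]
          add[OF square[OF cH, of "\<lambda>r. \<mu> r * (\<xi> r)\<^sup>2" "e\<^sup>2"]
          add[OF prod[OF cH TX, of "\<lambda>r. \<mu> r * d r" 1]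
          add[OF prod[OF cH TV, of "\<lambda>r. \<mu> r * \<xi> r" "- g * a"]
          add[OF dprod[OF H' U' EH EU, of \<mu> g]
              dprod[OF H' S' EH ES, of "\<lambda>r. \<mu> r * \<xi> r" "- e"]]]]]])
       (use w\<mu> pos \<xi> in \<open>auto simp: X_def field_simps power2_eq_square\<close>)
  have cU: "controlled R E T (\<lambda>r t. m r * (U r t)\<^sup>2)"
  proof (rule controlled_mono[OF add[OF square[OF cX, of m "2 / g\<^sup>2"]
          square[OF cS, of "\<lambda>r. m r * (\<xi> r)\<^sup>2" "2 * e\<^sup>2 / g\<^sup>2"]]])
    fix r t assume r: "r \<in> R"
    have "g\<^sup>2 * (U r t)\<^sup>2 = (X r t + e * \<xi> r * S r t)\<^sup>2" by (simp add: X_def power_mult_distrib)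
    also have "\<dots> \<le> 2 * (X r t)\<^sup>2 + 2 * (e * \<xi> r * S r t)\<^sup>2"
      using sum_squares_bound[of "X r t" "e * \<xi> r * S r t"] by (simp add: power2_sum)
    finally have "(U r t)\<^sup>2 \<le> (2 * (X r t)\<^sup>2 + 2 * (e * \<xi> r * S r t)\<^sup>2) / g\<^sup>2"
      using pos by (simp add: field_simps)
    then have "m r * (U r t)\<^sup>2 \<le> m r * ((2 * (X r t)\<^sup>2 + 2 * (e * \<xi> r * S r t)\<^sup>2) / g\<^sup>2)"
      using r by (intro mult_left_mono) auto
    then show "m r * (U r t)\<^sup>2 \<le> 2 / g\<^sup>2 * (m r * (X r t)\<^sup>2)
        + 2 * e\<^sup>2 / g\<^sup>2 * (m r * (\<xi> r)\<^sup>2 * (S r t)\<^sup>2)"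
      by (simp add: field_simps add_divide_distrib power_mult_distrib)
  qed (use wm in auto)
  \<comment> \<open>The derivative of \<open>U * V\<close> leaves \<open>U * W\<close>, which is
    split by \<open>g * U = X + e * \<xi> * S\<close>. The product \<open>X * W\<close> can be
    absorbed thanks to the better weight of \<open>X\<close>, and \<open>S * W\<close> is a
    derivative up to \<open>H * Z\<close> and \<open>H * \<Phi>\<close>, because
    \<open>\<xi> * Y = Z' / b\<close> and \<open>\<xi> * \<Theta> = \<Phi>' / c\<close>.\<close>
  have cV: "controlled R E T (\<lambda>r t. n r * (V r t)\<^sup>2)"
    by (rule controlled_mono, rule add[OF square[OF cU, of n 1]
          add[OF prod[OF cH TV, of "\<lambda>r. n r / \<xi> r" "g / a"]
          add[OF prod[OF cX TW, of "\<lambda>r. n r / \<xi> r" "- 1 / g"]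
          add[OF prod[OF cH TZ, of n "e * e / (g * b)"]
          add[OF prod[OF cH T\<Phi>, of n "e * e / (g * c)"]
          add[OF dprod[OF U' V' EU EV, of "\<lambda>r. n r / \<xi> r" "1 / a"]
          add[OF dprod[OF S' Z' ES EZ, of "\<lambda>r. n r / \<xi> r" "- e / (g * b)"]
              dprod[OF S' \<Phi>' ES E\<Phi>, of "\<lambda>r. n r / \<xi> r" "- e / (g * c)"]]]]]]]])
       (use wn pos \<xi> in \<open>auto simp: X_def W_def field_simps power2_eq_square\<close>)
  have cW: "controlled R E T (\<lambda>r t. k r * (W r t)\<^sup>2)"
    by (rule controlled_mono, rule add[OF square[OF cV, of k 2]
          add[OF prod[OF cU TW, of "\<lambda>r. k r * \<xi> r" 1]
          add[OF prod[OF cV TZ, of "\<lambda>r. k r * \<xi> r" "b / a"]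
          add[OF prod[OF cV T\<Phi>, of "\<lambda>r. k r * \<xi> r" "c / a"]
          add[OF dprod[OF V' Y' EV EY, of k "1 / a"]
              dprod[OF V' \<Theta>' EV E\<Theta>, of k "1 / a"]]]]]])
       (use wk pos \<xi> in \<open>auto simp: W_def field_simps power2_eq_square\<close>)
  \<comment> \<open>The multiplier is \<open>W * B\<close> with weight \<open>- q / \<xi>\<close>,
    expanded into four products of components.\<close>
  have cB: "controlled R E T (\<lambda>r t. q r * (B r t)\<^sup>2)"
  proof (rule controlled_mono, rule add[OF prod[OF cV TZ, of "\<lambda>r. q r / \<xi> r" "- 2 * a * b"]
          add[OF prod[OF cV T\<Phi>, of "\<lambda>r. q r / \<xi> r" "- 2 * a * c"]
          add[OF prod[OF cW TY, of q "b\<^sup>2"]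
          add[OF prod[OF cW T\<Theta>, of q "c\<^sup>2"]
          add[OF dprod[OF Y' Z' EY EZ, of "\<lambda>r. q r / \<xi> r" "- b"]
          add[OF dprod[OF Y' \<Phi>' EY E\<Phi>, of "\<lambda>r. q r / \<xi> r" "- c"]
          add[OF dprod[OF \<Theta>' Z' E\<Theta> EZ, of "\<lambda>r. q r / \<xi> r" "- b"]
              dprod[OF \<Theta>' \<Phi>' E\<Theta> E\<Phi>, of "\<lambda>r. q r / \<xi> r" "- c"]]]]]]]])
    fix r t assume r: "r \<in> R"
    define i where "i = q r / \<xi> r"
    have i: "q r = i * \<xi> r" using \<xi>[OF r] by (simp add: i_def)
    show "q r * (B r t)\<^sup>2 \<le> - 2 * a * b * (q r / \<xi> r * (V r t * Z r t)) +
        (- 2 * a * c * (q r / \<xi> r * (V r t * \<Phi> r t)) +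
        (b\<^sup>2 * (q r * (W r t * Y r t)) + (c\<^sup>2 * (q r * (W r t * \<Theta> r t)) +
        (- b * (q r / \<xi> r * ((- b * \<xi> r * Z r t - a * V r t) * Z r t + Y r t * (b * \<xi> r * Y r t))) +
        (- c * (q r / \<xi> r * ((- b * \<xi> r * Z r t - a * V r t) * \<Phi> r t + Y r t * (c * \<xi> r * \<Theta> r t))) +
        (- b * (q r / \<xi> r * ((- c * \<xi> r * \<Phi> r t - a * V r t) * Z r t + \<Theta> r t * (b * \<xi> r * Y r t))) +
         - c * (q r / \<xi> r * ((- c * \<xi> r * \<Phi> r t - a * V r t) * \<Phi> r t
           + \<Theta> r t * (c * \<xi> r * \<Theta> r t)))))))))"
      unfolding i_def[symmetric] i W_def B_def
      by (simp add: algebra_simps power2_eq_square)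
  qed (use wq in auto)
  \<comment> \<open>The multiplier is \<open>Y * B\<close>. In its derivative
    \<open>b\<^sup>2 * Y + c\<^sup>2 * \<Theta>\<close> is rewritten as
    \<open>(b\<^sup>2 - c\<^sup>2) * Y + c\<^sup>2 * W\<close>, whence the division by
    \<open>b\<^sup>2 - c\<^sup>2\<close>.\<close>
  have cY: "controlled R E T (\<lambda>r t. q r * (Y r t)\<^sup>2)"
  proof (rule controlled_mono, rule add[OF prod[OF cW TY, of q "- c\<^sup>2 / (b\<^sup>2 - c\<^sup>2)"]
          add[OF prod[OF cB TZ, of q "b / (b\<^sup>2 - c\<^sup>2)"]
          add[OF prod[OF cV TZ, of "\<lambda>r. q r / \<xi> r" "a * b / (b\<^sup>2 - c\<^sup>2)"]
          add[OF prod[OF cV T\<Phi>, of "\<lambda>r. q r / \<xi> r" "a * c / (b\<^sup>2 - c\<^sup>2)"]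
          add[OF dprod[OF Y' Z' EY EZ, of "\<lambda>r. q r / \<xi> r" "b / (b\<^sup>2 - c\<^sup>2)"]
              dprod[OF Y' \<Phi>' EY E\<Phi>, of "\<lambda>r. q r / \<xi> r" "c / (b\<^sup>2 - c\<^sup>2)"]]]]]])
    fix r t assume r: "r \<in> R"
    define D where "D = 1 / (b\<^sup>2 - c\<^sup>2)"
    have D: "D * b\<^sup>2 = 1 + D * c\<^sup>2" using bc0 by (simp add: D_def field_simps)
    have dD: "x / (b\<^sup>2 - c\<^sup>2) = x * D" for x by (simp add: D_def)
    define i where "i = q r / \<xi> r"
    have i: "q r = i * \<xi> r" using \<xi>[OF r] by (simp add: i_def)
    have "(D * b\<^sup>2) * (i * \<xi> r * (Y r t)\<^sup>2) = (1 + D * c\<^sup>2) * (i * \<xi> r * (Y r t)\<^sup>2)"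
      by (simp only: D)
    then show "q r * (Y r t)\<^sup>2 \<le> - c\<^sup>2 / (b\<^sup>2 - c\<^sup>2) * (q r * (W r t * Y r t)) +
             (b / (b\<^sup>2 - c\<^sup>2) * (q r * (B r t * Z r t)) +
              (a * b / (b\<^sup>2 - c\<^sup>2) * (q r / \<xi> r * (V r t * Z r t)) +
               (a * c / (b\<^sup>2 - c\<^sup>2) * (q r / \<xi> r * (V r t * \<Phi> r t)) +
                (b / (b\<^sup>2 - c\<^sup>2) * (q r / \<xi> r * ((- b * \<xi> r * Z r t - a * V r t) * Z r t
                   + Y r t * (b * \<xi> r * Y r t))) +
                 c / (b\<^sup>2 - c\<^sup>2) * (q r / \<xi> r * ((- b * \<xi> r * Z r t - a * V r t) * \<Phi> r t
                   + Y r t * (c * \<xi> r * \<Theta> r t)))))))"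
      unfolding dD i_def[symmetric] i W_def B_def
      by (simp add: algebra_simps power2_eq_square)
  qed (use wq pos \<xi> in \<open>auto simp: field_simps power2_eq_square\<close>)
  have c\<Theta>: "controlled R E T (\<lambda>r t. q r * (\<Theta> r t)\<^sup>2)"
  proof (rule controlled_mono[OF add[OF square[OF cW, of q 2] square[OF cY, of q 2]]])
    fix r t assume r: "r \<in> R"
    have "(\<Theta> r t)\<^sup>2 = (W r t - Y r t)\<^sup>2" by (simp add: W_def)
    also have "\<dots> \<le> 2 * (W r t)\<^sup>2 + 2 * (Y r t)\<^sup>2"
      using sum_squares_bound[of "W r t" "- Y r t"] by (simp add: power2_diff)
    finally have "q r * (\<Theta> r t)\<^sup>2 \<le> q r * (2 * (W r t)\<^sup>2 + 2 * (Y r t)\<^sup>2)"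
      using r by (intro mult_left_mono) auto
    then show "q r * (\<Theta> r t)\<^sup>2 \<le> 2 * (q r * (W r t)\<^sup>2) + 2 * (q r * (Y r t)\<^sup>2)"
      by (simp add: algebra_simps)
  qed (use wq in auto)
  have cZ: "controlled R E T (\<lambda>r t. q r * (Z r t)\<^sup>2)"
    by (rule controlled_mono, rule add[OF square[OF cY, of q 1]
          add[OF prod[OF cV TZ, of "\<lambda>r. q r / \<xi> r" "- a / b"]
              dprod[OF Y' Z' EY EZ, of "\<lambda>r. q r / \<xi> r" "- 1 / b"]]])
       (use wq pos \<xi> in \<open>auto simp: field_simps power2_eq_square\<close>)
  have c\<Phi>: "controlled R E T (\<lambda>r t. q r * (\<Phi> r t)\<^sup>2)"
    by (rule controlled_mono, rule add[OF square[OF c\<Theta>, of q 1]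
          add[OF prod[OF cV T\<Phi>, of "\<lambda>r. q r / \<xi> r" "- a / c"]
              dprod[OF \<Theta>' \<Phi>' E\<Theta> E\<Phi>, of "\<lambda>r. q r / \<xi> r" "- 1 / c"]]])
       (use wq pos \<xi> in \<open>auto simp: field_simps power2_eq_square\<close>)
  have cT: "controlled R E T T"
    unfolding T_def by (intro controlled_add; unfold T_def[symmetric]; fact)
  have \<rho>E: "\<rho> r * E r t \<le> T r t" if r: "r \<in> R" for r t
  proof -
    have w: "\<rho> r \<le> d r" "\<rho> r \<le> s r" "\<rho> r \<le> m r" "\<rho> r \<le> n r" "\<rho> r \<le> q r"
      using \<rho> r by auto
    have "\<rho> r * (H r t)\<^sup>2 \<le> d r * (H r t)\<^sup>2" "\<rho> r * (S r t)\<^sup>2 \<le> s r * (S r t)\<^sup>2"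
      "\<rho> r * (U r t)\<^sup>2 \<le> m r * (U r t)\<^sup>2" "\<rho> r * (V r t)\<^sup>2 \<le> n r * (V r t)\<^sup>2"
      "\<rho> r * (Z r t)\<^sup>2 \<le> q r * (Z r t)\<^sup>2" "\<rho> r * (\<Theta> r t)\<^sup>2 \<le> q r * (\<Theta> r t)\<^sup>2"
      "\<rho> r * (Y r t)\<^sup>2 \<le> q r * (Y r t)\<^sup>2" "\<rho> r * (\<Phi> r t)\<^sup>2 \<le> q r * (\<Phi> r t)\<^sup>2"
      by (rule mult_right_mono[OF w(1)] mult_right_mono[OF w(2)] mult_right_mono[OF w(3)]
          mult_right_mono[OF w(4)] mult_right_mono[OF w(5)], simp)+
    moreover have "0 \<le> \<mu> r * (X r t)\<^sup>2" "0 \<le> k r * (W r t)\<^sup>2" using r by auto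
    ultimately show ?thesis unfolding E_def T_def by (simp add: distrib_left)
  qed
  show ?thesis
    by (rule exponential_decay[where T = T and \<rho> = \<rho>, OF cT E' _ E0 \<rho>E])
      (auto intro: that)
qed

section \<open>Admissible weights at low and high frequencies\<close>

lemma le_multI: "c \<le> K \<Longrightarrow> Y = c * X \<Longrightarrow> 0 \<le> X \<Longrightarrow> Y \<le> K * X" for c K X Y :: real
  by (simp add: mult_right_mono)

lemma abs_le_of_eq: "\<bar>c\<bar> \<le> K \<Longrightarrow> Y = c \<Longrightarrow> \<bar>Y\<bar> \<le> K" for c K Y :: real
  by simp

text \<open>After insertion of the low-frequency weights, a condition \<open>Y \<le> K * X\<close>
  that is not settled by simplification has its quotient \<open>Y / X\<close> in this list, and a
  bound on a multiplier refers to one of the absolute values. The verifications try the entries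
  through \<open>le_multI\<close> and \<open>abs_le_of_eq\<close>. \<open>K\<close> dominates
  \<open>1\<close>, \<open>D\<close> and \<open>D\<^sup>2\<close>, which bound all entries for
  \<open>|\<xi>| \<le> 1\<close>.\<close>

lemma
  fixes \<xi> d D :: real
  assumes \<xi>: "\<bar>\<xi>\<bar> \<le> 1" and d: "0 < d" "d \<le> D"
  defines "K \<equiv> 1 + D + D\<^sup>2"
  shows low_coeff_le: "1 \<le> K" "\<xi>\<^sup>2 \<le> K" "\<xi> ^ 4 \<le> K" "d\<^sup>2 \<le> K" "d\<^sup>2 * \<xi>\<^sup>2 \<le> K"
    and low_coeff_abs_le: "\<bar>d\<bar> \<le> K" "\<bar>d * \<xi>\<bar> \<le> K" "\<bar>d * \<xi>\<^sup>2\<bar> \<le> K" "\<bar>d * \<xi> ^ 3\<bar> \<le> K"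
    and low_order: "0 \<le> d" "d * \<xi>\<^sup>2 \<le> d" "d * \<xi> ^ 4 \<le> d" "d * \<xi> ^ 4 \<le> d * \<xi>\<^sup>2"
proof -
  have D: "D > 0" using d by simp
  have K: "1 \<le> K" "D \<le> K" "D\<^sup>2 \<le> K" using D by (auto simp: K_def)
  have p: "\<bar>\<xi>\<bar> ^ i \<le> 1" for i using \<xi> by (intro power_le_one) auto
  have x: "\<xi>\<^sup>2 \<le> 1" "\<xi> ^ 4 \<le> 1" using p[of 2] p[of 4] by (simp_all add: power_even_abs)
  have d2: "d\<^sup>2 \<le> D\<^sup>2" using d by (intro power_mono) auto
  have d2x: "d\<^sup>2 * \<xi>\<^sup>2 \<le> D\<^sup>2" using mult_mono[OF d2 x(1)] by simp
  have dx: "d * \<bar>\<xi>\<bar> ^ i \<le> D" for i using mult_mono[OF d(2) p[of i]] D by simp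
  show "1 \<le> K" "\<xi>\<^sup>2 \<le> K" "\<xi> ^ 4 \<le> K" "d\<^sup>2 \<le> K" "d\<^sup>2 * \<xi>\<^sup>2 \<le> K"
    using K x d2 d2x by linarith+
  show "\<bar>d\<bar> \<le> K" "\<bar>d * \<xi>\<bar> \<le> K" "\<bar>d * \<xi>\<^sup>2\<bar> \<le> K" "\<bar>d * \<xi> ^ 3\<bar> \<le> K"
    using dx[of 0] dx[of 1] dx[of 2] dx[of 3] K d(1) by (auto simp: abs_mult power_abs)
  show "0 \<le> d" "d * \<xi>\<^sup>2 \<le> d" "d * \<xi> ^ 4 \<le> d" "d * \<xi> ^ 4 \<le> d * \<xi>\<^sup>2"
    using x d mult_left_mono[of "\<xi>\<^sup>2 * \<xi>\<^sup>2" "\<xi>\<^sup>2" d] mult_left_le[of "\<xi>\<^sup>2" "\<xi>\<^sup>2"]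
    by (simp_all add: mult_left_le flip: power_add)
qed

text \<open>The analogous list for \<open>|\<xi>| \<ge> 1\<close>. Here \<open>d\<close> may grow
  like \<open>\<xi>\<^sup>2\<close>, so \<open>d / \<xi>\<^sup>2\<close> and \<open>1 / d\<close>
  take the place of \<open>d\<close>. The factor \<open>min 1 D\<close> keeps the rate below
  \<open>d\<close> as well as below the pure powers of \<open>1 / \<xi>\<close>.\<close>

lemma
  fixes \<xi> d D :: real
  assumes \<xi>: "1 \<le> \<bar>\<xi>\<bar>" and D: "0 < D" and d: "D \<le> d" "d \<le> D * \<xi>\<^sup>2"
  defines "K \<equiv> 1 + D + 1 / D"
  shows high_coeff_le: "1 \<le> K" "1 / \<xi>\<^sup>2 \<le> K" "1 / \<xi> ^ 4 \<le> K" "1 / d \<le> K" "1 / (d * \<xi>\<^sup>2) \<le> K"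
      "1 / (d * \<xi> ^ 4) \<le> K" "d / \<xi>\<^sup>2 \<le> K"
    and high_coeff_abs_le: "\<bar>1 / \<xi>\<bar> \<le> K" "\<bar>1 / \<xi>\<^sup>2\<bar> \<le> K" "\<bar>1 / \<xi> ^ 3\<bar> \<le> K" "\<bar>1 / \<xi> ^ 4\<bar> \<le> K"
      "\<bar>1 / \<xi> ^ 5\<bar> \<le> K" "\<bar>1 / \<xi> ^ 6\<bar> \<le> K" "\<bar>1 / \<xi> ^ 7\<bar> \<le> K"
    and high_order: "even p \<Longrightarrow> min 1 D / \<xi> ^ p \<le> d" "even p \<Longrightarrow> 0 \<le> min 1 D / \<xi> ^ p"
      "even p \<Longrightarrow> even i \<Longrightarrow> i \<le> p \<Longrightarrow> min 1 D / \<xi> ^ p \<le> 1 / \<xi> ^ i"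
proof -
  have K: "1 \<le> K" "D \<le> K" "1 / D \<le> K" using D by (auto simp: K_def)
  have g: "1 \<le> \<bar>\<xi>\<bar> ^ i" for i using \<xi> by (intro one_le_power)
  have g2: "1 \<le> \<xi> ^ i" if "even i" for i using g[of i] that by (simp add: power_even_abs)
  have l: "1 / \<bar>\<xi>\<bar> ^ i \<le> K" for i
  proof -
    have "1 / \<bar>\<xi>\<bar> ^ i \<le> 1" using g[of i] by (simp add: divide_le_eq)
    then show ?thesis using K(1) by linarith
  qed
  have l2: "1 / \<xi> ^ i \<le> K" if "even i" for i using l[of i] that by (simp add: power_even_abs)
  have dl: "1 / (d * \<xi> ^ i) \<le> K" if "even i" for i
  proof -
    have "D * 1 \<le> d * \<xi> ^ i" using D d g2[OF that] by (intro mult_mono) auto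
    then have "1 / (d * \<xi> ^ i) \<le> 1 / D" using D by (intro divide_left_mono) auto
    then show ?thesis using K(3) by linarith
  qed
  have "d / \<xi>\<^sup>2 \<le> D" using \<xi> d by (simp add: divide_le_eq)
  then show "1 \<le> K" "1 / \<xi>\<^sup>2 \<le> K" "1 / \<xi> ^ 4 \<le> K" "1 / d \<le> K" "1 / (d * \<xi>\<^sup>2)
    \<le> K" "1 / (d * \<xi> ^ 4) \<le> K"
      "d / \<xi>\<^sup>2 \<le> K"
    using K(1,2) l2[of 2] l2[of 4] dl[of 0] dl[of 2] dl[of 4] by simp_all
  show "\<bar>1 / \<xi>\<bar> \<le> K" "\<bar>1 / \<xi>\<^sup>2\<bar> \<le> K" "\<bar>1 / \<xi> ^ 3\<bar> \<le> K" "\<bar>1 / \<xi> ^ 4\<bar> \<le> K" "\<bar>1 / \<xi> ^ 5\<bar> \<le> K"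
      "\<bar>1 / \<xi> ^ 6\<bar> \<le> K" "\<bar>1 / \<xi> ^ 7\<bar> \<le> K"
    using l[of 1] l[of 2] l[of 3] l[of 4] l[of 5] l[of 6] l[of 7]
      by (simp_all add: abs_divide power_abs)
  have m: "0 < min 1 D" "min 1 D \<le> 1" "min 1 D \<le> D" using D by auto
  show "min 1 D / \<xi> ^ p \<le> d" "0 \<le> min 1 D / \<xi> ^ p" if "even p"
    using frac_le[of D "min 1 D" 1 "\<xi> ^ p"] m D d g2[OF that] by simp_all
  show "min 1 D / \<xi> ^ p \<le> 1 / \<xi> ^ i" if "even p" "even i" "i \<le> p"
  proof -
    have "\<xi> ^ i \<le> \<xi> ^ p" using power_increasing[OF that(3) \<xi>] that by (simp add: power_even_abs)
    then show ?thesis using m g2[OF that(2)] by (intro frac_le) auto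
  qed
qed

text \<open>The factor \<open>\<xi>\<^sup>2\<close> is lost on \<open>S\<close>, \<open>Z\<close>,
  \<open>U\<close> and \<open>\<Phi>\<close>, whose multipliers are divided by \<open>\<xi>\<close>.
  For instance \<open>(q / \<xi>)\<^sup>2 \<le> K * (n * q)\<close> forces
  \<open>q \<le> K * n * \<xi>\<^sup>2\<close>.\<close>

lemma weights_y_low:
  fixes \<xi> d D :: real
  assumes "\<xi> \<noteq> 0" "\<bar>\<xi>\<bar> \<le> 1" "0 < d" "d \<le> D"
  shows "weights_y a b c (1 + D + D\<^sup>2) \<xi> d (d * \<xi>\<^sup>2) d d (d * \<xi>\<^sup>2) d (d * \<xi>\<^sup>2) (d * \<xi>\<^sup>2) (d * \<xi>\<^sup>2)"
proof -
  note [simp] = assms(1) low_order[OF assms(2-4)]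
  show ?thesis
    unfolding weights_y_def
    by (intro conjI;
      ((simp; fail)
      | (rule low_coeff_le[OF assms(2-4), THEN le_multI], (simp add: field_simps
        eval_nat_numeral; fail), (simp; fail))
      | (rule low_coeff_abs_le[OF assms(2-4), THEN abs_le_of_eq], (simp add: field_simps
        eval_nat_numeral; fail))
      | (rule disjI2, rule low_coeff_le(1)[OF assms(2-4), THEN le_multI], (simp add: field_simps
        eval_nat_numeral; fail), (simp; fail))))
qed

lemma weights_y_high_equal:
  fixes \<xi> d D :: real
  assumes "1 \<le> \<bar>\<xi>\<bar>" "0 < D" "D \<le> d" "d \<le> D * \<xi>\<^sup>2"
  shows "weights_y a a a (1 + D + 1 / D) \<xi> d 1 (1 / \<xi>\<^sup>2) (1 / \<xi>\<^sup>2) (1 / \<xi>\<^sup>2) (1 / \<xi>\<^sup>2) (1 / \<xi>\<^sup>2)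
    (1 / \<xi>\<^sup>2) (min 1 D / \<xi>\<^sup>2)"
proof -
  have [simp]: "\<xi> \<noteq> 0" "d > 0" "d \<ge> 0" "d \<noteq> 0" using assms by auto
  note [simp] = high_order(1,2)[OF assms, of 2, simplified]
    high_order(3)[OF assms, of 2 0, simplified] high_order(3)[OF assms, of 2 2, simplified]
  show ?thesis
    unfolding weights_y_def
    by (intro conjI;
      ((simp; fail)
      | (rule high_coeff_le[OF assms, THEN le_multI], (simp add: field_simps eval_nat_numeral;
        fail), (simp; fail))
      | (rule high_coeff_abs_le[OF assms, THEN abs_le_of_eq], (simp add: field_simps
        eval_nat_numeral; fail))
      | (rule disjI2, rule high_coeff_le(1)[OF assms, THEN le_multI], (simp add: field_simps
        eval_nat_numeral; fail), (simp; fail))))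
qed

text \<open>As \<open>p \<le> K * n\<close>, the condition
  \<open>(n * \<xi>)\<^sup>2 \<le> K * (m * p)\<close> forces \<open>n\<close> to be of order
  \<open>m / \<xi>\<^sup>2\<close> at most. Likewise \<open>f \<le> K * \<kappa>\<close> and
  \<open>(\<kappa> * \<xi>)\<^sup>2 \<le> K * (n * f)\<close> make \<open>\<kappa>\<close> lose
  another \<open>\<xi>\<^sup>2\<close> against \<open>n\<close>. These are the conditions that equal
  wave speeds remove.\<close>

lemma weights_y_high:
  fixes \<xi> d D :: real
  assumes "1 \<le> \<bar>\<xi>\<bar>" "0 < D" "D \<le> d" "d \<le> D * \<xi>\<^sup>2"
  shows "weights_y a b c (1 + D + 1 / D) \<xi> d 1 (1 / \<xi>\<^sup>2) (1 / \<xi> ^ 4) (1 / \<xi>\<^sup>2) (1 / \<xi> ^ 6) (1 /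
    \<xi> ^ 4) (1 / \<xi> ^ 6) (min 1 D / \<xi> ^ 6)"
proof -
  have [simp]: "\<xi> \<noteq> 0" "d > 0" "d \<ge> 0" "d \<noteq> 0" using assms by auto
  note [simp] = high_order(1,2)[OF assms, of 6, simplified]
    high_order(3)[OF assms, of 6 0, simplified] high_order(3)[OF assms, of 6 2, simplified]
      high_order(3)[OF assms, of 6 4, simplified] high_order(3)[OF assms, of 6 6, simplified]
  show ?thesis
    unfolding weights_y_def
    by (intro conjI;
      ((simp; fail)
      | (rule high_coeff_le[OF assms, THEN le_multI], (simp add: field_simps eval_nat_numeral;
        fail), (simp; fail))
      | (rule high_coeff_abs_le[OF assms, THEN abs_le_of_eq], (simp add: field_simps
        eval_nat_numeral; fail))
      | (rule disjI2, rule high_coeff_le(1)[OF assms, THEN le_multI], (simp add: field_simps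
        eval_nat_numeral; fail), (simp; fail))))
qed

text \<open>The condition \<open>(n / \<xi>)\<^sup>2 \<le> K * (d * n)\<close> forces the order
  \<open>d * \<xi>\<^sup>2\<close> on \<open>n\<close>, and
  \<open>(q / \<xi>)\<^sup>2 \<le> K * (n * q)\<close> then forces \<open>d * \<xi> ^ 4\<close> on
  \<open>q\<close>. Through \<open>(s / \<xi>\<^sup>2)\<^sup>2 \<le> K * (d * q)\<close> the weight
  \<open>s\<close> has to follow.\<close>

lemma weights_u_low:
  fixes \<xi> d D :: real
  assumes "\<xi> \<noteq> 0" "\<bar>\<xi>\<bar> \<le> 1" "0 < d" "d \<le> D"
  shows "weights_u (1 + D + D\<^sup>2) \<xi> d (d * \<xi> ^ 4) d (d * \<xi>\<^sup>2) (d * \<xi>\<^sup>2) (d * \<xi>\<^sup>2) (d * \<xi> ^ 4) (d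
    * \<xi> ^ 4)"
proof -
  note [simp] = assms(1) low_order[OF assms(2-4)]
  show ?thesis
    unfolding weights_u_def
    by (intro conjI;
      ((simp; fail)
      | (rule low_coeff_le[OF assms(2-4), THEN le_multI], (simp add: field_simps
        eval_nat_numeral; fail), (simp; fail))
      | (rule low_coeff_abs_le[OF assms(2-4), THEN abs_le_of_eq], (simp add: field_simps
        eval_nat_numeral; fail))
      | (rule disjI2, rule low_coeff_le(1)[OF assms(2-4), THEN le_multI], (simp add: field_simps
        eval_nat_numeral; fail), (simp; fail))))
qed

text \<open>The order of \<open>k\<close> is limited by
  \<open>(k * \<xi>)\<^sup>2 \<le> K * (m * k)\<close>, where
  \<open>m * \<xi>\<^sup>2 \<le> K * s\<close>, and \<open>q\<close> cannot exceed
  \<open>K * k\<close>. With \<open>s = 1\<close> this leaves \<open>1 / \<xi> ^ 4\<close>.\<close>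

lemma weights_u_high:
  fixes \<xi> d D :: real
  assumes "1 \<le> \<bar>\<xi>\<bar>" "0 < D" "D \<le> d" "d \<le> D * \<xi>\<^sup>2"
  shows "weights_u (1 + D + 1 / D) \<xi> d 1 (1 / \<xi>\<^sup>2) (1 / \<xi>\<^sup>2) (1 / \<xi>\<^sup>2) (1 / \<xi> ^ 4) (1 / \<xi> ^ 4)
    (min 1 D / \<xi> ^ 4)"
proof -
  have [simp]: "\<xi> \<noteq> 0" "d > 0" "d \<ge> 0" "d \<noteq> 0" using assms by auto
  note [simp] = high_order(1,2)[OF assms, of 4, simplified]
    high_order(3)[OF assms, of 4 0, simplified] high_order(3)[OF assms, of 4 2, simplified]
      high_order(3)[OF assms, of 4 4, simplified]
  show ?thesis
    unfolding weights_u_def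
    by (intro conjI;
      ((simp; fail)
      | (rule high_coeff_le[OF assms, THEN le_multI], (simp add: field_simps eval_nat_numeral;
        fail), (simp; fail))
      | (rule high_coeff_abs_le[OF assms, THEN abs_le_of_eq], (simp add: field_simps
        eval_nat_numeral; fail))
      | (rule disjI2, rule high_coeff_le(1)[OF assms, THEN le_multI], (simp add: field_simps
        eval_nat_numeral; fail), (simp; fail))))
qed

section \<open>The Fourier symbol\<close>

lemma sums_matrixI:
  fixes f :: "nat \<Rightarrow> 'a::real_normed_vector ^ 'n ^ 'm"
  assumes "\<And>i j. (\<lambda>n. f n $ i $ j) sums (S $ i $ j)"
  shows "f sums S"
  using assms unfolding sums_def by (auto intro!: vec_tendstoI simp: sum_component)

lemma matrix_power_scaleR:
  fixes M :: "complex ^ 'n ^ 'n"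
  shows "(((**) (t *\<^sub>R M)) ^^ n) (mat 1) = t ^ n *\<^sub>R (((**) M) ^^ n) (mat 1)"
  by (induction n)
    (simp_all add: vec_eq_iff matrix_matrix_mult_def scaleR_sum_right)

lemma matrix_power_entry_bound:
  fixes M :: "complex ^ 'n ^ 'n"
  defines "K \<equiv> \<Sum>i\<in>UNIV. \<Sum>j\<in>UNIV. norm (M $ i $ j)"
  shows "norm ((((**) M) ^^ n) (mat 1) $ i $ j) \<le> K ^ n"
proof (induction n arbitrary: i)
  case 0
  then show ?case by (simp add: mat_def)
next
  case (Suc n)
  have "norm ((((**) M) ^^ Suc n) (mat 1) $ i $ j)
      \<le> (\<Sum>k\<in>UNIV. norm (M $ i $ k) * norm ((((**) M) ^^ n) (mat 1) $ k $ j))"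
    by (simp add: matrix_matrix_mult_def norm_mult[symmetric] norm_sum)
  also have "\<dots> \<le> (\<Sum>k\<in>UNIV. norm (M $ i $ k) * K ^ n)"
    by (intro sum_mono mult_left_mono Suc) auto
  also have "\<dots> = (\<Sum>k\<in>UNIV. norm (M $ i $ k)) * K ^ n" by (simp add: sum_distrib_right)
  also have "\<dots> \<le> K * K ^ n"
    unfolding K_def
    by (intro mult_right_mono member_le_sum[where f = "\<lambda>i. \<Sum>j\<in>UNIV. norm (M $ i $ j)"])
      (auto intro!: sum_nonneg zero_le_power)
  finally show ?case by simp
qed

text \<open>The entries of the \<open>n\<close>-th power are at most \<open>K ^ n\<close>, so each
  component is an everywhere convergent power series. It is stated for complex \<open>z\<close>
  because its derivative is then obtained by termwise differentiation over a field and restricted to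
  the real line.\<close>

lemma matrix_exp_vector_nth:
  fixes M :: "complex ^ 'n ^ 'n"
  shows "summable (\<lambda>n. ((((**) M) ^^ n) (mat 1) *v w) $ i / fact n * z ^ n)" (is ?S)
    and "(matrix_exp (t *\<^sub>R M) *v w) $ i =
      (\<Sum>n. ((((**) M) ^^ n) (mat 1) *v w) $ i / fact n * of_real t ^ n)" (is ?E)
proof -
  define P where "P = (\<lambda>n. (((**) M) ^^ n) (mat 1))"
  have P: "(((**) M) ^^ n) (mat 1) = P n" for n by (simp add: P_def)
  define K where "K = (\<Sum>i\<in>UNIV. \<Sum>j\<in>UNIV. norm (M $ i $ j))"
  have s: "summable (\<lambda>n. P n $ i $ j / fact n * z ^ n)" for i j and z :: complex
  proof (rule summable_comparison_test')
    show "summable (\<lambda>n. (K * norm z) ^ n /\<^sub>R fact n)" by (rule summable_exp_generic)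
    show "norm (P n $ i $ j / fact n * z ^ n) \<le> (K * norm z) ^ n /\<^sub>R fact n" for n
      using mult_left_mono[OF matrix_power_entry_bound[where M = M and n = n and i = i and j = j],
          of "norm z ^ n"]
      by (simp add: norm_mult norm_divide norm_power power_mult_distrib P_def K_def field_simps)
  qed
  have e: "(P n *v w) $ i / fact n * z ^ n = (\<Sum>j\<in>UNIV. P n $ i $ j / fact n * z ^ n
    * w $ j)" for n i z
    by (simp add: matrix_vector_mult_def sum_divide_distrib sum_distrib_left sum_distrib_right
      mult_ac)
  show ?S
    unfolding P e by (intro summable_sum summable_mult2 s)
  have "(\<lambda>n. (1 / fact n) *\<^sub>R (((**) (t *\<^sub>R M)) ^^ n) (mat 1)) sums
    (\<chi> i j. \<Sum>n. P n $ i $ j / fact n * of_real t ^ n)"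
  proof (rule sums_matrixI)
    show "(\<lambda>n. ((1 / fact n) *\<^sub>R (((**) (t *\<^sub>R M)) ^^ n) (mat 1)) $ i $ j) sums
      ((\<chi> i j. \<Sum>n. P n $ i $ j / fact n * of_real t ^ n) $ i $ j)" for i j
      using summable_sums[OF s[of i j "of_real t"]]
      unfolding matrix_power_scaleR P vector_scaleR_component
      by (simp add: scaleR_conv_of_real mult_ac)
  qed
  then have m: "matrix_exp (t *\<^sub>R M) = (\<chi> i j. \<Sum>n. P n $ i $ j / fact n * of_real t ^ n)"
    unfolding matrix_exp_def by (rule sums_unique[symmetric])
  have "(matrix_exp (t *\<^sub>R M) *v w) $ i = (\<Sum>j\<in>UNIV. (\<Sum>n. P n $ i $ j / fact n * of_real t ^ n)
    * w $ j)"
    unfolding m by (simp add: matrix_vector_mult_def)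
  also have "\<dots> = (\<Sum>j\<in>UNIV. \<Sum>n. P n $ i $ j / fact n * of_real t ^ n * w $ j)"
    by (intro sum.cong refl suminf_mult2 s)
  also have "\<dots> = (\<Sum>n. \<Sum>j\<in>UNIV. P n $ i $ j / fact n * of_real t ^ n * w $ j)"
    by (intro suminf_sum[symmetric] summable_mult2 s)
  finally show ?E unfolding P e .
qed

lemma matrix_exp_has_vector_derivative:
  fixes M :: "complex ^ 'n ^ 'n"
  shows "((\<lambda>t. (matrix_exp (t *\<^sub>R M) *v w) $ i) has_vector_derivative
    (M *v (matrix_exp (t *\<^sub>R M) *v w)) $ i) (at t)"
proof -
  define x where "x = (\<lambda>n. (((**) M) ^^ n) (mat 1) *v w)"
  have x_Suc: "x (Suc n) = M *v x n" for n
    by (simp add: x_def matrix_vector_mul_assoc)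
  define g where "g = (\<lambda>z. \<Sum>n. x n $ i / fact n * z ^ n)"
  have "(g has_field_derivative (\<Sum>n. diffs (\<lambda>n. x n $ i / fact n) n
    * of_real t ^ n)) (at (of_real t))"
    unfolding g_def x_def
    by (rule termdiffs_strong_converges_everywhere) (rule matrix_exp_vector_nth)
  \<comment> \<open>\<open>diffs\<close> multiplies the shifted coefficient by \<open>n + 1\<close>,
    which cancels against the factorial and leaves \<open>M *v x n\<close> over
    \<open>fact n\<close>.\<close>
  also have "(\<Sum>n. diffs (\<lambda>n. x n $ i / fact n) n * of_real t ^ n) =
      (\<Sum>n. \<Sum>j\<in>UNIV. M $ i $ j * (x n $ j / fact n * of_real t ^ n))"
    by (intro suminf_cong)
      (simp add: diffs_def x_Suc matrix_vector_mult_def sum_distrib_left sum_distrib_right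
        sum_divide_distrib field_simps del: of_nat_Suc)
  also have "\<dots> = (\<Sum>j\<in>UNIV. \<Sum>n. M $ i $ j * (x n $ j / fact n * of_real t ^ n))"
    unfolding x_def by (intro suminf_sum summable_mult matrix_exp_vector_nth)
  also have "\<dots> = (M *v (matrix_exp (t *\<^sub>R M) *v w)) $ i"
    unfolding matrix_vector_mult_def[of M] matrix_exp_vector_nth(2) x_def
    by (simp only: vec_lambda_beta suminf_mult[OF matrix_exp_vector_nth(1)]
      matrix_exp_vector_nth(2))
  finally have "((\<lambda>t. g (of_real t)) has_vector_derivative (M *v (matrix_exp (t *\<^sub>R M) *v w)) $
    i) (at t)"
    by (rule has_vector_derivative_real_field)
  then show ?thesis
    unfolding g_def x_def matrix_exp_vector_nth(2) .
qed

lemma matrix_exp_zero: "matrix_exp (0 *\<^sub>R M) *v w = w"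
  unfolding vec_eq_iff matrix_exp_vector_nth(2) of_real_0 powser_zero by simp

section \<open>The flow of the transformed system and its pointwise decay\<close>

definition flow ::
    "real \<Rightarrow> real \<Rightarrow> real \<Rightarrow> real \<Rightarrow> real \<Rightarrow> real \<Rightarrow> real \<times> real \<times> real \<Rightarrow> nat \<Rightarrow> real
      \<Rightarrow> complex ^ 8 \<Rightarrow> real \<Rightarrow> complex ^ 8" where
  "flow k1 k2 k3 k4 k5 \<gamma> \<tau> \<epsilon>0 \<xi> w t = matrix_exp (t *\<^sub>R symbol_matrix k1 k2 k3 k4 k5 \<gamma> \<tau> \<epsilon>0 \<xi>) *v w"

lemma flow_zero: "flow k1 k2 k3 k4 k5 \<gamma> \<tau> \<epsilon>0 \<xi> w 0 = w"
  unfolding flow_def by (rule matrix_exp_zero)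

lemma flow_smult: "flow k1 k2 k3 k4 k5 \<gamma> \<tau> \<epsilon>0 \<xi> (c *s w) t = c *s flow k1 k2 k3 k4 k5 \<gamma> \<tau> \<epsilon>0 \<xi> w t"
  unfolding flow_def
  by (simp add: vec_eq_iff matrix_vector_mult_def sum_distrib_left mult_ac)

lemma flow_has_real_derivative:
  fixes k1 k2 k3 k4 k5 \<gamma> \<xi> :: real and \<tau> \<epsilon>0 w
  defines "X \<equiv> flow k1 k2 k3 k4 k5 \<gamma> \<tau> \<epsilon>0 \<xi> w" and "A \<equiv> symbol k1 k2 k3 k4 k5 \<gamma> \<tau> \<epsilon>0 \<xi>"
  shows "((\<lambda>t. Re (X t $ i)) has_real_derivative Re (A (X t) $ i)) (at t)"
    and "((\<lambda>t. Im (X t $ i)) has_real_derivative Im (A (X t) $ i)) (at t)"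
proof -
  have d: "((\<lambda>t. X t $ i) has_vector_derivative (A (X t) $ i)) (at t)"
    using matrix_exp_has_vector_derivative[of "symbol_matrix k1 k2 k3 k4 k5 \<gamma> \<tau> \<epsilon>0 \<xi>" w i t]
    unfolding symbol_matrix_mult by (simp add: X_def A_def flow_def)
  show "((\<lambda>t. Re (X t $ i)) has_real_derivative Re (A (X t) $ i)) (at t)"
    using bounded_linear.has_vector_derivative[OF bounded_linear_Re d]
    by (simp add: has_real_derivative_iff_has_vector_derivative)
  show "((\<lambda>t. Im (X t $ i)) has_real_derivative Im (A (X t) $ i)) (at t)"
    using bounded_linear.has_vector_derivative[OF bounded_linear_Im d]
    by (simp add: has_real_derivative_iff_has_vector_derivative)
qed

text \<open>Squaring \<open>\<i> * \<xi>\<close> produces the sign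
  \<open>(- 1) ^ \<epsilon>0\<close>, which cancels the one in the system. In both cases the damping
  coefficient is therefore \<open>k5 * \<xi> ^ (2 * \<epsilon>0)\<close>.\<close>

lemma symbol_nth:
  fixes k1 k2 k3 k4 k5 \<gamma> \<tau>1 \<tau>2 \<tau>3 \<xi> :: real and \<epsilon>0 w
  defines "A \<equiv> symbol k1 k2 k3 k4 k5 \<gamma> (\<tau>1, \<tau>2, \<tau>3) \<epsilon>0 \<xi>"
  shows "A w $ 1 = \<i> * \<xi> * w $ 2 + w $ 4 + w $ 6"
    "A w $ 2 = k1 * (\<i> * \<xi> * w $ 1) - \<tau>1 * \<gamma> * w $ 8"
    "A w $ 3 = \<i> * \<xi> * w $ 4"
    "A w $ 4 = k2 * (\<i> * \<xi> * w $ 3) - k1 * w $ 1 - \<tau>2 * \<gamma> * w $ 8"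
    "A w $ 5 = \<i> * \<xi> * w $ 6"
    "A w $ 6 = k3 * (\<i> * \<xi> * w $ 5) - k1 * w $ 1 - \<tau>3 * \<gamma> * w $ 8"
    "A w $ 7 = \<i> * \<xi> * w $ 8"
    "A w $ 8 = k4 * (\<i> * \<xi> * w $ 7) - complex_of_real (k5 * \<xi> ^ (2 * \<epsilon>0)) * w $ 8
      + \<gamma> * (\<tau>1 * w $ 2 + \<tau>2 * w $ 4 + \<tau>3 * w $ 6)"
proof -
  have "(\<i> * complex_of_real \<xi>) ^ (2 * \<epsilon>0) = (- 1) ^ \<epsilon>0 * of_real (\<xi> ^ (2 * \<epsilon>0))"
    by (simp add: power_mult power_mult_distrib power_minus[of "(complex_of_real \<xi>)\<^sup>2"])
  then have "(- 1) ^ \<epsilon>0 * (\<i> * complex_of_real \<xi>) ^ (2 * \<epsilon>0) = of_real (\<xi> ^ (2 * \<epsilon>0))"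
    by (simp add: mult.assoc[symmetric] power_mult_distrib[symmetric])
  then have e: "(- 1) ^ \<epsilon>0 * of_real k5 * ((\<i> * complex_of_real \<xi>) ^ (2 * \<epsilon>0) * w $ 8)
      = of_real (k5 * \<xi> ^ (2 * \<epsilon>0)) * w $ 8"
    by (simp add: algebra_simps)
  show "A w $ 1 = \<i> * \<xi> * w $ 2 + w $ 4 + w $ 6"
    "A w $ 2 = k1 * (\<i> * \<xi> * w $ 1) - \<tau>1 * \<gamma> * w $ 8"
    "A w $ 3 = \<i> * \<xi> * w $ 4"
    "A w $ 4 = k2 * (\<i> * \<xi> * w $ 3) - k1 * w $ 1 - \<tau>2 * \<gamma> * w $ 8"
    "A w $ 5 = \<i> * \<xi> * w $ 6"
    "A w $ 6 = k3 * (\<i> * \<xi> * w $ 5) - k1 * w $ 1 - \<tau>3 * \<gamma> * w $ 8"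
    "A w $ 7 = \<i> * \<xi> * w $ 8"
    "A w $ 8 = k4 * (\<i> * \<xi> * w $ 7) - complex_of_real (k5 * \<xi> ^ (2 * \<epsilon>0)) * w $ 8
      + \<gamma> * (\<tau>1 * w $ 2 + \<tau>2 * w $ 4 + \<tau>3 * w $ 6)"
    unfolding A_def symbol_def Let_def prod.case vector_8 e by simp_all
qed

text \<open>
  With \<open>u\<close>, \<open>z\<close>, \<open>\<phi>\<close>, \<open>\<sigma>\<close> (respectively \<open>u\<close>, \<open>z\<close>, \<open>\<phi>\<close>, \<open>\<eta>\<close>) multiplied by \<open>\<i>\<close> the symbol is
  real, so real and imaginary parts evolve separately. The half energies measure one of
  the two parts; the other one is the same part of \<open>-\<i> w\<close>.
\<close>

definition half_energy_y :: "real \<Rightarrow> real \<Rightarrow> real \<Rightarrow> real \<Rightarrow> complex ^ 8 \<Rightarrow> real" where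
  "half_energy_y k1 k2 k3 k4 w = k1 * (Re (w $ 1))\<^sup>2 + (Im (w $ 2))\<^sup>2 + k2 * (Im (w $ 3))\<^sup>2
    + (Re (w $ 4))\<^sup>2 + k3 * (Im (w $ 5))\<^sup>2 + (Re (w $ 6))\<^sup>2 + k4 * (Im (w $ 7))\<^sup>2 + (Re (w $ 8))\<^sup>2"

definition half_energy_u :: "real \<Rightarrow> real \<Rightarrow> real \<Rightarrow> real \<Rightarrow> complex ^ 8 \<Rightarrow> real" where
  "half_energy_u k1 k2 k3 k4 w = k1 * (Re (w $ 1))\<^sup>2 + (Im (w $ 2))\<^sup>2 + k2 * (Im (w $ 3))\<^sup>2
    + (Re (w $ 4))\<^sup>2 + k3 * (Im (w $ 5))\<^sup>2 + (Re (w $ 6))\<^sup>2 + k4 * (Re (w $ 7))\<^sup>2 + (Im (w $ 8))\<^sup>2"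

lemma norm_square_8:
  "(norm (w :: complex ^ 8))\<^sup>2 = (\<Sum>i\<in>{1, 2, 3, 4, 5, 6, 7, 8}. (Re (w $ i))\<^sup>2 + (Im (w $ i))\<^sup>2)"
  by (simp add: norm_vec_def L2_set_def sum_nonneg cmod_power2 UNIV_8[symmetric])

text \<open>The hypothesis is applied to \<open>w\<close> and to \<open>- \<i> * w\<close>, and the
  results are added. The sum is an energy of all real and imaginary parts with weights
  \<open>1\<close>, \<open>k1\<close>, ..., \<open>k4\<close>, which lie between
  \<open>\<mu>\<close> and \<open>M\<close>.\<close>

lemma full_decay_of_half_decay:
  assumes k: "k1 > 0" "k2 > 0" "k3 > 0" "k4 > 0"
    and e: "e = half_energy_y k1 k2 k3 k4 \<or> e = half_energy_u k1 k2 k3 k4"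
    and lin: "\<And>c w. x (c *s w) = c *s x w"
    and dec: "\<And>w. e (x w) \<le> B * e w" and B: "B \<ge> 0"
  shows "(norm (x w))\<^sup>2
    \<le> (1 + k1 + k2 + k3 + k4) / min 1 (min k1 (min k2 (min k3 k4))) * B * (norm w)\<^sup>2"
proof -
  define M where "M = 1 + k1 + k2 + k3 + k4"
  define \<mu> where "\<mu> = min 1 (min k1 (min k2 (min k3 k4)))"
  have \<mu>: "\<mu> > 0" "\<mu> \<le> 1" "\<mu> \<le> k1" "\<mu> \<le> k2" "\<mu> \<le> k3" "\<mu> \<le> k4" using k by (auto simp: \<mu>_def)
  have M: "1 \<le> M" "k1 \<le> M" "k2 \<le> M" "k3 \<le> M" "k4 \<le> M" using k by (auto simp: M_def)
  define F where "F = (\<lambda>w. e w + e ((- \<i>) *s w))"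
  have d8: "distinct [1, 2, 3, 4, 5, 6, 7, 8 :: 8]" by simp
  have F: "F w = k1 * ((Re (w $ 1))\<^sup>2 + (Im (w $ 1))\<^sup>2) + ((Re (w $ 2))\<^sup>2 + (Im (w $ 2))\<^sup>2)
      + k2 * ((Re (w $ 3))\<^sup>2 + (Im (w $ 3))\<^sup>2) + ((Re (w $ 4))\<^sup>2 + (Im (w $ 4))\<^sup>2)
      + k3 * ((Re (w $ 5))\<^sup>2 + (Im (w $ 5))\<^sup>2) + ((Re (w $ 6))\<^sup>2 + (Im (w $ 6))\<^sup>2)
      + k4 * ((Re (w $ 7))\<^sup>2 + (Im (w $ 7))\<^sup>2) + ((Re (w $ 8))\<^sup>2 + (Im (w $ 8))\<^sup>2)" for w
    using e unfolding F_def half_energy_y_def half_energy_u_def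
    by (auto simp: algebra_simps)
  have n: "(norm w)\<^sup>2 = ((Re (w $ 1))\<^sup>2 + (Im (w $ 1))\<^sup>2) + ((Re (w $ 2))\<^sup>2 + (Im (w $ 2))\<^sup>2)
      + ((Re (w $ 3))\<^sup>2 + (Im (w $ 3))\<^sup>2) + ((Re (w $ 4))\<^sup>2 + (Im (w $ 4))\<^sup>2)
      + ((Re (w $ 5))\<^sup>2 + (Im (w $ 5))\<^sup>2) + ((Re (w $ 6))\<^sup>2 + (Im (w $ 6))\<^sup>2)
      + ((Re (w $ 7))\<^sup>2 + (Im (w $ 7))\<^sup>2) + ((Re (w $ 8))\<^sup>2
        + (Im (w $ 8))\<^sup>2)" for w :: "complex ^ 8"
    unfolding norm_square_8 using d8 by simp
  have lower: "\<mu> * (norm w)\<^sup>2 \<le> F w" for w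
    unfolding F n distrib_left using \<mu>
    by (intro add_mono mult_right_mono) (auto simp: mult_left_le_one_le)
  have upper: "F w \<le> M * (norm w)\<^sup>2" for w
    unfolding F n distrib_left using M
    by (intro add_mono mult_right_mono) (auto simp: mult_le_cancel_right1 not_less)
  have "\<mu> * (norm (x w))\<^sup>2 \<le> F (x w)" by (rule lower)
  also have "F (x w) = e (x w) + e (x ((- \<i>) *s w))" unfolding F_def lin ..
  also have "\<dots> \<le> B * e w + B * e ((- \<i>) *s w)" by (intro add_mono dec)
  also have "\<dots> = B * F w" by (simp add: F_def algebra_simps)
  also have "\<dots> \<le> B * (M * (norm w)\<^sup>2)" by (intro mult_left_mono upper B)
  finally have "(norm (x w))\<^sup>2 \<le> B * (M * (norm w)\<^sup>2) / \<mu>" using \<mu> by (simp add: field_simps)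
  then show ?thesis by (simp add: M_def \<mu>_def mult_ac)
qed

text \<open>Exchanging \<open>(z, y, k2)\<close> with \<open>(\<phi>, \<theta>, k3)\<close> turns a
  coupling through \<open>\<theta>\<close> into one through \<open>y\<close>. The indices
  \<open>iz\<close>, \<open>iy\<close>, \<open>ip\<close>, \<open>it\<close> and the coefficients
  \<open>kz\<close>, \<open>kp\<close> name the components and speeds after this exchange, so that
  one argument serves both.\<close>

lemma half_decay_y:
  assumes k: "k1 > 0" "k2 > 0" "k3 > 0" "k4 > 0" and \<gamma>: "\<gamma> \<noteq> 0" and K: "K > 0"
    and \<tau>: "\<tau> = (0, 1, 0) \<and> b = sqrt k2 \<and> c = sqrt k3 \<or> \<tau> = (0, 0, 1) \<and> b = sqrt k3 \<and> c = sqrt k2"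
    and W: "\<And>\<xi>. \<xi> \<in> X \<Longrightarrow> weights_y (sqrt k1) b c K \<xi> (k5 * \<xi> ^ (2 * \<epsilon>0)) (s \<xi>) (m \<xi>) (n \<xi>) (q \<xi>)
      (\<kappa> \<xi>) (p \<xi>) (f \<xi>) (\<rho> \<xi>)"
  obtains \<omega> where "\<omega> > 0" "\<And>\<xi> w t. \<xi> \<in> X \<Longrightarrow> t \<ge> 0 \<Longrightarrow>
    half_energy_y k1 k2 k3 k4 (flow k1 k2 k3 k4 k5 \<gamma> \<tau> \<epsilon>0 \<xi> w t)
      \<le> 3 * exp (- \<omega> * \<rho> \<xi> * t) * half_energy_y k1 k2 k3 k4 w"
proof -
  have "\<exists>iz iy ip it kz kp. kz > 0 \<and> kp > 0 \<and> b = sqrt kz \<and> c = sqrt kp \<and>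
    (\<forall>\<xi> w. let A = symbol k1 k2 k3 k4 k5 \<gamma> \<tau> \<epsilon>0 \<xi> w in
      A $ 1 = \<i> * \<xi> * w $ 2 + w $ iy + w $ it \<and> A $ 2 = k1 * (\<i> * \<xi> * w $ 1) \<and>
      A $ iz = \<i> * \<xi> * w $ iy \<and> A $ iy = kz * (\<i> * \<xi> * w $ iz) - k1 * w $ 1 - \<gamma> * w $ 8 \<and>
      A $ ip = \<i> * \<xi> * w $ it \<and> A $ it = kp * (\<i> * \<xi> * w $ ip) - k1 * w $ 1 \<and>
      A $ 7 = \<i> * \<xi> * w $ 8 \<and>
      A $ 8 = k4 * (\<i> * \<xi> * w $ 7) - complex_of_real (k5 * \<xi> ^ (2 * \<epsilon>0)) * w $ 8 + \<gamma> * w $ iy) \<and>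
    (\<forall>w. half_energy_y k1 k2 k3 k4 w = k1 * (Re (w $ 1))\<^sup>2 + (Im (w $ 2))\<^sup>2 + kz * (Im (w $ iz))\<^sup>2
      + (Re (w $ iy))\<^sup>2 + kp * (Im (w $ ip))\<^sup>2 + (Re (w $ it))\<^sup>2 + k4 * (Im (w $ 7))\<^sup>2
        + (Re (w $ 8))\<^sup>2)"
    using \<tau>
  proof (elim disjE conjE)
    assume "\<tau> = (0, 1, 0)" "b = sqrt k2" "c = sqrt k3"
    then show ?thesis using k
      by (rule_tac exI[of _ 3], rule_tac exI[of _ 4], rule_tac exI[of _ 5], rule_tac exI[of _ 6],
          rule_tac exI[of _ k2], rule_tac exI[of _ k3]) (simp add: symbol_nth half_energy_y_def)
  next
    assume "\<tau> = (0, 0, 1)" "b = sqrt k3" "c = sqrt k2"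
    then show ?thesis using k
      by (rule_tac exI[of _ 5], rule_tac exI[of _ 6], rule_tac exI[of _ 3], rule_tac exI[of _ 4],
          rule_tac exI[of _ k3], rule_tac exI[of _ k2]) (simp add: symbol_nth half_energy_y_def)
  qed
  then obtain iz iy ip it kz kp where kzp: "kz > 0" "kp > 0" and bc: "b = sqrt kz" "c = sqrt kp"
    and A: "\<And>\<xi> w. symbol k1 k2 k3 k4 k5 \<gamma> \<tau> \<epsilon>0 \<xi> w $ 1 = \<i> * \<xi> * w $ 2 + w $ iy + w $ it"
      "\<And>\<xi> w. symbol k1 k2 k3 k4 k5 \<gamma> \<tau> \<epsilon>0 \<xi> w $ 2 = k1 * (\<i> * \<xi> * w $ 1)"
      "\<And>\<xi> w. symbol k1 k2 k3 k4 k5 \<gamma> \<tau> \<epsilon>0 \<xi> w $ iz = \<i> * \<xi> * w $ iy"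
      "\<And>\<xi> w. symbol k1 k2 k3 k4 k5 \<gamma> \<tau> \<epsilon>0 \<xi> w $ iy = kz * (\<i> * \<xi> * w $ iz) - k1 * w $ 1 - \<gamma> * w $ 8"
      "\<And>\<xi> w. symbol k1 k2 k3 k4 k5 \<gamma> \<tau> \<epsilon>0 \<xi> w $ ip = \<i> * \<xi> * w $ it"
      "\<And>\<xi> w. symbol k1 k2 k3 k4 k5 \<gamma> \<tau> \<epsilon>0 \<xi> w $ it = kp * (\<i> * \<xi> * w $ ip) - k1 * w $ 1"
      "\<And>\<xi> w. symbol k1 k2 k3 k4 k5 \<gamma> \<tau> \<epsilon>0 \<xi> w $ 7 = \<i> * \<xi> * w $ 8"
      "\<And>\<xi> w. symbol k1 k2 k3 k4 k5 \<gamma> \<tau> \<epsilon>0 \<xi> w $ 8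
        = k4 * (\<i> * \<xi> * w $ 7) - complex_of_real (k5 * \<xi> ^ (2 * \<epsilon>0)) * w $ 8 + \<gamma> * w $ iy"
    and e: "\<And>w. half_energy_y k1 k2 k3 k4 w = k1 * (Re (w $ 1))\<^sup>2 + (Im (w $ 2))\<^sup>2
      + kz * (Im (w $ iz))\<^sup>2
      + (Re (w $ iy))\<^sup>2 + kp * (Im (w $ ip))\<^sup>2 + (Re (w $ it))\<^sup>2 + k4 * (Im (w $ 7))\<^sup>2
        + (Re (w $ 8))\<^sup>2"
    unfolding Let_def by blast
  \<comment> \<open>A trajectory is indexed by its frequency and its initial value, so the rate
    obtained is uniform in both.\<close>
  define x where "x = (\<lambda>r t. flow k1 k2 k3 k4 k5 \<gamma> \<tau> \<epsilon>0 (fst r) (snd r) t)"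
  have D: "((\<lambda>t. Re (x r t $ i)) has_real_derivative
        Re (symbol k1 k2 k3 k4 k5 \<gamma> \<tau> \<epsilon>0 (fst r) (x r t) $ i)) (at t)"
      "((\<lambda>t. Im (x r t $ i)) has_real_derivative
        Im (symbol k1 k2 k3 k4 k5 \<gamma> \<tau> \<epsilon>0 (fst r) (x r t) $ i)) (at t)"
    for r i t unfolding x_def by (rule flow_has_real_derivative)+
  have s: "sqrt k1 > 0" "sqrt kz > 0" "sqrt kp > 0" "sqrt k4 > 0" using k kzp by auto
  have sq: "sqrt k1 * sqrt k1 = k1" "sqrt kz * sqrt kz = kz" "sqrt kp * sqrt kp = kp"
    "sqrt k4 * sqrt k4 = k4" "(sqrt k1)\<^sup>2 = k1" "(sqrt kz)\<^sup>2 = kz" "(sqrt kp)\<^sup>2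
      = kp" "(sqrt k4)\<^sup>2 = k4"
    using k kzp by auto
  have sq': "sqrt k1 * (sqrt k1 * z) = k1 * z" "sqrt kz * (sqrt kz * z) = kz * z"
    "sqrt kp * (sqrt kp * z) = kp * z" "sqrt k4 * (sqrt k4 * z) = k4 * z" for z
    unfolding mult.assoc[symmetric] sq by simp_all
  have W': "weights_y (sqrt k1) (sqrt kz) (sqrt kp) K (fst r) (k5 * fst r ^ (2 * \<epsilon>0)) (s (fst r))
      (m (fst r)) (n (fst r)) (q (fst r)) (\<kappa> (fst r)) (p (fst r)) (f (fst r)) (\<rho> (fst r))"
    if "r \<in> X \<times> UNIV" for r :: "real \<times> (complex ^ 8)"
    using W[of "fst r"] that by (auto simp: bc)
  show ?thesis
  proof (rule decay_coupled_y[where e = "sqrt k4" and g = \<gamma> and \<xi> = fst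
        and V = "\<lambda>r t. sqrt k1 * Re (x r t $ 1)" and U = "\<lambda>r t. Im (x r t $ 2)"
        and Z = "\<lambda>r t. sqrt kz * Im (x r t $ iz)" and Y = "\<lambda>r t. Re (x r t $ iy)"
        and \<Phi> = "\<lambda>r t. sqrt kp * Im (x r t $ ip)" and \<Theta> = "\<lambda>r t. Re (x r t $ it)"
        and S = "\<lambda>r t. sqrt k4 * Im (x r t $ 7)" and H = "\<lambda>r t. Re (x r t $ 8)",
        OF s \<gamma> K _ _ _ _ _ _ _ _ W'])
    fix \<omega> :: real assume "\<omega> > 0" and
      *: "\<And>(r :: real \<times> (complex ^ 8)) t. r \<in> X \<times> UNIV \<Longrightarrow> t \<ge> 0 \<Longrightarrow>
        (sqrt k1 * Re (x r t $ 1))\<^sup>2 + (Im (x r t $ 2))\<^sup>2 + (sqrt kz * Im (x r t $ iz))\<^sup>2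
          + (Re (x r t $ iy))\<^sup>2
        + (sqrt kp * Im (x r t $ ip))\<^sup>2 + (Re (x r t $ it))\<^sup>2 + (sqrt k4 * Im (x r t $ 7))\<^sup>2
          + (Re (x r t $ 8))\<^sup>2
        \<le> 3 * exp (- \<omega> * \<rho> (fst r) * t) * ((sqrt k1 * Re (x r 0 $ 1))\<^sup>2 + (Im (x r 0 $ 2))\<^sup>2
        + (sqrt kz * Im (x r 0 $ iz))\<^sup>2 + (Re (x r 0 $ iy))\<^sup>2 + (sqrt kp * Im (x r 0 $ ip))\<^sup>2
        + (Re (x r 0 $ it))\<^sup>2 + (sqrt k4 * Im (x r 0 $ 7))\<^sup>2 + (Re (x r 0 $ 8))\<^sup>2)"
    show ?thesis
    proof (rule that[OF \<open>\<omega> > 0\<close>])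
      fix \<xi> :: real and w :: "complex ^ 8" and t :: real assume "\<xi> \<in> X" "t \<ge> 0"
      then show "half_energy_y k1 k2 k3 k4 (flow k1 k2 k3 k4 k5 \<gamma> \<tau> \<epsilon>0 \<xi> w t)
          \<le> 3 * exp (- \<omega> * \<rho> \<xi> * t) * half_energy_y k1 k2 k3 k4 w"
        using *[of "(\<xi>, w)" t] by (simp add: e power_mult_distrib sq x_def flow_zero)
    qed
  qed ((rule DERIV_cong, rule DERIV_cmult[OF D(1)] DERIV_cmult[OF D(2)] D(1) D(2),
      simp add: A algebra_simps sq sq')+)
qed

text \<open>Since \<open>\<eta>\<close> is now coupled to \<open>u\<close>, its imaginary part
  belongs to the half system, and with it the real part of \<open>\<sigma>\<close>. The sign in
  \<open>S = - sqrt k4 * Re \<sigma>\<close> restores the form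
  \<open>S' = e * \<xi> * H\<close>.\<close>

lemma half_decay_u:
  assumes k: "k1 > 0" "k2 > 0" "k3 > 0" "k4 > 0" and \<gamma>: "\<gamma> \<noteq> 0" and K: "K > 0" and ne: "k2 \<noteq> k3"
    and W: "\<And>\<xi>. \<xi> \<in> X \<Longrightarrow> weights_u K \<xi> (k5 * \<xi> ^ (2 * \<epsilon>0)) (s \<xi>) (\<mu> \<xi>) (m \<xi>) (n \<xi>) (l \<xi>) (q \<xi>) (\<rho> \<xi>)"
  obtains \<omega> where "\<omega> > 0" "\<And>\<xi> w t. \<xi> \<in> X \<Longrightarrow> t \<ge> 0 \<Longrightarrow>
    half_energy_u k1 k2 k3 k4 (flow k1 k2 k3 k4 k5 \<gamma> (1, 0, 0) \<epsilon>0 \<xi> w t)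
      \<le> 3 * exp (- \<omega> * \<rho> \<xi> * t) * half_energy_u k1 k2 k3 k4 w"
proof -
  define x where "x = (\<lambda>r t. flow k1 k2 k3 k4 k5 \<gamma> (1, 0, 0) \<epsilon>0 (fst r) (snd r) t)"
  have D: "((\<lambda>t. Re (x r t $ i)) has_real_derivative Re (symbol k1 k2 k3 k4 k5 \<gamma> (1, 0, 0) \<epsilon>0
    (fst r) (x r t) $ i)) (at t)"
      "((\<lambda>t. Im (x r t $ i)) has_real_derivative Im (symbol k1 k2 k3 k4 k5 \<gamma> (1, 0, 0) \<epsilon>0 (fst
        r) (x r t) $ i)) (at t)"
    for r i t unfolding x_def by (rule flow_has_real_derivative)+
  have s: "sqrt k1 > 0" "sqrt k2 > 0" "sqrt k3 > 0" "sqrt k4 > 0" using k by auto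
  have sq: "sqrt k1 * sqrt k1 = k1" "sqrt k2 * sqrt k2 = k2" "sqrt k3 * sqrt k3
    = k3" "sqrt k4 * sqrt k4 = k4"
    "(sqrt k1)\<^sup>2 = k1" "(sqrt k2)\<^sup>2 = k2" "(sqrt k3)\<^sup>2 = k3" "(sqrt k4)\<^sup>2 = k4"
    using k by auto
  have sq': "sqrt k1 * (sqrt k1 * z) = k1 * z" "sqrt k2 * (sqrt k2 * z) = k2 * z"
    "sqrt k3 * (sqrt k3 * z) = k3 * z" "sqrt k4 * (sqrt k4 * z) = k4 * z" for z
    unfolding mult.assoc[symmetric] sq by simp_all
  have ne': "(sqrt k2)\<^sup>2 \<noteq> (sqrt k3)\<^sup>2" using ne by (simp add: sq)
  have W': "weights_u K (fst r) (k5 * fst r ^ (2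
    * \<epsilon>0)) (s (fst r)) (\<mu> (fst r)) (m (fst r)) (n (fst r)) (l (fst r)) (q (fst r))
     (\<rho> (fst r))" if "r \<in> X \<times> UNIV" for r :: "real \<times> (complex ^ 8)"
    using W[of "fst r"] that by auto
  show ?thesis
  proof (rule decay_coupled_u[where a = "sqrt k1" and b = "sqrt k2" and c = "sqrt k3" and e
    = "sqrt k4" and g = \<gamma>
        and K = K and R = "X \<times> UNIV" and \<xi> = fst
        and V = "\<lambda>r t. sqrt k1 * Re (x r t $ 1)" and U = "\<lambda>r t. Im (x r t $ 2)"
        and Z = "\<lambda>r t. sqrt k2 * Im (x r t $ 3)" and Y = "\<lambda>r t. Re (x r t $ 4)"
        and \<Phi> = "\<lambda>r t. sqrt k3 * Im (x r t $ 5)" and \<Theta> = "\<lambda>r t. Re (x r t $ 6)"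
        and S = "\<lambda>r t. (- sqrt k4) * Re (x r t $ 7)" and H = "\<lambda>r t. Im (x r t $ 8)",
        OF s \<gamma> K ne' _ _ _ _ _ _ _ _ W'])
    fix \<omega> :: real assume "\<omega> > 0" and
      *: "\<And>(r :: real \<times> (complex ^ 8)) t. r \<in> X \<times> UNIV \<Longrightarrow> t \<ge> 0 \<Longrightarrow>
        (sqrt k1 * Re (x r t $ 1))\<^sup>2 + (Im (x r t $ 2))\<^sup>2 + (sqrt k2 * Im (x r t $ 3))\<^sup>2
          + (Re (x r t $ 4))\<^sup>2
        + (sqrt k3 * Im (x r t $ 5))\<^sup>2 + (Re (x r t $ 6))\<^sup>2 + ((- sqrt k4) * Re (x r t $ 7))\<^sup>2
          + (Im (x r t $ 8))\<^sup>2
        \<le> 3 * exp (- \<omega> * \<rho> (fst r) * t) * ((sqrt k1 * Re (x r 0 $ 1))\<^sup>2 + (Im (x r 0 $ 2))\<^sup>2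
        + (sqrt k2 * Im (x r 0 $ 3))\<^sup>2 + (Re (x r 0 $ 4))\<^sup>2 + (sqrt k3 * Im (x r 0 $ 5))\<^sup>2
        + (Re (x r 0 $ 6))\<^sup>2 + ((- sqrt k4) * Re (x r 0 $ 7))\<^sup>2 + (Im (x r 0 $ 8))\<^sup>2)"
    show ?thesis
    proof (rule that[OF \<open>\<omega> > 0\<close>])
      fix \<xi> :: real and w :: "complex ^ 8" and t :: real assume "\<xi> \<in> X" "t \<ge> 0"
      then show "half_energy_u k1 k2 k3 k4 (flow k1 k2 k3 k4 k5 \<gamma> (1, 0, 0) \<epsilon>0 \<xi> w t)
          \<le> 3 * exp (- \<omega> * \<rho> \<xi> * t) * half_energy_u k1 k2 k3 k4 w"
        using *[of "(\<xi>, w)" t] by (simp add: half_energy_u_def power_mult_distrib sq x_def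
          flow_zero)
    qed
  qed ((rule DERIV_cong, rule DERIV_cmult[OF D(1)] DERIV_cmult[OF D(2)] D(1) D(2),
      simp add: symbol_nth algebra_simps sq sq')+)
qed

text \<open>The frequency \<open>0\<close> is excluded because the multipliers divide by
  \<open>\<xi>\<close>; it is a null set in the integrals to come. The exponent \<open>p\<close>
  combines the factor \<open>\<xi> ^ (2 * \<epsilon>0)\<close> of the damping with the
  \<open>\<xi>\<^sup>2\<close> or \<open>\<xi> ^ 4\<close> lost in the weights.\<close>

lemma flow_decay:
  assumes k: "k1 > 0" "k2 > 0" "k3 > 0" "k4 > 0" "k5 > 0" and \<gamma>: "\<gamma> \<noteq> 0" and \<epsilon>: "\<epsilon>0 \<in> {0, 1}"
    and cases: "\<tau> = (1, 0, 0) \<and> k2 \<noteq> k3 \<and> p = 4 + 2 * \<epsilon>0 \<and> q = 4 \<or>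
      \<tau> \<in> {(0, 1, 0), (0, 0, 1)} \<and> p = 2 + 2 * \<epsilon>0 \<and> (k1 = k2 \<and> k2 = k3 \<and> q = 2 \<or> q = 6)"
  obtains C c where "C > 0" "c > 0"
    "\<And>\<xi> w t. \<xi> \<noteq> 0 \<Longrightarrow> t \<ge> 0 \<Longrightarrow> (norm (flow k1 k2 k3 k4 k5 \<gamma> \<tau> \<epsilon>0 \<xi> w t))\<^sup>2
      \<le> C * exp (- c * (if \<bar>\<xi>\<bar> \<le> 1 then \<bar>\<xi>\<bar> ^ p else 1 / \<bar>\<xi>\<bar> ^ q) * t) * (norm w)\<^sup>2"
proof -
  define d where "d = (\<lambda>\<xi>. k5 * \<xi> ^ (2 * \<epsilon>0))"
  define A B where "A = {\<xi> :: real. \<xi> \<noteq> 0 \<and> \<bar>\<xi>\<bar> \<le> 1}" and "B = {\<xi> :: real. 1 \<le> \<bar>\<xi>\<bar>}"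
  have low: "\<xi> \<noteq> 0" "\<bar>\<xi>\<bar> \<le> 1" "0 < d \<xi>" "d \<xi> \<le> k5" if "\<xi> \<in> A" for \<xi>
    using that k \<epsilon> power_le_one[of "\<bar>\<xi>\<bar>" 2] by (auto simp: A_def d_def mult_left_le)
  have high: "1 \<le> \<bar>\<xi>\<bar>" "k5 \<le> d \<xi>" "d \<xi> \<le> k5 * \<xi>\<^sup>2" if "\<xi> \<in> B" for \<xi>
  proof -
    have "1 \<le> \<xi>\<^sup>2" using that one_le_power[of "\<bar>\<xi>\<bar>" 2] by (simp add: B_def)
    then show "1 \<le> \<bar>\<xi>\<bar>" "k5 \<le> d \<xi>" "d \<xi> \<le> k5 * \<xi>\<^sup>2" using that k \<epsilon> by (auto simp: B_def d_def)
  qed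
  have K: "1 + k5 + k5\<^sup>2 > 0" "1 + k5 + 1 / k5 > 0" using k by (auto intro: add_pos_pos)
  define \<sigma> where "\<sigma> = min 1 k5"
  have \<sigma>: "\<sigma> > 0" using k by (simp add: \<sigma>_def)
  have even: "even p" "even q" using cases by auto
  have "\<exists>e \<omega>1 \<omega>2. (e = half_energy_y k1 k2 k3 k4 \<or> e = half_energy_u k1 k2 k3 k4) \<and> \<omega>1 > 0
    \<and> \<omega>2 > 0 \<and>
    (\<forall>\<xi>\<in>A. \<forall>w. \<forall>t\<ge>0. e (flow k1 k2 k3 k4 k5 \<gamma> \<tau> \<epsilon>0 \<xi> w t)
      \<le> 3 * exp (- \<omega>1 * (k5 * \<xi> ^ p) * t) * e w) \<and>
    (\<forall>\<xi>\<in>B. \<forall>w. \<forall>t\<ge>0. e (flow k1 k2 k3 k4 k5 \<gamma> \<tau> \<epsilon>0 \<xi> w t) \<le> 3 * exp (- \<omega>2 * (\<sigma> / \<xi> ^ q) * t) * e w)"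
  proof (cases "\<tau> = (1, 0, 0)")
    case True
    then have c: "k2 \<noteq> k3" "p = 4 + 2 * \<epsilon>0" "q = 4" using cases by auto
    obtain \<omega>1 where 1: "\<omega>1 > 0" "\<And>\<xi> w t. \<xi> \<in> A \<Longrightarrow> t \<ge> 0 \<Longrightarrow>
      half_energy_u k1 k2 k3 k4 (flow k1 k2 k3 k4 k5 \<gamma> \<tau> \<epsilon>0 \<xi> w t)
        \<le> 3 * exp (- \<omega>1 * (d \<xi> * \<xi> ^ 4) * t) * half_energy_u k1 k2 k3 k4 w"
      using half_decay_u[OF k(1-4) \<gamma> K(1) c(1) weights_u_low[OF low, unfolded d_def]]
      unfolding True d_def by metis
    obtain \<omega>2 where 2: "\<omega>2 > 0" "\<And>\<xi> w t. \<xi> \<in> B \<Longrightarrow> t \<ge> 0 \<Longrightarrow>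
      half_energy_u k1 k2 k3 k4 (flow k1 k2 k3 k4 k5 \<gamma> \<tau> \<epsilon>0 \<xi> w t)
        \<le> 3 * exp (- \<omega>2 * (\<sigma> / \<xi> ^ 4) * t) * half_energy_u k1 k2 k3 k4 w"
      using half_decay_u[OF k(1-4) \<gamma> K(2) c(1) weights_u_high[OF high(1) k(5) high(2,3),
        unfolded d_def]]
      unfolding True \<sigma>_def by metis
    have "d \<xi> * \<xi> ^ 4 = k5 * \<xi> ^ p" for \<xi> by (simp add: d_def c power_add)
    then show ?thesis using 1 2 c(3) by metis
  next
    case False
    then have t: "\<tau> \<in> {(0, 1, 0), (0, 0, 1)}" and c: "p = 2 + 2 * \<epsilon>0" and q: "k1 = k2 \<and> k2 = k3
      \<and> q = 2 \<or> q = 6"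
      using cases by auto
    obtain b c where bc: "\<tau> = (0, 1, 0) \<and> b = sqrt k2 \<and> c = sqrt k3 \<or> \<tau> = (0, 0, 1)
      \<and> b = sqrt k3 \<and> c = sqrt k2"
      using t by auto
    obtain \<omega>1 where 1: "\<omega>1 > 0" "\<And>\<xi> w t. \<xi> \<in> A \<Longrightarrow> t \<ge> 0 \<Longrightarrow>
      half_energy_y k1 k2 k3 k4 (flow k1 k2 k3 k4 k5 \<gamma> \<tau> \<epsilon>0 \<xi> w t)
        \<le> 3 * exp (- \<omega>1 * (d \<xi> * \<xi>\<^sup>2) * t) * half_energy_y k1 k2 k3 k4 w"
      using half_decay_y[OF k(1-4) \<gamma> K(1) bc weights_y_low[OF low, unfolded d_def]]
      unfolding d_def by metis
    have "\<exists>\<omega>2>0. \<forall>\<xi> w t. \<xi> \<in> B \<longrightarrow> t \<ge> 0 \<longrightarrow>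
      half_energy_y k1 k2 k3 k4 (flow k1 k2 k3 k4 k5 \<gamma> \<tau> \<epsilon>0 \<xi> w t)
        \<le> 3 * exp (- \<omega>2 * (\<sigma> / \<xi> ^ q) * t) * half_energy_y k1 k2 k3 k4 w"
      using q
    proof
      assume e: "k1 = k2 \<and> k2 = k3 \<and> q = 2"
      then have bc': "b = sqrt k1" "c = sqrt k1" using bc by auto
      show ?thesis
        using half_decay_y[OF k(1-4) \<gamma> K(2) bc[unfolded bc']
            weights_y_high_equal[OF high(1) k(5) high(2,3), unfolded d_def]]
        using e unfolding \<sigma>_def by metis
    next
      assume "q = 6"
      then show ?thesis
        using half_decay_y[OF k(1-4) \<gamma> K(2) bc weights_y_high[OF high(1) k(5) high(2,3),
          unfolded d_def]]
        unfolding \<sigma>_def by metis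
    qed
    then obtain \<omega>2 where 2: "\<omega>2 > 0" "\<And>\<xi> w t. \<xi> \<in> B \<Longrightarrow> t \<ge> 0 \<Longrightarrow>
      half_energy_y k1 k2 k3 k4 (flow k1 k2 k3 k4 k5 \<gamma> \<tau> \<epsilon>0 \<xi> w t)
        \<le> 3 * exp (- \<omega>2 * (\<sigma> / \<xi> ^ q) * t) * half_energy_y k1 k2 k3 k4 w" by blast
    have "d \<xi> * \<xi>\<^sup>2 = k5 * \<xi> ^ p" for \<xi>
      by (simp add: d_def \<open>p = 2 + 2 * \<epsilon>0\<close> power_add power2_eq_square)
    then show ?thesis using 1 2 by metis
  qed
  then obtain e \<omega>1 \<omega>2 where e: "e = half_energy_y k1 k2 k3 k4 \<or> e
    = half_energy_u k1 k2 k3 k4" and \<omega>: "\<omega>1 > 0" "\<omega>2 > 0"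
    and dA: "\<And>\<xi> w t. \<xi> \<in> A \<Longrightarrow> t \<ge> 0 \<Longrightarrow> e (flow k1 k2 k3 k4 k5 \<gamma> \<tau> \<epsilon>0 \<xi> w t)
      \<le> 3 * exp (- \<omega>1 * (k5 * \<xi> ^ p) * t) * e w"
    and dB: "\<And>\<xi> w t. \<xi> \<in> B \<Longrightarrow> t \<ge> 0 \<Longrightarrow> e (flow k1 k2 k3 k4 k5 \<gamma> \<tau> \<epsilon>0 \<xi> w t)
      \<le> 3 * exp (- \<omega>2 * (\<sigma> / \<xi> ^ q) * t) * e w"
    by metis
  define M where "M = (1 + k1 + k2 + k3 + k4) / min 1 (min k1 (min k2 (min k3 k4)))"
  have M: "M > 0" unfolding M_def using k by (intro divide_pos_pos) auto
  define c where "c = min (\<omega>1 * k5) (\<omega>2 * \<sigma>)"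
  have c: "c > 0" using \<omega> k \<sigma> by (simp add: c_def)
  show ?thesis
  proof (rule that[of "M * 3" c])
    fix \<xi> t :: real and w :: "complex ^ 8" assume \<xi>: "\<xi> \<noteq> 0" and t: "t \<ge> 0"
    let ?r = "if \<bar>\<xi>\<bar> \<le> 1 then \<bar>\<xi>\<bar> ^ p else 1 / \<bar>\<xi>\<bar> ^ q"
    define x where "x = (\<lambda>w. flow k1 k2 k3 k4 k5 \<gamma> \<tau> \<epsilon>0 \<xi> w t)"
    have e0: "e w \<ge> 0" for w using e k by (auto simp: half_energy_y_def half_energy_u_def)
    have "e (x w) \<le> 3 * exp (- c * ?r * t) * e w" for w
    proof (cases "\<bar>\<xi>\<bar> \<le> 1")
      case True
      have "e (x w) \<le> 3 * exp (- \<omega>1 * (k5 * \<xi> ^ p) * t) * e w"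
        unfolding x_def using True \<xi> t by (intro dA) (auto simp: A_def)
      also have "- \<omega>1 * (k5 * \<xi> ^ p) * t \<le> - c * ?r * t"
      proof -
        have "c * (\<bar>\<xi>\<bar> ^ p * t) \<le> (\<omega>1 * k5) * (\<bar>\<xi>\<bar> ^ p * t)"
          using t by (intro mult_right_mono) (auto simp: c_def)
        then show ?thesis using True even by (simp add: power_even_abs mult_ac)
      qed
      then have "3 * exp (- \<omega>1 * (k5 * \<xi> ^ p) * t) * e w \<le> 3 * exp (- c * ?r * t) * e w"
        using e0 by (intro mult_right_mono mult_left_mono) auto
      finally show ?thesis .
    next
      case False
      have "e (x w) \<le> 3 * exp (- \<omega>2 * (\<sigma> / \<xi> ^ q) * t) * e w"
        unfolding x_def using False t by (intro dB) (auto simp: B_def)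
      also have "- \<omega>2 * (\<sigma> / \<xi> ^ q) * t \<le> - c * ?r * t"
      proof -
        have "c * (1 / \<bar>\<xi>\<bar> ^ q * t) \<le> (\<omega>2 * \<sigma>) * (1 / \<bar>\<xi>\<bar> ^ q * t)"
          using t by (intro mult_right_mono) (auto simp: c_def)
        then show ?thesis using False even by (simp add: power_even_abs mult_ac)
      qed
      then have "3 * exp (- \<omega>2 * (\<sigma> / \<xi> ^ q) * t) * e w \<le> 3 * exp (- c * ?r * t) * e w"
        using e0 by (intro mult_right_mono mult_left_mono) auto
      finally show ?thesis .
    qed
    then have "(norm (x w))\<^sup>2 \<le> M * (3 * exp (- c * ?r * t)) * (norm w)\<^sup>2"
      unfolding M_def using k e by (intro full_decay_of_half_decay) (auto simp: x_def flow_smult)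
    then show "(norm (flow k1 k2 k3 k4 k5 \<gamma> \<tau> \<epsilon>0 \<xi> w t))\<^sup>2
      \<le> M * 3 * exp (- c * ?r * t) * (norm w)\<^sup>2"
      by (simp add: x_def mult.assoc)
  qed (use M c in auto)
qed

section \<open>Test functions and weak derivatives\<close>

definition flat :: "real poly \<Rightarrow> real \<Rightarrow> real" where
  "flat p x = (if x > 0 then poly p (1 / x) * exp (- (1 / x)) else 0)"

lemma flat_tendsto_0: "(flat p \<longlongrightarrow> 0) (at_right 0)"
proof -
  have "((\<lambda>y. poly p y * exp (- y)) \<longlongrightarrow> 0) at_top" for p :: "real poly"
  proof -
    have "((\<lambda>y. \<Sum>i\<le>degree p. coeff p i * (y ^ i / exp y)) \<longlongrightarrow> (\<Sum>i\<le>degree p. coeff p i * 0)) at_top"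
      by (intro tendsto_intros tendsto_power_div_exp_0)
    then show ?thesis
      by (simp add: poly_altdef exp_minus divide_inverse sum_distrib_left mult_ac)
  qed
  then have "((\<lambda>x. poly p (inverse x) * exp (- inverse x)) \<longlongrightarrow> 0) (at_right 0)"
    by (rule filterlim_compose) (rule filterlim_inverse_at_top_right)
  then show ?thesis
    by (rule Lim_transform_eventually)
       (auto simp: eventually_at_right_less flat_def inverse_eq_divide
         intro!: eventually_mono[OF eventually_at_right_less])
qed

text \<open>For \<open>x > 0\<close> the product rule gives the factor \<open>1 / x\<^sup>2\<close>
  times \<open>p - p'\<close> at \<open>1 / x\<close>, so the polynomial is multiplied by the square
  of the variable. At \<open>0\<close> the difference quotient from the right is again a
  \<open>flat\<close> function, with one more power of \<open>1 / x\<close>, and tends to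
  \<open>0\<close>.\<close>

lemma flat_has_derivative:
  "(flat p has_real_derivative flat ([:0, 0, 1:] * (p - pderiv p)) x) (at x)"
proof -
  consider "x > 0" | "x < 0" | "x = 0" by linarith
  then show ?thesis
  proof cases
    case 1
    have "((\<lambda>x. poly p (1 / x) * exp (- (1 / x))) has_real_derivative
        flat ([:0, 0, 1:] * (p - pderiv p)) x) (at x)"
      using 1 by (auto intro!: derivative_eq_intros simp: flat_def field_simps power2_eq_square)
    then show ?thesis
      by (rule has_field_derivative_transform_within_open[of _ _ _ "{0<..}"]) (use 1 in \<open>auto
        simp: flat_def\<close>)
  next
    case 2
    have "((\<lambda>x. 0) has_real_derivative flat ([:0, 0, 1:] * (p - pderiv p)) x) (at x)"
      using 2 by (simp add: flat_def)
    then show ?thesis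
      by (rule has_field_derivative_transform_within_open[of _ _ _ "{..<0}"]) (use 2 in \<open>auto
        simp: flat_def\<close>)
  next
    case 3
    have "((\<lambda>h. flat p h / h) \<longlongrightarrow> 0) (at 0)"
    proof (rule filterlim_split_at)
      show "((\<lambda>h. flat p h / h) \<longlongrightarrow> 0) (at_left 0)"
        by (rule tendsto_eventually)
          (auto simp: flat_def eventually_at_left_field intro!: exI[of _ "-1"])
      show "((\<lambda>h. flat p h / h) \<longlongrightarrow> 0) (at_right 0)"
        using flat_tendsto_0[of "[:0, 1:] * p"]
        by (rule Lim_transform_eventually)
          (auto intro!: eventually_mono[OF eventually_at_right_less] simp: flat_def)
    qed
    then show ?thesis using 3 by (simp add: DERIV_def flat_def)
  qed
qed

text \<open>This class is closed under differentiation, so its members have derivatives of all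
  orders and no formula for these is ever required. It is large enough for cut-offs multiplied by
  sines and cosines, from which the concrete test functions are built.\<close>

inductive_set smooth_funs :: "(real \<Rightarrow> real) set" where
  const: "(\<lambda>x. k) \<in> smooth_funs"
| sin: "sin \<in> smooth_funs"
| cos: "cos \<in> smooth_funs"
| flat: "flat p \<in> smooth_funs"
| add: "f \<in> smooth_funs \<Longrightarrow> g \<in> smooth_funs \<Longrightarrow> (\<lambda>x. f x + g x) \<in> smooth_funs"
| mult: "f \<in> smooth_funs \<Longrightarrow> g \<in> smooth_funs \<Longrightarrow> (\<lambda>x. f x * g x) \<in> smooth_funs"
| affine: "f \<in> smooth_funs \<Longrightarrow> (\<lambda>x. f (a * x + b)) \<in> smooth_funs"

lemma smooth_funs_derivative:
  "f \<in> smooth_funs \<Longrightarrow> \<exists>f'\<in>smooth_funs. \<forall>x. (f has_real_derivative f' x) (at x)"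
proof (induction rule: smooth_funs.induct)
  case (const k)
  then show ?case by (intro bexI[of _ "\<lambda>x. 0"]) (auto intro: smooth_funs.intros)
next
  case sin
  then show ?case by (intro bexI[of _ cos]) (auto intro: smooth_funs.intros DERIV_sin)
next
  case cos
  have "(\<lambda>x. (-1) * sin x) \<in> smooth_funs" by (intro smooth_funs.intros)
  then show ?case by (rule bexI[rotated]) (auto intro!: derivative_eq_intros)
next
  case (flat p)
  show ?case using flat_has_derivative smooth_funs.flat by blast
next
  case (add f g)
  then obtain f' g' where "f' \<in> smooth_funs" "g' \<in> smooth_funs"
    "\<And>x. (f has_real_derivative f' x) (at x)" "\<And>x. (g has_real_derivative g' x) (at x)" by blast
  then show ?case
    by (intro bexI[of _ "\<lambda>x. f' x + g' x"]) (auto intro!: DERIV_add smooth_funs.intros)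
next
  case (mult f g)
  then obtain f' g' where "f' \<in> smooth_funs" "g' \<in> smooth_funs"
    "\<And>x. (f has_real_derivative f' x) (at x)" "\<And>x. (g has_real_derivative g' x) (at x)" by blast
  with mult show ?case
    by (intro bexI[of _ "\<lambda>x. f' x * g x + g' x * f x"]) (auto intro!: DERIV_mult smooth_funs.intros)
next
  case (affine f a b)
  then obtain f' where f': "f' \<in> smooth_funs" "\<And>x. (f has_real_derivative f' x) (at x)" by blast
  have "((\<lambda>x. f (a * x + b)) has_real_derivative f' (a * x + b) * a) (at x)" for x
    by (rule DERIV_chain2[OF f'(2)]) (auto intro!: derivative_eq_intros)
  with f' show ?case
    by (intro bexI[of _ "\<lambda>x. f' (a * x + b) * a"]) (auto intro!: smooth_funs.intros)
qed

lemma smooth_funs_deriv: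
  assumes "f \<in> smooth_funs"
  shows "deriv f \<in> smooth_funs" "(f has_real_derivative deriv f x) (at x)"
proof -
  obtain f' where f': "f' \<in> smooth_funs" "\<And>x. (f has_real_derivative f' x) (at x)"
    using smooth_funs_derivative[OF assms] by blast
  then have "deriv f = f'" by (auto intro!: DERIV_imp_deriv)
  with f' show "deriv f \<in> smooth_funs" "(f has_real_derivative deriv f x) (at x)" by auto
qed

lemma smooth_funs_funpow_deriv: "f \<in> smooth_funs \<Longrightarrow> (deriv ^^ n) f \<in> smooth_funs"
  by (induction n) (auto intro: smooth_funs_deriv)

lemma smooth_funs_test_function:
  assumes "f \<in> smooth_funs" "\<And>x. \<bar>x\<bar> > R \<Longrightarrow> f x = 0"
  shows "test_function f"
  unfolding test_function_def
  using assms smooth_funs_deriv(2)[OF smooth_funs_funpow_deriv[OF assms(1)]] real_differentiable_def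
  by blast

section \<open>Test functions and their products with locally integrable functions\<close>

lemma test_function_deriv:
  assumes "test_function \<phi>"
  shows "test_function (deriv \<phi>)" "(\<phi> has_real_derivative deriv \<phi> x) (at x)"
proof -
  have d: "(deriv ^^ n) \<phi> differentiable at x" for n x using assms by (auto simp: test_function_def)
  show D: "(\<phi> has_real_derivative deriv \<phi> x) (at x)" for x
    using d[of 0 x] by (simp add: DERIV_deriv_iff_real_differentiable)
  obtain R where R: "\<And>x. \<bar>x\<bar> > R \<Longrightarrow> \<phi> x = 0" using assms by (auto simp: test_function_def)
  have "deriv \<phi> x = 0" if x: "\<bar>x\<bar> > R" for x
  proof -
    have "((\<lambda>x. 0) has_real_derivative 0) (at x)" by simp
    then have "(\<phi> has_real_derivative 0) (at x)"
      by (rule has_field_derivative_transform_within_open[of _ _ _ "{x. \<bar>x\<bar> > R}"])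
        (use x in \<open>simp_all add: open_Collect_less continuous_on_const continuous_on_rabs R\<close>)
    then show ?thesis by (rule DERIV_imp_deriv)
  qed
  moreover have "(deriv ^^ n) (deriv \<phi>) differentiable at x" for n x
    using d[of "Suc n" x] by (simp add: funpow_swap1 del: funpow.simps add: funpow_Suc_right)
  ultimately show "test_function (deriv \<phi>)" unfolding test_function_def by blast
qed

lemma test_function_funpow_deriv: "test_function \<phi> \<Longrightarrow> test_function ((deriv ^^ n) \<phi>)"
  by (induction n) (auto intro: test_function_deriv)

lemma test_function_bounded_support:
  assumes "test_function \<phi>"
  obtains R M where "R > 0" "M > 0" "\<And>x. \<bar>x\<bar> > R \<Longrightarrow> \<phi> x = 0" "\<And>x. \<bar>\<phi> x\<bar> \<le> M"
proof -
  obtain R where R: "\<And>x. \<bar>x\<bar> > R \<Longrightarrow> \<phi> x = 0" using assms by (auto simp: test_function_def)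
  have "continuous_on {- \<bar>R\<bar> - 1..\<bar>R\<bar> + 1} \<phi>"
    by (rule DERIV_continuous_on[OF DERIV_subset[OF test_function_deriv(2)[OF assms]]]) auto
  then have "bounded (\<phi> ` {- \<bar>R\<bar> - 1..\<bar>R\<bar> + 1})"
    by (intro compact_imp_bounded compact_continuous_image) auto
  then obtain M where "M > 0" "\<forall>y\<in>\<phi> ` {- \<bar>R\<bar> - 1..\<bar>R\<bar> + 1}. norm y \<le> M"
    unfolding bounded_pos by blast
  then have M: "\<And>x. x \<in> {- \<bar>R\<bar> - 1..\<bar>R\<bar> + 1} \<Longrightarrow> \<bar>\<phi> x\<bar> \<le> M" "M > 0"
    by auto
  have "\<bar>\<phi> x\<bar> \<le> M" for x
    using M(1)[of x] M(2) R[of x] by (cases "\<bar>x\<bar> > R") (simp_all, linarith)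
  then show ?thesis using that[of "\<bar>R\<bar> + 1" M] R M by auto
qed

lemma test_function_measurable:
  assumes "test_function \<phi>" shows "\<phi> \<in> borel_measurable borel"
proof (rule borel_measurable_continuous_onI)
  show "continuous_on UNIV \<phi>"
    by (rule DERIV_continuous_on[OF DERIV_subset[OF test_function_deriv(2)[OF assms]]]) auto
qed

lemma integrable_test_function_mult:
  fixes f :: "real \<Rightarrow> 'a::{banach, second_countable_topology}"
  assumes "test_function \<phi>" "\<And>a b. set_integrable lborel {a..b} f"
  shows "integrable lborel (\<lambda>x. \<phi> x *\<^sub>R f x)"
proof -
  obtain R M where R: "\<And>x. \<bar>x\<bar> > R \<Longrightarrow> \<phi> x = 0" "\<And>x. \<bar>\<phi> x\<bar> \<le> M" "M > 0"
    using test_function_bounded_support[OF assms(1)] by metis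
  have i: "integrable lborel (\<lambda>x. indicator {-R..R} x *\<^sub>R f x)"
    using assms(2) by (auto simp: set_integrable_def)
  have "integrable lborel (\<lambda>x. \<phi> x *\<^sub>R (indicator {-R..R} x *\<^sub>R f x))"
  proof (rule Bochner_Integration.integrable_bound)
    show "integrable lborel (\<lambda>x. M * norm (indicator {-R..R} x *\<^sub>R f x))"
      by (intro integrable_mult_right integrable_norm i)
    show "(\<lambda>x. \<phi> x *\<^sub>R (indicator {-R..R} x *\<^sub>R f x)) \<in> borel_measurable lborel"
      by (rule borel_measurable_scaleR[OF _ borel_measurable_integrable[OF i]])
        (simp add: test_function_measurable[OF assms(1)])
    show "AE x in lborel. norm (\<phi> x *\<^sub>R (indicator {-R..R} x *\<^sub>R f x))
        \<le> norm (M * norm (indicator {-R..R} x *\<^sub>R f x))"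
    proof (intro AE_I2)
      fix x
      have "\<bar>\<phi> x\<bar> * norm (indicat_real {-R..R} x *\<^sub>R f x)
        \<le> M * norm (indicat_real {-R..R} x *\<^sub>R f x)"
        by (intro mult_right_mono R norm_ge_zero)
      then show "norm (\<phi> x *\<^sub>R (indicat_real {-R..R} x *\<^sub>R f x))
        \<le> norm (M * norm (indicat_real {-R..R} x *\<^sub>R f x))"
        using R(3) by (simp add: abs_mult)
    qed
  qed
  also have "(\<lambda>x. \<phi> x *\<^sub>R (indicator {-R..R} x *\<^sub>R f x)) = (\<lambda>x. \<phi> x *\<^sub>R f x)"
  proof
    show "\<phi> x *\<^sub>R (indicator {-R..R} x *\<^sub>R f x) = \<phi> x *\<^sub>R f x" for x
      using R(1)[of x] by (cases "\<bar>x\<bar> > R") (auto simp: indicator_def abs_le_iff)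
  qed
  finally show ?thesis .
qed

section \<open>The fundamental lemma of the calculus of variations\<close>

lemma locally_integrable_measurable:
  assumes "locally_integrable f" shows "f \<in> borel_measurable borel"
proof (rule borel_measurable_LIMSEQ_metric)
  show "(\<lambda>x. indicat_real {- real n..real n} x *\<^sub>R f x) \<in> borel_measurable borel" for n
    using borel_measurable_integrable[of lborel "\<lambda>x. indicat_real {- real n..real n} x *\<^sub>R f x"]
      assms
    unfolding locally_integrable_def set_integrable_def by simp
  show "(\<lambda>n. indicat_real {- real n..real n} x *\<^sub>R f x) \<longlonglongrightarrow> f x" for x
  proof (rule tendsto_eventually)
    obtain N where "\<bar>x\<bar> \<le> real N" using real_arch_simple by blast
    then show "\<forall>\<^sub>F n in sequentially. indicat_real {- real n..real n} x *\<^sub>R f x = f x"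
      by (intro eventually_sequentiallyI[of N]) (auto simp: indicator_def abs_le_iff)
  qed
qed

text \<open>Induction over the Borel sets extends the hypothesis from intervals to all of them, and
  a function whose integrals over all measurable sets vanish is zero almost everywhere. The
  truncation to \<open>[- n, n]\<close> supplies the integrability on the whole line that
  complements and countable unions require.\<close>

lemma AE_zero_of_interval_integrals:
  assumes f: "locally_integrable f"
    and z: "\<And>a b. a \<le> b \<Longrightarrow> (LINT x:{a..b}|lborel. f x) = 0"
  shows "AE x in lborel. f x = 0"
proof -
  have "AE x in lborel. indicat_real {- real n..real n} x *\<^sub>R f x = 0" for n
  proof (rule sigma_finite_measure.density_zero[OF sigma_finite_lborel])
    let ?g = "\<lambda>x. indicat_real {- real n..real n} x *\<^sub>R f x"
    show i: "integrable lborel ?g"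
      by (rule f[unfolded locally_integrable_def set_integrable_def, rule_format])
    have si: "set_integrable lborel A ?g" if "A \<in> sets borel" for A
      unfolding set_integrable_def by (rule integrable_mult_indicator[OF _ i]) (simp add: that)
    have eq: "(LINT x:{a..b}|lborel. ?g x) = (LINT x:{max a (- real n)..min b (real n)}|lborel.
      f x)" for a b
      unfolding set_lebesgue_integral_def scaleR_scaleR indicator_inter_arith[symmetric]
        Int_atLeastAtMost ..
    have int: "(LINT x:{a..b}|lborel. ?g x) = 0" for a b
      unfolding eq using z[of "max a (- real n)" "min b (real n)"]
      by (cases "max a (- real n) \<le> min b (real n)") (auto simp: set_lebesgue_integral_def)
    fix A :: "real set" assume "A \<in> sets lborel"
    then have "A \<in> sets borel" by simp
    then show "(LINT x:A|lborel. ?g x) = 0"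
    proof (induction A rule: borel_set_induct)
      case empty
      then show ?case by (simp add: set_lebesgue_integral_def)
    next
      case (interval a b)
      then show ?case using int by simp
    next
      case (compl A)
      have "(LINT x:A \<union> - A|lborel. ?g x) = (LINT x:A|lborel. ?g x) + (LINT x:- A|lborel. ?g x)"
        using compl by (intro set_integral_Un si) auto
      moreover have "(LINT x:A \<union> - A|lborel. ?g x) = (LINT x:{- real n..real n}|lborel. ?g x)"
        unfolding set_lebesgue_integral_def scaleR_scaleR indicator_inter_arith[symmetric] by simp
      ultimately show ?case using compl int by simp
    next
      case (union F)
      have "(LINT x:(\<Union>i. F i)|lborel. ?g x) = (\<Sum>i. LINT x:F i|lborel. ?g x)"
      proof (rule lebesgue_integral_countable_add)
        show "F i \<in> sets lborel" for i using union(2) by simp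
        show "i \<noteq> j \<Longrightarrow> F i \<inter> F j = {}" for i j
          using union(1) by (simp add: disjoint_family_on_def)
        show "set_integrable lborel (\<Union>i. F i) ?g"
          by (rule si) (use union(2) in blast)
      qed
      also have "\<dots> = 0" by (simp only: union(3) suminf_zero)
      finally show ?case .
    qed
  qed
  then have "AE x in lborel. \<forall>n. indicat_real {- real n..real n} x *\<^sub>R f x = 0"
    unfolding AE_all_countable by blast
  then show ?thesis
  proof (rule AE_mp, intro AE_I2 impI)
    fix x assume *: "\<forall>n. indicat_real {- real n..real n} x *\<^sub>R f x = 0"
    obtain N where "\<bar>x\<bar> \<le> real N" using real_arch_simple by blast
    with *[rule_format, of N] show "f x = 0" by (auto simp: indicator_def abs_le_iff)
  qed
qed

text \<open>With \<open>k = Suc n\<close>, the test function \<open>\<phi> n\<close> is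
  \<open>exp (- 1 / (k * (x - a)) - 1 / (k * (b - x)))\<close> on the open interval and
  \<open>0\<close> elsewhere. These functions are bounded by \<open>1\<close> and converge to the
  indicator, so dominated convergence leads back to integrals over intervals.\<close>

lemma AE_zero_of_test_functions:
  assumes f: "locally_integrable f"
    and z: "\<And>\<phi>. test_function \<phi> \<Longrightarrow> (\<integral>x. \<phi> x *\<^sub>R f x \<partial>lborel) = 0"
  shows "AE x in lborel. f x = 0"
proof (rule AE_zero_of_interval_integrals[OF f])
  fix a b :: real assume "a \<le> b"
  define \<phi> where "\<phi> = (\<lambda>n x. flat 1 (real (Suc n) * x
    + (- real (Suc n) * a)) * flat 1 (- real (Suc n) * x + real (Suc n) * b))"
  have out: "\<phi> n x = 0" if "x \<notin> {a<..<b}" for n x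
  proof -
    have "real (Suc n) * x + (- real (Suc n) * a) = real (Suc n) * (x - a)"
      "- real (Suc n) * x + real (Suc n) * b = real (Suc n) * (b - x)"
        by (simp_all only: algebra_simps)
    moreover have "x - a \<le> 0 \<or> b - x \<le> 0" using that by auto
    ultimately show ?thesis
      unfolding \<phi>_def flat_def by (auto simp: mult_le_0_iff not_less zero_less_mult_iff simp
        del: of_nat_Suc)
  qed
  have "\<phi> n \<in> smooth_funs" for n
    unfolding \<phi>_def by (intro smooth_funs.mult smooth_funs.affine smooth_funs.flat)
  then have test: "test_function (\<phi> n)" for n
    by (rule smooth_funs_test_function[of _ "\<bar>a\<bar> + \<bar>b\<bar>"]) (auto intro!: out)
  have flat1: "0 \<le> flat 1 y \<and> flat 1 y \<le> 1" for y by (auto simp: flat_def)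
  have lim: "(\<lambda>n. \<phi> n x) \<longlonglongrightarrow> indicator {a<..<b} x" for x
  proof (cases "x \<in> {a<..<b}")
    case False
    then show ?thesis by (simp add: out)
  next
    case True
    have l: "(\<lambda>n. exp (- (1 / (real (Suc n) * y)))) \<longlonglongrightarrow> 1" if "y > 0" for y
    proof -
      have "(\<lambda>n. exp (- (1 / y * (1 / real (Suc n))))) \<longlonglongrightarrow> exp (- (1 / y * 0))"
        by (intro tendsto_intros LIMSEQ_Suc[OF lim_1_over_n])
      then show ?thesis by (simp add: field_simps del: of_nat_Suc)
    qed
    have "\<phi> n x = exp (- (1 / (real (Suc n) * (x - a)))) * exp (- (1 / (real (Suc n)
      * (b - x))))" for n
    proof -
      have "real (Suc n) * x + (- real (Suc n) * a) = real (Suc n) * (x - a)"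
        "- real (Suc n) * x + real (Suc n) * b = real (Suc n) * (b - x)"
          by (simp_all only: algebra_simps)
      moreover have "real (Suc n) * (x - a) > 0" "real (Suc n) * (b - x) > 0" using True by auto
      ultimately show ?thesis unfolding \<phi>_def flat_def by (simp del: of_nat_Suc)
    qed
    then have "(\<lambda>n. \<phi> n x) \<longlonglongrightarrow> 1 * 1"
      using True by (simp only:) (intro tendsto_mult l, auto)
    then show ?thesis using True by simp
  qed
  have i: "integrable lborel (\<lambda>x. indicator {a..b} x *\<^sub>R f x)"
    using f by (auto simp: locally_integrable_def set_integrable_def)
  have fm [measurable]: "f \<in> borel_measurable borel" by (rule locally_integrable_measurable[OF f])
  have [measurable]: "\<phi> n \<in> borel_measurable borel" for n
    by (rule test_function_measurable[OF test])
  have "(\<lambda>n. \<integral>x. \<phi> n x *\<^sub>R f x \<partial>lborel) \<longlonglongrightarrow> (\<integral>x. indicat_real {a<..<b} x *\<^sub>R f x \<partial>lborel)"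
  proof (rule integral_dominated_convergence)
    show "integrable lborel (\<lambda>x. norm (indicator {a..b} x *\<^sub>R f x))" using i
      by (rule integrable_norm)
    show "AE x in lborel. (\<lambda>n. \<phi> n x *\<^sub>R f x) \<longlonglongrightarrow> indicat_real {a<..<b} x *\<^sub>R f x"
      by (intro AE_I2 tendsto_intros lim)
    show "AE x in lborel. norm (\<phi> n x *\<^sub>R f x) \<le> norm (indicat_real {a..b} x *\<^sub>R f x)" for n
    proof (rule AE_I2)
      fix x
      have "\<bar>\<phi> n x\<bar> \<le> 1" unfolding \<phi>_def abs_mult using flat1
        by (intro mult_le_one) (auto simp: abs_of_nonneg)
      then show "norm (\<phi> n x *\<^sub>R f x) \<le> norm (indicat_real {a..b} x *\<^sub>R f x)"
        using out[of x n] by (auto simp: indicator_def intro!: mult_left_le_one_le)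
    qed
  qed measurable
  then have "(\<integral>x. indicat_real {a<..<b} x *\<^sub>R f x \<partial>lborel) = 0"
    by (simp add: z[OF test] LIMSEQ_const_iff)
  also have "(\<integral>x. indicat_real {a<..<b} x *\<^sub>R f x \<partial>lborel) = (LINT x:{a..b}|lborel. f x)"
    unfolding set_lebesgue_integral_def
  proof (rule integral_cong_AE)
    show "AE x in lborel. indicat_real {a<..<b} x *\<^sub>R f x = indicat_real {a..b} x *\<^sub>R f x"
      using AE_lborel_singleton[of a] AE_lborel_singleton[of b]
      by eventually_elim (auto simp: indicator_def)
  qed measurable
  finally show "(LINT x:{a..b}|lborel. f x) = 0" .
qed

lemma has_weak_deriv_unique:
  assumes "has_weak_deriv n f g" "has_weak_deriv n f h"
  shows "AE x in lborel. g x = h x"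
proof -
  have l: "locally_integrable g" "locally_integrable h" using assms
    by (auto simp: has_weak_deriv_def)
  have "AE x in lborel. g x - h x = 0"
  proof (rule AE_zero_of_test_functions)
    show "locally_integrable (\<lambda>x. g x - h x)"
      using l by (auto simp: locally_integrable_def)
    fix \<phi> :: "real \<Rightarrow> real" assume t: "test_function \<phi>"
    have "(- 1) ^ n *\<^sub>R (\<integral>x. \<phi> x *\<^sub>R g x \<partial>lborel) = (- 1) ^ n *\<^sub>R (\<integral>x. \<phi> x *\<^sub>R h x \<partial>lborel)"
      using assms t by (simp add: has_weak_deriv_def)
    then show "(\<integral>x. \<phi> x *\<^sub>R (g x - h x) \<partial>lborel) = 0"
      using integrable_test_function_mult[OF t, of g] integrable_test_function_mult[OF t, of h] l
      unfolding locally_integrable_def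
      by (simp add: scaleR_diff_right)
  qed
  then show ?thesis by simp
qed

text \<open>All representatives agree almost everywhere, so the norm of the arbitrarily chosen one
  can be computed from any weak derivative at hand.\<close>

lemma L2_norm_weak_deriv:
  assumes "has_weak_deriv n f g"
  shows "L2_norm (weak_deriv n f) = L2_norm g"
proof -
  have w: "has_weak_deriv n f (weak_deriv n f)"
    unfolding weak_deriv_def using assms by (rule someI[where P = "has_weak_deriv n f"])
  note [measurable] = locally_integrable_measurable
  have [measurable]: "g \<in> borel_measurable borel" "weak_deriv n f \<in> borel_measurable borel"
    using assms w by (auto intro!: locally_integrable_measurable simp: has_weak_deriv_def)
  have "(\<integral>x. (norm (weak_deriv n f x))\<^sup>2 \<partial>lborel) = (\<integral>x. (norm (g x))\<^sup>2 \<partial>lborel)"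
    by (rule integral_cong_AE) (use has_weak_deriv_unique[OF w assms] in auto)
  then show ?thesis by (simp add: L2_norm_def)
qed

section \<open>The Fourier transform of scalar functions\<close>

abbreviation phase :: "real \<Rightarrow> real \<Rightarrow> complex" where
  "phase \<xi> x \<equiv> exp (- (\<i> * of_real (\<xi> * x)))"

abbreviation l2_sq :: "(real \<Rightarrow> 'a::real_normed_vector) \<Rightarrow> ennreal" where
  "l2_sq f \<equiv> \<integral>\<^sup>+x. ennreal ((norm (f x))\<^sup>2) \<partial>lborel"

definition ft :: "(real \<Rightarrow> complex) \<Rightarrow> real \<Rightarrow> complex" where
  "ft f \<xi> = (\<integral>x. phase \<xi> x * f x \<partial>lborel)"

lemma norm_cis_exp [simp]: "norm (exp (- (\<i> * complex_of_real r)))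
  = 1" "norm (exp (\<i> * complex_of_real r)) = 1"
  using norm_exp_i_times[of "- r"] norm_exp_i_times[of r] by simp_all

lemma integrable_phase:
  assumes "integrable lborel f"
  shows "integrable lborel (\<lambda>x. phase \<xi> x * f x)"
  by (rule Bochner_Integration.integrable_bound[OF assms]) (use assms in \<open>auto simp: norm_mult\<close>)

lemma ft_measurable [measurable]:
  assumes [measurable]: "f \<in> borel_measurable borel" shows "ft f \<in> borel_measurable borel"
  unfolding ft_def by measurable

lemma norm_ft_le: "norm (ft f \<xi>) \<le> (\<integral>x. norm (f x) \<partial>lborel)"
  unfolding ft_def
  by (rule order_trans[OF integral_norm_bound]) (simp add: norm_mult)

lemma integrable_prod_phase:
  assumes f: "integrable lborel f" and g: "integrable lborel (g :: real \<Rightarrow> complex)"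
  shows "integrable (lborel \<Otimes>\<^sub>M lborel) (\<lambda>(x, \<xi>). phase \<xi> x * f x * g \<xi>)"
proof (rule lborel_pair.Fubini_integrable)
  note [measurable] = borel_measurable_integrable[OF f] borel_measurable_integrable[OF g]
  show "(\<lambda>(x, \<xi>). phase \<xi> x * f x * g \<xi>) \<in> borel_measurable (lborel \<Otimes>\<^sub>M lborel)"
    by measurable
  show "integrable lborel (\<lambda>x. \<integral>y. norm (case (x, y) of (x, \<xi>) \<Rightarrow> phase \<xi> x * f x * g \<xi>) \<partial>lborel)"
    using integrable_norm[OF f] by (simp add: norm_mult)
  show "AE x in lborel. integrable lborel (\<lambda>y. case (x, y) of (x, \<xi>) \<Rightarrow> phase \<xi> x * f x * g \<xi>)"
  proof (rule AE_I2)
    fix x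
    have "integrable lborel (\<lambda>y. f x * (phase x y * g y))"
      by (intro integrable_mult_right integrable_phase g)
    then show "integrable lborel (\<lambda>y. case (x, y) of (x, \<xi>) \<Rightarrow> phase \<xi> x * f x * g \<xi>)"
      by (simp add: mult_ac)
  qed
qed

text \<open>The phase is symmetric in \<open>x\<close> and \<open>\<xi>\<close>, so Fubini's theorem
  moves the transform from one factor to the other. A Gaussian in the place of \<open>g\<close>
  makes this a regularised inversion formula.\<close>

lemma ft_mult:
  assumes f: "integrable lborel f" and g: "integrable lborel g"
  shows "(\<integral>\<xi>. ft f \<xi> * g \<xi> \<partial>lborel) = (\<integral>x. f x * ft g x \<partial>lborel)"
proof -
  have "(\<integral>\<xi>. ft f \<xi> * g \<xi> \<partial>lborel)
      = (\<integral>\<xi>. (\<integral>x. phase \<xi> x * f x * g \<xi> \<partial>lborel) \<partial>lborel)"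
    unfolding ft_def by simp
  also have "\<dots> = (\<integral>x. (\<integral>\<xi>. phase \<xi> x * f x * g \<xi> \<partial>lborel) \<partial>lborel)"
    by (rule lborel_pair.Fubini_integral[OF integrable_prod_phase[OF f g]])
  also have "\<dots> = (\<integral>x. (\<integral>\<xi>. f x * (phase x \<xi> * g \<xi>) \<partial>lborel) \<partial>lborel)"
    by (simp add: mult_ac)
  also have "\<dots> = (\<integral>x. f x * ft g x \<partial>lborel)"
    unfolding ft_def by simp
  finally show ?thesis .
qed

section \<open>Gaussian regularisation and Bessel's inequality\<close>

definition gauss :: "real \<Rightarrow> real \<Rightarrow> real" where "gauss s \<xi> = exp (- (s * \<xi>)\<^sup>2 / 2)"

lemma gauss_eq: "gauss s \<xi> = sqrt (2 * pi) * std_normal_density (s * \<xi>)"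
  by (simp add: gauss_def std_normal_density_def)

lemma std_normal_integral: "has_bochner_integral lborel std_normal_density 1"
  using std_normal_moment_even[of 0] by simp

lemma gauss_integrable: "s > 0 \<Longrightarrow> integrable lborel (gauss s)"
  using lborel_integrable_real_affine[of std_normal_density s 0]
    integrable.intros[OF std_normal_integral]
  by (simp add: gauss_eq[abs_def])

lemma gauss_bounds: "0 < gauss s \<xi>" "gauss s \<xi> \<le> 1"
  by (auto simp: gauss_def)

lemma gauss_measurable [measurable]: "gauss s \<in> borel_measurable borel"
  unfolding gauss_def[abs_def] by measurable

lemma modulated_gauss_integrable:
  assumes "s > 0" shows "integrable lborel (\<lambda>\<xi>. exp (\<i> * of_real (\<xi> * a))
    * complex_of_real (gauss s \<xi>))"
proof (rule Bochner_Integration.integrable_bound[OF gauss_integrable[OF assms]])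
  show "AE x in lborel. norm (exp (\<i> * complex_of_real (x * a)) * complex_of_real (gauss s x))
    \<le> norm (gauss s x)"
    by (simp add: norm_mult)
qed measurable

text \<open>The characteristic function of the normal distribution is again a multiple of its
  density. One factor \<open>sqrt (2 * pi)\<close> comes from the normalisation of
  \<open>gauss\<close>, the other from that of the result.\<close>

lemma ft_gauss:
  assumes s: "s > 0"
  shows "ft (\<lambda>\<xi>. exp (\<i> * of_real (\<xi> * a)) * of_real (gauss s \<xi>)) x
    = of_real (2 * pi / s * std_normal_density ((x - a) / s))"
proof -
  define t where "t = - (x - a) / s"
  have "ft (\<lambda>\<xi>. exp (\<i> * of_real (\<xi> * a)) * of_real (gauss s \<xi>)) x
      = (\<integral>\<xi>. exp (\<i> * of_real (- (x - a) * \<xi>)) * of_real (gauss s \<xi>) \<partial>lborel)"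
    unfolding ft_def mult.assoc[symmetric] exp_add[symmetric]
    by (simp add: algebra_simps)
  also have "\<dots> = \<bar>1 / s\<bar> *\<^sub>R (\<integral>w. exp (\<i> * of_real (- (x - a) * (0
    + 1 / s * w))) * of_real (gauss s (0 + 1 / s * w)) \<partial>lborel)"
    using s by (subst lborel_integral_real_affine[where c = "1 / s" and t = 0]) auto
  also have "\<dots> = (1 / s) *\<^sub>R (\<integral>w. sqrt (2 * pi) *\<^sub>R (std_normal_density w *\<^sub>R iexp (t
    * w)) \<partial>lborel)"
    using s by (simp add: gauss_eq t_def scaleR_conv_of_real mult_ac)
  also have "(\<integral>w. sqrt (2 * pi) *\<^sub>R (std_normal_density w *\<^sub>R iexp (t * w)) \<partial>lborel)
      = sqrt (2 * pi) *\<^sub>R char std_normal_distribution t"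
    unfolding char_def by (subst integral_density) (simp_all add: normal_density_nonneg del:
      scaleR_scaleR)
  also have "\<dots> = of_real (2 * pi * std_normal_density t)"
  proof -
    have "sqrt (2 * pi) * exp (- t\<^sup>2 / 2) = 2 * pi * std_normal_density t"
      by (simp add: std_normal_density_def field_simps)
    then show ?thesis
      by (simp only: char_std_normal_distribution scaleR_conv_of_real of_real_mult[symmetric])
  qed
  also have "std_normal_density t = std_normal_density ((x - a) / s)"
    by (simp add: t_def std_normal_density_def power_divide power2_commute)
  finally show ?thesis by (simp add: scaleR_conv_of_real)
qed

text \<open>The right side is \<open>2 * pi\<close> times the average of \<open>f\<close> under a
  normal distribution with mean \<open>a\<close> and standard deviation \<open>s\<close>.\<close>

lemma gauss_pairing:
  assumes f: "integrable lborel f" and s: "s > 0"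
  shows "(\<integral>\<xi>. ft f \<xi> * (exp (\<i> * of_real (\<xi> * a)) * of_real (gauss s \<xi>)) \<partial>lborel)
    = (\<integral>x. f x * of_real (2 * pi / s * std_normal_density ((x - a) / s)) \<partial>lborel)"
  using ft_mult[OF f modulated_gauss_integrable[OF s, of a]] unfolding ft_gauss[OF s] .

lemma nn_integral_le_of_tendsto:
  fixes u :: "nat \<Rightarrow> 'a \<Rightarrow> ennreal"
  assumes [measurable]: "\<And>n. u n \<in> borel_measurable M"
    and lim: "\<And>x. (\<lambda>n. u n x) \<longlonglongrightarrow> v x" and le: "\<And>n. (\<integral>\<^sup>+x. u n x \<partial>M) \<le> C"
  shows "(\<integral>\<^sup>+x. v x \<partial>M) \<le> C"
proof -
  have "(\<integral>\<^sup>+x. v x \<partial>M) = (\<integral>\<^sup>+x. liminf (\<lambda>n. u n x) \<partial>M)"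
    by (intro nn_integral_cong lim_imp_Liminf[symmetric] lim) simp
  also have "\<dots> \<le> liminf (\<lambda>n. \<integral>\<^sup>+x. u n x \<partial>M)" by (rule nn_integral_liminf) measurable
  also have "\<dots> \<le> liminf (\<lambda>n. C)" by (rule Liminf_mono) (simp add: le)
  finally show ?thesis by (simp add: Liminf_const)
qed

lemma nn_integral_scaled_normal:
  assumes "s > 0"
  shows "(\<integral>\<^sup>+x. ennreal (2 * pi / s * std_normal_density ((x - a) / s)) \<partial>lborel) = ennreal (2 * pi)"
    and "(\<integral>\<^sup>+a. ennreal (2 * pi / s * std_normal_density ((x - a) / s)) \<partial>lborel) = ennreal (2 * pi)"
proof -
  have n: "(\<integral>\<^sup>+x. ennreal (std_normal_density x) \<partial>lborel) = 1"
    using std_normal_integral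
    by (subst nn_integral_eq_integral) (auto simp: has_bochner_integral_iff)
  have g: "(\<integral>\<^sup>+y. ennreal (2 * pi / s * std_normal_density (t + c * y)) \<partial>lborel) = ennreal (2 * pi)"
    if c: "\<bar>c\<bar> = 1 / s" for c t
  proof -
    have "c \<noteq> 0" using that assms by auto
    then have "1 = ennreal \<bar>c\<bar> * (\<integral>\<^sup>+y. ennreal (std_normal_density (t + c * y)) \<partial>lborel)"
      using nn_integral_real_affine[of "\<lambda>x. ennreal (std_normal_density x)" c t] n by simp
    then have "ennreal (2 * pi) * 1 = ennreal (2 * pi) * (ennreal (1 / s)
      * (\<integral>\<^sup>+y. ennreal (std_normal_density (t + c * y)) \<partial>lborel))"
      using c by simp
    also have "\<dots> = (\<integral>\<^sup>+y. ennreal (2 * pi) * (ennreal (1 / s) * ennreal (std_normal_density (t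
      + c * y))) \<partial>lborel)"
      by (simp add: nn_integral_cmult)
    also have "\<dots> = (\<integral>\<^sup>+y. ennreal (2 * pi / s * std_normal_density (t + c * y)) \<partial>lborel)"
      using assms by (intro nn_integral_cong) (simp add: ennreal_mult[symmetric]
        normal_density_nonneg)
    finally show ?thesis by simp
  qed
  show "(\<integral>\<^sup>+x. ennreal (2 * pi / s * std_normal_density ((x - a) / s)) \<partial>lborel) = ennreal (2 * pi)"
    using g[of "1 / s" "- a / s"] assms by (simp add: diff_divide_distrib)
  show "(\<integral>\<^sup>+a. ennreal (2 * pi / s * std_normal_density ((x - a) / s)) \<partial>lborel) = ennreal (2 * pi)"
    using g[of "- 1 / s" "x / s"] assms by (simp add: diff_divide_distrib)
qed

lemma ft_cnj: "ft (\<lambda>x. cnj (f x)) (- \<xi>) = cnj (ft f \<xi>)"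
  unfolding ft_def by (subst Bochner_Integration.integral_cnj[symmetric]) (simp add: exp_cnj)

lemma norm_integral_le_nn_integral:
  fixes f :: "'a \<Rightarrow> 'b::{banach, second_countable_topology}"
  shows "ennreal (norm (\<integral>x. f x \<partial>M)) \<le> (\<integral>\<^sup>+x. ennreal (norm (f x)) \<partial>M)"
  by (cases "integrable M f") (simp_all add: integral_norm_bound_ennreal not_integrable_integral_eq)

text \<open>With a Gaussian weight the left side becomes a double integral of
  \<open>cnj (f y) * f x\<close> against a nonnegative kernel of mass \<open>2 * pi\<close> in
  either variable. Bounding the product by half the sum of the squares, as in Schur's test, gives
  the estimate uniformly in \<open>s\<close>, and Fatou's lemma removes the weight. The right side
  may be infinite.\<close>

lemma ft_bessel:
  assumes f: "integrable lborel f"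
  shows "l2_sq (ft f) \<le> ennreal (2 * pi) * l2_sq f"
    (is "_ \<le> ?C")
proof -
  have fm [measurable]: "f \<in> borel_measurable borel" using borel_measurable_integrable[OF f] by simp
  have main: "(\<integral>\<^sup>+\<xi>. ennreal ((norm (ft f \<xi>))\<^sup>2 * gauss s \<xi>) \<partial>lborel) \<le> ?C" if s: "s > 0" for s
  proof -
    define k where "k = (\<lambda>x y. 2 * pi / s * std_normal_density ((x - y) / s))"
    have k0: "k x y \<ge> 0" for x y using s by (simp add: k_def normal_density_nonneg)
    have km [measurable]: "case_prod k \<in> borel_measurable (borel \<Otimes>\<^sub>M borel)" unfolding k_def
      by measurable
    \<comment> \<open>The reflection is chosen so that the transform of \<open>g\<close> is the
      Gaussian average of \<open>f\<close> itself, while its product with the reflected transform of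
      \<open>cnj f\<close> is the weighted square.\<close>
    define g where "g = (\<lambda>\<xi>. ft f (- \<xi>) * complex_of_real (gauss s \<xi>))"
    have gi: "integrable lborel g"
    proof (rule Bochner_Integration.integrable_bound)
      show "integrable lborel (\<lambda>\<xi>. (\<integral>x. norm (f x) \<partial>lborel) * gauss s \<xi>)"
        using gauss_integrable[OF s] by simp
      show "g \<in> borel_measurable lborel" unfolding g_def by measurable
      show "AE \<xi> in lborel. norm (g \<xi>) \<le> norm ((\<integral>x. norm (f x) \<partial>lborel) * gauss s \<xi>)"
        using gauss_bounds norm_ft_le[of f]
        by (auto simp: g_def norm_mult abs_mult intro!: mult_mono)
    qed
    have ftg: "ft g y = (\<integral>x. f x * of_real (k x y) \<partial>lborel)" for y
    proof -
      have "ft g y = (\<integral>\<xi>. phase y (0 + (-1) * \<xi>) * g (0 + (-1) * \<xi>) \<partial>lborel)"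
        unfolding ft_def by (subst lborel_integral_real_affine[where c = "-1" and t = 0]) auto
      also have "\<dots> = (\<integral>\<xi>. ft f \<xi> * (exp (\<i> * of_real (\<xi> * y)) * of_real (gauss s \<xi>)) \<partial>lborel)"
        by (simp add: g_def gauss_def mult_ac)
      finally show ?thesis unfolding gauss_pairing[OF f s] k_def .
    qed
    have "integrable lborel (\<lambda>x. cnj (f x))" using f by simp
    note * = ft_mult[OF this gi, unfolded ftg]
    have "(\<integral>\<xi>. ft (\<lambda>x. cnj (f x)) \<xi> * g \<xi> \<partial>lborel)
      = (\<integral>\<xi>. of_real ((norm (ft f \<xi>))\<^sup>2 * gauss s \<xi>) \<partial>lborel)"
    proof -
      have "(\<integral>\<xi>. ft (\<lambda>x. cnj (f x)) \<xi> * g \<xi> \<partial>lborel)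
        = (\<integral>\<xi>. ft (\<lambda>x. cnj (f x)) (0 + (-1) * \<xi>) * g (0 + (-1) * \<xi>) \<partial>lborel)"
        by (subst lborel_integral_real_affine[where c = "-1" and t = 0]) auto
      also have "\<dots> = (\<integral>\<xi>. of_real ((norm (ft f \<xi>))\<^sup>2 * gauss s \<xi>) \<partial>lborel)"
      proof (rule Bochner_Integration.integral_cong)
        have c: "cnj z * (z * of_real G) = of_real ((norm z)\<^sup>2 * G)" for z G
          by (simp add: complex_norm_square[of z] mult_ac del: of_real_power)
        show "ft (\<lambda>x. cnj (f x)) (0 + (-1) * \<xi>) * g (0 + (-1) * \<xi>)
            = of_real ((norm (ft f \<xi>))\<^sup>2 * gauss s \<xi>)" for \<xi>
          unfolding c[symmetric] by (simp add: ft_cnj g_def gauss_def)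
      qed simp
      finally show ?thesis .
    qed
    also have "\<dots> = complex_of_real (\<integral>\<xi>. (norm (ft f \<xi>))\<^sup>2 * gauss s \<xi> \<partial>lborel)"
      by (rule integral_complex_of_real)
    finally have e: "complex_of_real (\<integral>\<xi>. (norm (ft f \<xi>))\<^sup>2 * gauss s \<xi> \<partial>lborel)
        = (\<integral>y. cnj (f y) * (\<integral>x. f x * of_real (k x y) \<partial>lborel) \<partial>lborel)" using * by simp
    have i: "integrable lborel (\<lambda>\<xi>. (norm (ft f \<xi>))\<^sup>2 * gauss s \<xi>)"
    proof (rule Bochner_Integration.integrable_bound)
      show "integrable lborel (\<lambda>\<xi>. (\<integral>x. norm (f x) \<partial>lborel)\<^sup>2 * gauss s \<xi>)"
        using gauss_integrable[OF s] by simp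
      show "AE \<xi> in lborel. norm ((norm (ft f \<xi>))\<^sup>2 * gauss s \<xi>)
        \<le> norm ((\<integral>x. norm (f x) \<partial>lborel)\<^sup>2 * gauss s \<xi>)"
        using gauss_bounds norm_ft_le[of f]
        by (auto simp: abs_mult intro!: mult_mono power_mono)
    qed measurable
    have "(\<integral>\<^sup>+\<xi>. ennreal ((norm (ft f \<xi>))\<^sup>2 * gauss s \<xi>) \<partial>lborel)
        = ennreal (\<integral>\<xi>. (norm (ft f \<xi>))\<^sup>2 * gauss s \<xi> \<partial>lborel)"
      by (rule nn_integral_eq_integral[OF i]) (simp add: gauss_bounds(1) less_imp_le)
    also have "\<dots> \<le> ennreal (norm (complex_of_real (\<integral>\<xi>. (norm (ft f \<xi>))\<^sup>2 * gauss s \<xi> \<partial>lborel)))"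
      unfolding norm_of_real by (intro ennreal_leI abs_ge_self)
    also have "\<dots> = ennreal (norm (\<integral>y. cnj (f y) * (\<integral>x. f x * of_real (k x y) \<partial>lborel) \<partial>lborel))"
      unfolding e ..
    also have "\<dots> \<le> (\<integral>\<^sup>+y. ennreal (norm (cnj (f y) * (\<integral>x. f x * of_real (k x y) \<partial>lborel))) \<partial>lborel)"
      by (rule norm_integral_le_nn_integral) 
    also have "\<dots> \<le> (\<integral>\<^sup>+y. (\<integral>\<^sup>+x. ennreal (norm (f y)) * ennreal (norm (f x)
      * k x y) \<partial>lborel) \<partial>lborel)"
    proof (rule nn_integral_mono)
      fix y
      have "ennreal (norm (\<integral>x. f x * of_real (k x y) \<partial>lborel))
        \<le> (\<integral>\<^sup>+x. ennreal (norm (f x) * k x y) \<partial>lborel)"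
        using norm_integral_le_nn_integral[where f = "\<lambda>x. f x * of_real (k x y)" and M = lborel] k0
        by (simp add: norm_mult)
      then have "ennreal (norm (f y)) * ennreal (norm (\<integral>x. f x * of_real (k x y) \<partial>lborel))
          \<le> ennreal (norm (f y)) * (\<integral>\<^sup>+x. ennreal (norm (f x) * k x y) \<partial>lborel)"
        by (rule mult_left_mono) simp
      then show "ennreal (norm (cnj (f y) * (\<integral>x. f x * of_real (k x y) \<partial>lborel)))
          \<le> (\<integral>\<^sup>+x. ennreal (norm (f y)) * ennreal (norm (f x) * k x y) \<partial>lborel)"
        by (simp add: norm_mult ennreal_mult nn_integral_cmult)
    qed
    also have "\<dots> \<le> (\<integral>\<^sup>+y. (\<integral>\<^sup>+x. ennreal ((norm (f y))\<^sup>2 / 2) * ennreal (k x y)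
        + ennreal ((norm (f x))\<^sup>2 / 2) * ennreal (k x y) \<partial>lborel) \<partial>lborel)"
    proof (intro nn_integral_mono)
      fix x y
      have "norm (f y) * norm (f x) \<le> (norm (f y))\<^sup>2 / 2 + (norm (f x))\<^sup>2 / 2"
        using sum_squares_bound[of "norm (f y)" "norm (f x)"] by simp
      then have "norm (f y) * (norm (f x) * k x y)
        \<le> ((norm (f y))\<^sup>2 / 2 + (norm (f x))\<^sup>2 / 2) * k x y"
        using k0[of x y] by (simp add: mult.assoc[symmetric] mult_right_mono)
      then show "ennreal (norm (f y)) * ennreal (norm (f x) * k x y)
         \<le> ennreal ((norm (f y))\<^sup>2 / 2) * ennreal (k x y)
           + ennreal ((norm (f x))\<^sup>2 / 2) * ennreal (k x y)"
        using k0[of x y]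
        by (simp add: ennreal_mult[symmetric] ennreal_plus[symmetric] distrib_right del:
          ennreal_plus)
    qed
    also have "\<dots> = (\<integral>\<^sup>+y. (\<integral>\<^sup>+x. ennreal ((norm (f y))\<^sup>2 / 2) * ennreal (k x y) \<partial>lborel) \<partial>lborel)
        + (\<integral>\<^sup>+y. (\<integral>\<^sup>+x. ennreal ((norm (f x))\<^sup>2 / 2) * ennreal (k x y) \<partial>lborel) \<partial>lborel)"
      by (subst nn_integral_add[symmetric]) (auto intro!: nn_integral_cong nn_integral_add)
    also have "(\<integral>\<^sup>+y. (\<integral>\<^sup>+x. ennreal ((norm (f x))\<^sup>2 / 2) * ennreal (k x y) \<partial>lborel) \<partial>lborel)
        = (\<integral>\<^sup>+x. (\<integral>\<^sup>+y. ennreal ((norm (f x))\<^sup>2 / 2) * ennreal (k x y) \<partial>lborel) \<partial>lborel)"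
      by (rule lborel_pair.Fubini') measurable
    also have "(\<integral>\<^sup>+y. (\<integral>\<^sup>+x. ennreal ((norm (f y))\<^sup>2 / 2) * ennreal (k x y) \<partial>lborel) \<partial>lborel)
        = (\<integral>\<^sup>+y. ennreal ((norm (f y))\<^sup>2 / 2) * ennreal (2 * pi) \<partial>lborel)"
      using nn_integral_scaled_normal(1)[OF s] by (simp add: nn_integral_cmult k_def)
    also have "(\<integral>\<^sup>+x. (\<integral>\<^sup>+y. ennreal ((norm (f x))\<^sup>2 / 2) * ennreal (k x y) \<partial>lborel) \<partial>lborel)
        = (\<integral>\<^sup>+y. ennreal ((norm (f y))\<^sup>2 / 2) * ennreal (2 * pi) \<partial>lborel)"
      using nn_integral_scaled_normal(2)[OF s] by (simp add: nn_integral_cmult k_def)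
    also have "(\<integral>\<^sup>+y. ennreal ((norm (f y))\<^sup>2 / 2) * ennreal (2 * pi) \<partial>lborel)
        + (\<integral>\<^sup>+y. ennreal ((norm (f y))\<^sup>2 / 2) * ennreal (2 * pi) \<partial>lborel)
        = (\<integral>\<^sup>+y. ennreal (2 * pi) * ennreal ((norm (f y))\<^sup>2) \<partial>lborel)"
    proof (subst nn_integral_add[symmetric])
      have "ennreal (b / 2) * ennreal (2 * pi) + ennreal (b / 2) * ennreal (2 * pi)
        = ennreal (2 * pi) * ennreal b"
        if "b \<ge> 0" for b
      proof -
        have "ennreal (b / 2 * (2 * pi)) + ennreal (b / 2 * (2 * pi)) = ennreal (2 * pi * b)"
          using that by (subst ennreal_plus[symmetric]) (auto simp: field_simps)
        then show ?thesis using that by (simp only: ennreal_mult divide_nonneg_nonneg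
          zero_le_numeral pi_ge_zero mult_nonneg_nonneg)
      qed
      then show "(\<integral>\<^sup>+y. ennreal ((norm (f y))\<^sup>2 / 2) * ennreal (2 * pi)
        + ennreal ((norm (f y))\<^sup>2 / 2) * ennreal (2 * pi) \<partial>lborel)
          = (\<integral>\<^sup>+y. ennreal (2 * pi) * ennreal ((norm (f y))\<^sup>2) \<partial>lborel)"
        by (intro nn_integral_cong) simp
    qed auto
    also have "\<dots> = ?C" by (simp add: nn_integral_cmult)
    finally show ?thesis .
  qed
  show ?thesis
  proof (rule nn_integral_le_of_tendsto)
    show "(\<lambda>n. ennreal ((norm (ft f \<xi>))\<^sup>2 * gauss (1 / real (Suc n)) \<xi>)) \<longlonglongrightarrow> ennreal ((norm (ft f
      \<xi>))\<^sup>2)" for \<xi>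
    proof (rule tendsto_ennrealI)
      have "(\<lambda>n. (norm (ft f \<xi>))\<^sup>2 * exp (- (1 / real (Suc n) * \<xi>)\<^sup>2 / 2)) \<longlonglongrightarrow> (norm (ft f \<xi>))\<^sup>2
        * exp (- (0 * \<xi>)\<^sup>2 / 2)"
        by (intro tendsto_intros LIMSEQ_Suc[OF lim_1_over_n]) simp
      then show "(\<lambda>n. (norm (ft f \<xi>))\<^sup>2 * gauss (1 / real (Suc n)) \<xi>) \<longlonglongrightarrow> (norm (ft f \<xi>))\<^sup>2"
        by (simp add: gauss_def)
    qed
    show "(\<integral>\<^sup>+\<xi>. ennreal ((norm (ft f \<xi>))\<^sup>2 * gauss (1 / real (Suc n)) \<xi>) \<partial>lborel) \<le> ?C" for n
      by (rule main) simp
  qed measurable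
qed

section \<open>The Fourier transform of a weak derivative\<close>

lemma funpow_deriv_linear:
  assumes "u \<in> smooth_funs" "v \<in> smooth_funs"
  shows "(deriv ^^ m) (\<lambda>x. a * u x + b * v x) = (\<lambda>x. a * (deriv ^^ m) u x + b * (deriv ^^ m) v x)"
proof (induction m)
  case (Suc m)
  have "((\<lambda>x. a * (deriv ^^ m) u x + b * (deriv ^^ m) v x) has_real_derivative
      a * deriv ((deriv ^^ m) u) x + b * deriv ((deriv ^^ m) v) x) (at x)" for x
    by (intro DERIV_add DERIV_cmult smooth_funs_deriv(2) smooth_funs_funpow_deriv assms)
  then show ?case using Suc by (auto intro!: DERIV_imp_deriv)
qed simp

lemma smooth_bump:
  obtains \<psi> where "\<psi> \<in> smooth_funs" "\<psi> 0 = 1" "\<And>x. \<bar>\<psi> x\<bar> \<le> 1" "\<And>x. \<bar>x\<bar> > 1 \<Longrightarrow> \<psi> x = 0"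
proof -
  \<comment> \<open>The factor \<open>exp 2\<close> normalises \<open>\<psi> 0\<close> to
    \<open>1\<close>. The bound by \<open>1\<close> holds because
    \<open>1 / (1 + x) + 1 / (1 - x) = 2 / (1 - x\<^sup>2)\<close> is at least
    \<open>2\<close>.\<close>
  define \<psi> where "\<psi> = (\<lambda>x. exp 2 * (flat 1 (1 * x + 1) * flat 1 ((-1) * x + 1)))"
  have "\<psi> \<in> smooth_funs" unfolding \<psi>_def
    by (rule smooth_funs.mult[OF smooth_funs.const smooth_funs.mult[OF
          smooth_funs.affine[OF smooth_funs.flat] smooth_funs.affine[OF smooth_funs.flat]]])
  moreover have "\<psi> 0 = 1" by (simp add: \<psi>_def flat_def exp_add[symmetric])
  moreover have "\<bar>\<psi> x\<bar> \<le> 1" for x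
  proof (cases "\<bar>x\<bar> < 1")
    case True
    then have "0 < 1 - x\<^sup>2" by (simp add: abs_square_less_1)
    then have "2 \<le> 2 / (1 - x\<^sup>2)" by (simp add: field_simps)
    also have "\<dots> = 1 / (1 + x) + 1 / (1 - x)"
      using True by (simp add: field_simps power2_eq_square)
    finally have "2 - 1 / (1 + x) - 1 / (1 - x) \<le> 0" by simp
    moreover have "\<psi> x = exp (2 - 1 / (1 + x) - 1 / (1 - x))"
    proof -
      have "0 < 1 + x" "0 < 1 - x" using True by auto
      then show ?thesis by (simp add: \<psi>_def flat_def exp_add[symmetric] add.commute)
    qed
    ultimately show ?thesis by simp
  qed (auto simp: \<psi>_def flat_def)
  moreover have "\<psi> x = 0" if "\<bar>x\<bar> > 1" for x using that by (auto simp: \<psi>_def flat_def)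
  ultimately show ?thesis using that by blast
qed

text \<open>Test functions are real, so the truncated wave
  \<open>phase \<xi> x * \<psi> (\<epsilon> * x)\<close> has to be represented by its cosine and
  sine parts.\<close>

definition modulated :: "(real \<Rightarrow> real) \<Rightarrow> (real \<Rightarrow> real) \<Rightarrow> real \<Rightarrow> real \<Rightarrow> real \<Rightarrow> real" where
  "modulated w \<psi> \<xi> \<epsilon> x = w (\<xi> * x) * \<psi> (\<epsilon> * x)"

lemma modulated_smooth:
  assumes "\<psi> \<in> smooth_funs" "w = cos \<or> w = sin"
  shows "modulated w \<psi> \<xi> \<epsilon> \<in> smooth_funs"
proof -
  have w: "w \<in> smooth_funs" using assms(2) smooth_funs.intros by auto
  show ?thesis
    unfolding modulated_def[abs_def]
    using smooth_funs.mult[OF smooth_funs.affine[OF w, of \<xi> 0] smooth_funs.affine[OF assms(1),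
      of \<epsilon> 0]] by simp
qed

lemma modulated_test_function:
  assumes "\<psi> \<in> smooth_funs" "test_function \<psi>" "w = cos \<or> w = sin" "\<epsilon> > 0"
  shows "test_function (modulated w \<psi> \<xi> \<epsilon>)"
proof -
  obtain R where R: "\<And>x. \<bar>x\<bar> > R \<Longrightarrow> \<psi> x = 0" using assms(2) by (auto simp: test_function_def)
  show ?thesis
  proof (rule smooth_funs_test_function[OF modulated_smooth[OF assms(1,3)], of "R / \<epsilon>"])
    fix x :: real assume "\<bar>x\<bar> > R / \<epsilon>"
    then have "\<bar>\<epsilon> * x\<bar> > R" using assms(4) by (simp add: abs_mult field_simps)
    then show "modulated w \<psi> \<xi> \<epsilon> x = 0" by (simp add: modulated_def R)
  qed
qed

lemma deriv_modulated:
  assumes "\<psi> \<in> smooth_funs"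
  shows "deriv (modulated cos \<psi> \<xi> \<epsilon>) = (\<lambda>x. (- \<xi>) * modulated sin \<psi> \<xi> \<epsilon> x
    + \<epsilon> * modulated cos (deriv \<psi>) \<xi> \<epsilon> x)"
    and "deriv (modulated sin \<psi> \<xi> \<epsilon>) = (\<lambda>x. \<xi> * modulated cos \<psi> \<xi> \<epsilon> x
      + \<epsilon> * modulated sin (deriv \<psi>) \<xi> \<epsilon> x)"
  unfolding modulated_def[abs_def]
  by (rule ext, rule DERIV_imp_deriv,
      auto intro!: derivative_eq_intros DERIV_chain2[OF smooth_funs_deriv(2)[OF assms]])+

text \<open>Each derivative falls either on the wave, which multiplies the combination of cosine and
  sine by \<open>- \<i> * \<xi>\<close>, or on the cut-off, which contributes a factor
  \<open>\<epsilon> n\<close> tending to \<open>0\<close>. In the second case the new cut-off is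
  \<open>deriv \<psi>\<close>, hence the induction over all \<open>\<psi>\<close>.\<close>

lemma modulated_pairing_tendsto:
  fixes f :: "real \<Rightarrow> complex"
  assumes f: "integrable lborel f" and \<psi>: "\<psi> \<in> smooth_funs" "test_function \<psi>"
  defines "\<epsilon> \<equiv> \<lambda>n. 1 / real (Suc n)"
  shows "(\<lambda>n. (\<integral>x. (deriv ^^ m) (modulated cos \<psi> \<xi> (\<epsilon> n)) x *\<^sub>R f x \<partial>lborel)
      - \<i> * (\<integral>x. (deriv ^^ m) (modulated sin \<psi> \<xi> (\<epsilon> n)) x *\<^sub>R f x \<partial>lborel))
    \<longlonglongrightarrow> (- (\<i> * of_real \<xi>)) ^ m * of_real (\<psi> 0) * ft f \<xi>"
  using \<psi>
proof (induction m arbitrary: \<psi>)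
  case (0 \<psi>)
  have \<epsilon>: "\<epsilon> n > 0" for n by (simp add: \<epsilon>_def)
  have si: "set_integrable lborel {a..b} f" for a b
    using f unfolding set_integrable_def by (intro integrable_mult_indicator) auto
  have [measurable]: "f \<in> borel_measurable borel" using borel_measurable_integrable[OF f] by simp
  have [measurable]: "\<psi> \<in> borel_measurable borel" by (rule test_function_measurable[OF 0(2)])
  obtain M where M: "\<And>x. \<bar>\<psi> x\<bar> \<le> M" using test_function_bounded_support[OF 0(2)] by metis
  have "(\<integral>x. modulated cos \<psi> \<xi> (\<epsilon> n) x *\<^sub>R f x \<partial>lborel) - \<i>
    * (\<integral>x. modulated sin \<psi> \<xi> (\<epsilon> n) x *\<^sub>R f x \<partial>lborel)
      = (\<integral>x. of_real (\<psi> (\<epsilon> n * x)) * (phase \<xi> x * f x) \<partial>lborel)" for n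
  proof -
    have i: "integrable lborel (\<lambda>x. modulated w \<psi> \<xi> (\<epsilon> n) x *\<^sub>R f x)" if "w = cos \<or> w = sin" for w
      by (rule integrable_test_function_mult[OF modulated_test_function[OF 0 that \<epsilon>] si])
    have "(\<integral>x. modulated cos \<psi> \<xi> (\<epsilon> n) x *\<^sub>R f x \<partial>lborel) - \<i>
      * (\<integral>x. modulated sin \<psi> \<xi> (\<epsilon> n) x *\<^sub>R f x \<partial>lborel)
      = (\<integral>x. modulated cos \<psi> \<xi> (\<epsilon> n) x *\<^sub>R f x - \<i> * (modulated sin \<psi> \<xi> (\<epsilon> n) x *\<^sub>R f x) \<partial>lborel)"
      using i[of cos] i[of sin] by (simp del: mult_scaleR_right)
    also have "\<dots> = (\<integral>x. of_real (\<psi> (\<epsilon> n * x)) * (phase \<xi> x * f x) \<partial>lborel)"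
    proof (rule Bochner_Integration.integral_cong)
      fix x
      have e: "phase \<xi> x = of_real (cos (\<xi> * x)) - \<i> * of_real (sin (\<xi> * x))"
        using cis_conv_exp[of "- (\<xi> * x)"] by (simp add: complex_eq_iff)
      show "modulated cos \<psi> \<xi> (\<epsilon> n) x *\<^sub>R f x - \<i> * (modulated sin \<psi> \<xi> (\<epsilon> n) x *\<^sub>R f x)
          = of_real (\<psi> (\<epsilon> n * x)) * (phase \<xi> x * f x)"
        unfolding e by (simp add: modulated_def scaleR_conv_of_real algebra_simps)
    qed simp
    finally show ?thesis .
  qed
  moreover have "(\<lambda>n. (\<integral>x. of_real (\<psi> (\<epsilon> n * x)) * (phase \<xi> x * f x) \<partial>lborel))
      \<longlonglongrightarrow> (\<integral>x. of_real (\<psi> 0) * (phase \<xi> x * f x) \<partial>lborel)"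
  proof (rule integral_dominated_convergence)
    show "integrable lborel (\<lambda>x. M * norm (f x))" using f by simp
    show "AE x in lborel. (\<lambda>n. of_real (\<psi> (\<epsilon> n * x)) * (phase \<xi> x * f x))
        \<longlonglongrightarrow> of_real (\<psi> 0) * (phase \<xi> x * f x)"
    proof (intro AE_I2 tendsto_mult tendsto_const tendsto_of_real)
      fix x
      have "isCont \<psi> 0" using DERIV_isCont[OF smooth_funs_deriv(2)[OF 0(1)]] .
      moreover have "(\<lambda>n. \<epsilon> n * x) \<longlonglongrightarrow> 0 * x"
        unfolding \<epsilon>_def by (intro tendsto_intros LIMSEQ_Suc[OF lim_1_over_n])
      ultimately show "(\<lambda>n. \<psi> (\<epsilon> n * x)) \<longlonglongrightarrow> \<psi> 0"
        by (intro isCont_tendsto_compose[of 0 \<psi>]) auto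
    qed
    show "AE x in lborel. norm (of_real (\<psi> (\<epsilon> n * x)) * (phase \<xi> x * f x)) \<le> M * norm (f x)" for n
      by (intro AE_I2) (simp add: norm_mult mult_right_mono M)
  qed measurable
  ultimately show ?case by (simp add: ft_def)
next
  case (Suc m \<psi>)
  have \<epsilon>: "\<epsilon> n > 0" for n by (simp add: \<epsilon>_def)
  have si: "set_integrable lborel {a..b} f" for a b
    using f unfolding set_integrable_def by (intro integrable_mult_indicator) auto
  define I where "I = (\<lambda>w \<psi> n. \<integral>x. (deriv ^^ m) (modulated w \<psi> \<xi> (\<epsilon> n)) x *\<^sub>R f x \<partial>lborel)"
  have s': "deriv \<psi> \<in> smooth_funs" "test_function (deriv \<psi>)"
    using smooth_funs_deriv(1)[OF Suc.prems(1)] test_function_deriv(1)[OF Suc.prems(2)] by auto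
  have lin: "(\<integral>x. (deriv ^^ Suc m) (modulated w \<psi> \<xi> (\<epsilon> n)) x *\<^sub>R f x \<partial>lborel)
      = a * I w' \<psi> n + \<epsilon> n * I w (deriv \<psi>) n"
    if d: "deriv (modulated w \<psi> \<xi> (\<epsilon> n)) = (\<lambda>x. a * modulated w' \<psi> \<xi> (\<epsilon> n) x
      + \<epsilon> n * modulated w (deriv \<psi>) \<xi> (\<epsilon> n) x)"
      and w: "w = cos \<or> w = sin" "w' = cos \<or> w' = sin" for a w w' n
  proof -
    have i: "integrable lborel (\<lambda>x. (deriv ^^ m) (modulated w \<kappa> \<xi> (\<epsilon> n)) x *\<^sub>R f x)"
      if "\<kappa> \<in> smooth_funs" "test_function \<kappa>" "w = cos \<or> w = sin" for \<kappa> w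
      by (rule integrable_test_function_mult[OF test_function_funpow_deriv[OF
        modulated_test_function[OF that \<epsilon>]] si])
    have "(deriv ^^ Suc m) (modulated w \<psi> \<xi> (\<epsilon> n)) x *\<^sub>R f x
        = of_real a * ((deriv ^^ m) (modulated w' \<psi> \<xi> (\<epsilon> n)) x *\<^sub>R f x)
          + of_real (\<epsilon> n) * ((deriv ^^ m) (modulated w (deriv \<psi>) \<xi> (\<epsilon> n)) x *\<^sub>R f x)" for x
      unfolding funpow_Suc_right o_def d
        funpow_deriv_linear[OF modulated_smooth[OF Suc.prems(1) w(2)] modulated_smooth[OF s'(1)
          w(1)]]
      by (simp add: scaleR_conv_of_real algebra_simps)
    then show ?thesis
      unfolding I_def using i[OF Suc.prems w(2)] i[OF s' w(1)] by (simp del: mult_scaleR_right)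
  qed
  have "(\<integral>x. (deriv ^^ Suc m) (modulated cos \<psi> \<xi> (\<epsilon> n)) x *\<^sub>R f x \<partial>lborel)
      - \<i> * (\<integral>x. (deriv ^^ Suc m) (modulated sin \<psi> \<xi> (\<epsilon> n)) x *\<^sub>R f x \<partial>lborel)
    = (- (\<i> * of_real \<xi>)) * (I cos \<psi> n - \<i> * I sin \<psi> n)
      + of_real (\<epsilon> n) * (I cos (deriv \<psi>) n - \<i> * I sin (deriv \<psi>) n)" for n
    unfolding lin[OF deriv_modulated(1)[OF Suc.prems(1)] disjI1[OF refl] disjI2[OF refl]]
      lin[OF deriv_modulated(2)[OF Suc.prems(1)] disjI2[OF refl] disjI1[OF refl]]
    by (simp add: algebra_simps)
  moreover have "(\<lambda>n. (- (\<i> * of_real \<xi>)) * (I cos \<psi> n - \<i> * I sin \<psi> n)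
      + of_real (\<epsilon> n) * (I cos (deriv \<psi>) n - \<i> * I sin (deriv \<psi>) n))
    \<longlonglongrightarrow> (- (\<i> * of_real \<xi>)) * ((- (\<i> * of_real \<xi>)) ^ m * of_real (\<psi> 0) * ft f \<xi>)
      + of_real 0 * ((- (\<i> * of_real \<xi>)) ^ m * of_real (deriv \<psi> 0) * ft f \<xi>)"
    unfolding I_def
    by (intro tendsto_intros Suc.IH Suc.prems s') (simp only: \<epsilon>_def, rule LIMSEQ_Suc[OF
      lim_1_over_n])
  ultimately show ?case by (simp add: mult_ac)
qed

text \<open>Since \<open>g\<close> is only locally integrable, its transform need not exist, but
  that of the truncation \<open>h n\<close> does. Testing with truncated waves shows that
  \<open>ft (h n) \<xi>\<close> tends to \<open>(\<i> * \<xi>) ^ m * ft f \<xi>\<close>. Bessel's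
  inequality for \<open>h n\<close>, together with \<open>|\<psi>| \<le> 1\<close> and Fatou's
  lemma, gives the claim.\<close>

proposition ft_weak_derivative_bound:
  fixes f g :: "real \<Rightarrow> complex"
  assumes f: "integrable lborel f" and g: "\<And>a b. set_integrable lborel {a..b} g"
    and gm [measurable]: "g \<in> borel_measurable borel"
    and weak: "\<And>\<phi>. test_function \<phi> \<Longrightarrow> (\<integral>x. (deriv ^^ m) \<phi> x *\<^sub>R f x \<partial>lborel)
        = (- 1) ^ m *\<^sub>R (\<integral>x. \<phi> x *\<^sub>R g x \<partial>lborel)"
  shows "(\<integral>\<^sup>+\<xi>. ennreal (\<xi> ^ (2 * m) * (norm (ft f \<xi>))\<^sup>2) \<partial>lborel)
    \<le> ennreal (2 * pi) * l2_sq g" (is "_ \<le> ?C")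
proof -
  obtain \<psi> where \<psi>: "\<psi> \<in> smooth_funs" "\<psi> 0 = 1" "\<And>x. \<bar>\<psi> x\<bar> \<le> 1" "\<And>x. \<bar>x\<bar> > 1 \<Longrightarrow> \<psi> x = 0"
    using smooth_bump by metis
  have t: "test_function \<psi>" by (rule smooth_funs_test_function[OF \<psi>(1,4)])
  have [measurable]: "\<psi> \<in> borel_measurable borel" by (rule test_function_measurable[OF t])
  define \<epsilon> where "\<epsilon> = (\<lambda>n. 1 / real (Suc n))"
  have \<epsilon>: "\<epsilon> n > 0" for n by (simp add: \<epsilon>_def)
  define h where "h = (\<lambda>n x. \<psi> (\<epsilon> n * x) *\<^sub>R g x)"
  have [measurable]: "h n \<in> borel_measurable borel" for n unfolding h_def by measurable
  have "modulated cos \<psi> 0 (\<epsilon> n) = (\<lambda>x. \<psi> (\<epsilon> n * x))" for n by (simp add: modulated_def fun_eq_iff)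
  then have ht: "test_function (\<lambda>x. \<psi> (\<epsilon> n * x))" for n
    using modulated_test_function[OF \<psi>(1) t _ \<epsilon>, of cos 0 n] by simp
  have hi: "integrable lborel (h n)" for n
    unfolding h_def by (rule integrable_test_function_mult[OF ht g])
  have eq: "(\<integral>x. (deriv ^^ m) (modulated cos \<psi> \<xi> (\<epsilon> n)) x *\<^sub>R f x \<partial>lborel)
      - \<i> * (\<integral>x. (deriv ^^ m) (modulated sin \<psi> \<xi> (\<epsilon> n)) x *\<^sub>R f x \<partial>lborel)
    = (- 1) ^ m * ft (h n) \<xi>" for n \<xi>
  proof -
    have i: "integrable lborel (\<lambda>x. modulated w \<psi> \<xi> (\<epsilon> n) x *\<^sub>R g x)" if "w = cos \<or> w = sin" for w
      by (rule integrable_test_function_mult[OF modulated_test_function[OF \<psi>(1) t that \<epsilon>] g])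
    have "(\<integral>x. modulated cos \<psi> \<xi> (\<epsilon> n) x *\<^sub>R g x \<partial>lborel) - \<i>
      * (\<integral>x. modulated sin \<psi> \<xi> (\<epsilon> n) x *\<^sub>R g x \<partial>lborel)
      = (\<integral>x. modulated cos \<psi> \<xi> (\<epsilon> n) x *\<^sub>R g x - \<i> * (modulated sin \<psi> \<xi> (\<epsilon> n) x *\<^sub>R g x) \<partial>lborel)"
      using i[of cos] i[of sin] by (simp del: mult_scaleR_right)
    also have "\<dots> = ft (h n) \<xi>"
      unfolding ft_def
    proof (rule Bochner_Integration.integral_cong)
      fix x
      have e: "phase \<xi> x = of_real (cos (\<xi> * x)) - \<i> * of_real (sin (\<xi> * x))"
        using cis_conv_exp[of "- (\<xi> * x)"] by (simp add: complex_eq_iff)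
      show "modulated cos \<psi> \<xi> (\<epsilon> n) x *\<^sub>R g x - \<i> * (modulated sin \<psi> \<xi> (\<epsilon> n) x *\<^sub>R g x)
          = phase \<xi> x * h n x"
        unfolding e by (simp add: modulated_def h_def scaleR_conv_of_real algebra_simps)
    qed simp
    finally show ?thesis
      unfolding weak[OF modulated_test_function[OF \<psi>(1) t _ \<epsilon>, of cos, simplified]]
        weak[OF modulated_test_function[OF \<psi>(1) t _ \<epsilon>, of sin, simplified]]
      by (simp add: scaleR_conv_of_real algebra_simps flip: distrib_left right_diff_distrib)
  qed
  show ?thesis
  proof (rule nn_integral_le_of_tendsto)
    show "(\<lambda>n. ennreal ((norm (ft (h n) \<xi>))\<^sup>2)) \<longlonglongrightarrow> ennreal (\<xi> ^ (2 * m) * (norm (ft f \<xi>))\<^sup>2)" for \<xi>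
    proof (rule tendsto_ennrealI)
      have "(\<lambda>n. (norm ((- 1) ^ m * ft (h n) \<xi>))\<^sup>2) \<longlonglongrightarrow> (norm ((- (\<i> * of_real \<xi>)) ^ m
        * of_real (\<psi> 0) * ft f \<xi>))\<^sup>2"
        using modulated_pairing_tendsto[OF f \<psi>(1) t, of m \<xi>] unfolding \<epsilon>_def[symmetric]
        unfolding eq[unfolded \<epsilon>_def] eq
        by (intro tendsto_power tendsto_norm)
      then show "(\<lambda>n. (norm (ft (h n) \<xi>))\<^sup>2) \<longlonglongrightarrow> \<xi> ^ (2 * m) * (norm (ft f \<xi>))\<^sup>2"
        by (simp add: norm_mult norm_power \<psi>(2) power_mult_distrib power_mult[symmetric]
          mult.commute[of m] power_even_abs)
    qed
    show "l2_sq (ft (h n)) \<le> ?C" for n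
    proof -
      have "(norm (h n x))\<^sup>2 \<le> (norm (g x))\<^sup>2" for x
        unfolding h_def using \<psi>(3)[of "\<epsilon> n * x"]
        by (intro power_mono) (auto intro: mult_left_le_one_le)
      then have "l2_sq (h n) \<le> l2_sq g"
        by (intro nn_integral_mono ennreal_leI)
      then show ?thesis
        using ft_bessel[OF hi[of n]] by (meson mult_left_mono order_trans zero_le)
    qed
  qed measurable
qed

section \<open>Absolutely convergent inverse Fourier integrals\<close>

lemma ft_mult_reflect:
  assumes F: "integrable lborel F" and p: "integrable lborel p"
  shows "(\<integral>x. p x * ft F (- x) \<partial>lborel) = (\<integral>\<xi>. ft p (- \<xi>) * F \<xi> \<partial>lborel)"
proof -
  have "integrable lborel (\<lambda>x. p (0 + (-1) * x))" by (rule lborel_integrable_real_affine[OF p]) simp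
  then have p': "integrable lborel (\<lambda>x. p (- x))" by simp
  have e: "ft (\<lambda>x. p (- x)) \<xi> = ft p (- \<xi>)" for \<xi>
  proof -
    have "ft p (- \<xi>) = (\<integral>x. phase (- \<xi>) (0 + (-1) * x) * p (0 + (-1) * x) \<partial>lborel)"
      unfolding ft_def by (subst lborel_integral_real_affine[where c = "-1" and t = 0]) auto
    then show ?thesis by (simp add: ft_def)
  qed
  have "(\<integral>x. p x * ft F (- x) \<partial>lborel) = (\<integral>x. p (0 + (-1) * x) * ft F (- (0 + (-1) * x)) \<partial>lborel)"
    by (subst lborel_integral_real_affine[where c = "-1" and t = 0]) auto
  also have "\<dots> = (\<integral>x. ft F x * p (- x) \<partial>lborel)" by (simp add: mult.commute)
  also have "\<dots> = (\<integral>\<xi>. ft p (- \<xi>) * F \<xi> \<partial>lborel)"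
    unfolding ft_mult[OF F p'] e by (simp add: mult.commute)
  finally show ?thesis .
qed

lemma integrable_test_function:
  assumes "test_function \<phi>"
  shows "integrable lborel (\<lambda>x. complex_of_real (\<phi> x))"
proof -
  have "set_integrable lborel {a..b} (\<lambda>x. 1 :: complex)" for a b :: real
    by (intro borel_integrable_atLeastAtMost' continuous_on_const)
  then show ?thesis
    using integrable_test_function_mult[OF assms, of "\<lambda>x. 1 :: complex"]
    by (simp add: scaleR_conv_of_real)
qed

lemma ft_deriv_test_function:
  assumes t: "test_function \<phi>"
  shows "ft (\<lambda>x. complex_of_real (deriv \<phi> x)) \<xi> = \<i> * of_real \<xi> * ft (\<lambda>x. complex_of_real (\<phi> x)) \<xi>"
proof -
  obtain R where R: "R > 0" "\<And>x. \<bar>x\<bar> > R \<Longrightarrow> \<phi> x = 0" using test_function_bounded_support[OF t]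
    by metis
  obtain R' where R': "R' > 0" "\<And>x. \<bar>x\<bar> > R' \<Longrightarrow> deriv \<phi> x = 0"
    using test_function_bounded_support[OF test_function_deriv(1)[OF t]] by metis
  \<comment> \<open>Both supports lie strictly inside \<open>[- Q, Q]\<close>, so \<open>G\<close>
    vanishes at the end points and the fundamental theorem of calculus leaves no boundary
    terms.\<close>
  define Q where "Q = R + R' + 1"
  define E where "E = (\<lambda>x. phase \<xi> x)"
  define G where "G = (\<lambda>x. E x * of_real (\<phi> x))"
  define g where "g = (\<lambda>x. E x * of_real (deriv \<phi> x) - \<i> * of_real \<xi> * (E x * of_real (\<phi> x)))"
  have dE: "(E has_vector_derivative (- (\<i> * of_real \<xi>) * E x)) (at x)" for x
  proof -
    have "((\<lambda>z. exp (- (\<i> * of_real \<xi> * z))) has_field_derivative (- (\<i> * of_real \<xi>)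
      * E x)) (at (of_real x))"
      unfolding E_def by (auto intro!: derivative_eq_intros simp: mult_ac)
    from has_vector_derivative_real_field[OF this] show ?thesis by (simp add: E_def mult_ac)
  qed
  have d\<phi>: "((\<lambda>x. complex_of_real (\<phi> x)) has_vector_derivative of_real (deriv \<phi> x)) (at x)" for x
    using test_function_deriv(2)[OF t, of x]
    by (intro has_vector_derivative_of_real) (simp add:
      has_real_derivative_iff_has_vector_derivative)
  have dG: "(G has_vector_derivative g x) (at x)" for x
    using has_vector_derivative_mult[OF dE[of x] d\<phi>[of x]]
    by (simp add: G_def g_def algebra_simps)
  have c: "continuous_on UNIV (\<lambda>x. complex_of_real (deriv \<phi> x))" "continuous_on UNIV (\<lambda>x.
    complex_of_real (\<phi> x))"
    using DERIV_continuous_on[OF DERIV_subset[OF test_function_deriv(2)[OF t]], of UNIV]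
      DERIV_continuous_on[OF DERIV_subset[OF test_function_deriv(2)[OF test_function_deriv(1)[OF
        t]]], of UNIV]
    by (auto intro!: continuous_on_of_real)
  have cg: "continuous_on A g" for A
    unfolding g_def E_def
    by (intro continuous_intros continuous_on_subset[OF c(1)] continuous_on_subset[OF c(2)]) auto
  have "(\<integral>x. indicator {-Q..Q} x *\<^sub>R g x \<partial>lborel) = G Q - G (- Q)"
    using R(1) R'(1)
    by (intro integral_FTC_Icc has_vector_derivative_at_within[OF dG] cg) (auto simp: Q_def)
  also have "(\<lambda>x. indicator {-Q..Q} x *\<^sub>R g x) = g"
  proof
    fix x
    show "indicator {-Q..Q} x *\<^sub>R g x = g x"
    proof (cases "\<bar>x\<bar> \<le> Q")
      case False
      then have "\<phi> x = 0" "deriv \<phi> x = 0" using R R' by (auto simp: Q_def)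
      then show ?thesis by (simp add: g_def)
    qed (auto simp: indicator_def abs_le_iff)
  qed
  also have "G Q - G (- Q) = 0" using R R' by (simp add: G_def Q_def)
  finally have "(\<integral>x. g x \<partial>lborel) = 0" .
  moreover have "(\<integral>x. g x \<partial>lborel) = ft (\<lambda>x. complex_of_real (deriv \<phi> x)) \<xi> - \<i> * of_real \<xi>
    * ft (\<lambda>x. complex_of_real (\<phi> x)) \<xi>"
    using integrable_phase[OF integrable_test_function[OF t], of \<xi>]
      integrable_phase[OF integrable_test_function[OF test_function_deriv(1)[OF t]], of \<xi>]
    unfolding g_def E_def ft_def by simp
  ultimately show ?thesis by simp
qed

lemma ft_funpow_deriv_test_function:
  "test_function \<phi> \<Longrightarrow> ft (\<lambda>x. complex_of_real ((deriv ^^ n) \<phi> x)) \<xi>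
    = (\<i> * of_real \<xi>) ^ n * ft (\<lambda>x. complex_of_real (\<phi> x)) \<xi>"
  by (induction n) (simp_all add: ft_deriv_test_function test_function_funpow_deriv)

definition inv_ft :: "(real \<Rightarrow> complex) \<Rightarrow> real \<Rightarrow> complex" where
  "inv_ft F x = ft F (- x) / of_real (2 * pi)"

text \<open>The multiplication formula moves the transform onto the test function, where the
  derivatives become powers of \<open>- \<i> * \<xi>\<close>; applied once more, it moves the
  transform back. The sign \<open>(- 1) ^ n\<close> is due to the reflection.\<close>

lemma inv_ft_weak_derivative:
  assumes F: "integrable lborel F" "integrable lborel (\<lambda>\<xi>. (\<i> * of_real \<xi>) ^ n * F \<xi>)"
    and t: "test_function \<phi>"
  shows "(\<integral>x. (deriv ^^ n) \<phi> x *\<^sub>R inv_ft F x \<partial>lborel)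
    = (- 1) ^ n *\<^sub>R (\<integral>x. \<phi> x *\<^sub>R inv_ft (\<lambda>\<xi>. (\<i> * of_real \<xi>) ^ n * F \<xi>) x \<partial>lborel)"
proof -
  have "(\<integral>x. (deriv ^^ n) \<phi> x *\<^sub>R inv_ft F x \<partial>lborel)
      = (\<integral>x. of_real ((deriv ^^ n) \<phi> x) * ft F (- x) \<partial>lborel) / of_real (2 * pi)"
    by (simp add: inv_ft_def scaleR_conv_of_real)
  also have "(\<integral>x. of_real ((deriv ^^ n) \<phi> x) * ft F (- x) \<partial>lborel)
      = (\<integral>\<xi>. (\<i> * of_real (- \<xi>)) ^ n * ft (\<lambda>x. of_real (\<phi> x)) (- \<xi>) * F \<xi> \<partial>lborel)"
    unfolding ft_mult_reflect[OF F(1) integrable_test_function[OF test_function_funpow_deriv[OF t]]]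
      ft_funpow_deriv_test_function[OF t] ..
  also have "\<dots> = (\<integral>\<xi>. (- 1) ^ n * (ft (\<lambda>x. of_real (\<phi> x)) (- \<xi>) * ((\<i> * of_real \<xi>) ^ n
    * F \<xi>)) \<partial>lborel)"
    by (intro Bochner_Integration.integral_cong) (auto
      simp: power_minus[of "\<i> * of_real _"] mult_ac)
  also have "\<dots> = (- 1) ^ n * (\<integral>x. of_real (\<phi> x) * ft (\<lambda>\<xi>. (\<i> * of_real \<xi>) ^ n * F \<xi>) (- x) \<partial>lborel)"
    unfolding ft_mult_reflect[OF F(2) integrable_test_function[OF t]] by simp
  finally show ?thesis by (simp add: inv_ft_def scaleR_conv_of_real)
qed

lemma inv_ft_bessel:
  assumes "integrable lborel F"
  shows "l2_sq (inv_ft F)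
    \<le> ennreal (1 / (2 * pi)) * l2_sq F"
proof -
  have [measurable]: "F \<in> borel_measurable borel" using borel_measurable_integrable[OF assms]
    by simp
  have "l2_sq (inv_ft F)
      = (\<integral>\<^sup>+x. ennreal (1 / (2 * pi)\<^sup>2) * ennreal ((norm (ft F (- x)))\<^sup>2) \<partial>lborel)"
    by (intro nn_integral_cong) (simp add: inv_ft_def norm_divide power_divide
      ennreal_mult[symmetric])
  also have "\<dots> = ennreal (1 / (2 * pi)\<^sup>2) * (\<integral>\<^sup>+x. ennreal ((norm (ft F (- x)))\<^sup>2) \<partial>lborel)"
    by (intro nn_integral_cmult) measurable
  also have "(\<integral>\<^sup>+x. ennreal ((norm (ft F (- x)))\<^sup>2) \<partial>lborel) = l2_sq (ft F)"
    using nn_integral_real_affine[of "\<lambda>x. ennreal ((norm (ft F x))\<^sup>2)" "-1" 0] by simp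
  also have "ennreal (1 / (2 * pi)\<^sup>2) * \<dots> \<le> ennreal (1 / (2 * pi)\<^sup>2) * (ennreal (2 * pi) * l2_sq F)"
    by (intro mult_left_mono ft_bessel assms) simp
  also have "\<dots> = ennreal (1 / (2 * pi)) * l2_sq F"
    unfolding mult.assoc[symmetric] by (subst ennreal_mult[symmetric]) (auto simp: power2_eq_square)
  finally show ?thesis .
qed

section \<open>Recovering a square-integrable function from its integrable transform\<close>

lemma le_one_plus_square: "x \<le> 1 + x\<^sup>2" for x :: real
  using zero_le_power2[of "x - 1/2"] by (simp add: power2_eq_square algebra_simps)

lemma square_integrable_imp_set_integrable:
  fixes f :: "real \<Rightarrow> 'a::{banach, second_countable_topology}"
  assumes [measurable]: "f \<in> borel_measurable borel" and i: "integrable lborel (\<lambda>x. (norm (f x))\<^sup>2)"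
  shows "set_integrable lborel {a..b} f"
  unfolding set_integrable_def
proof (rule Bochner_Integration.integrable_bound)
  show "integrable lborel (\<lambda>x. indicat_real {a..b} x + (norm (f x))\<^sup>2)"
    using i by (intro Bochner_Integration.integrable_add) (simp_all add:
      integrable_indicator_iff emeasure_lborel_Icc_eq)
  show "AE x in lborel. norm (indicat_real {a..b} x *\<^sub>R f x)
    \<le> norm (indicat_real {a..b} x + (norm (f x))\<^sup>2)"
  proof (rule AE_I2)
    fix x
    have "norm (f x) \<le> 1 + (norm (f x))\<^sup>2" by (rule le_one_plus_square)
    then show "norm (indicat_real {a..b} x *\<^sub>R f x) \<le> norm (indicat_real {a..b} x + (norm (f x))\<^sup>2)"
      by (auto simp: indicator_def)
  qed
qed measurable

text \<open>The transform is known only as an \<open>L\<^sup>2\<close> limit over truncations of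
  \<open>f\<close>. For each truncation \<open>gauss_pairing\<close> applies. On the frequency side
  the limit follows from the Cauchy-Schwarz inequality, as the modulated Gaussian is square
  integrable; on the other side it follows by dominated convergence.\<close>

lemma plancherel_gauss_identity:
  fixes f F :: "real \<Rightarrow> complex"
  assumes [measurable]: "f \<in> borel_measurable borel" and f2: "integrable lborel (\<lambda>x. (norm (f
    x))\<^sup>2)"
    and F: "integrable lborel F"
    and lim: "((\<lambda>R. \<integral>\<^sup>+\<xi>. ennreal ((norm (ft (\<lambda>x. indicat_real {-R..R} x *\<^sub>R f x) \<xi> - F \<xi>))\<^sup>2)
      \<partial>lborel) \<longlongrightarrow> 0) at_top"
    and s: "s > 0"
  shows "(\<integral>w. std_normal_density w *\<^sub>R f (a + s * w) \<partial>lborel)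
    = inv_ft (\<lambda>\<xi>. F \<xi> * of_real (gauss s \<xi>)) a"
proof -
  have [measurable]: "F \<in> borel_measurable borel" using borel_measurable_integrable[OF F] by simp
  define fn where "fn = (\<lambda>n x. indicat_real {- real n..real n} x *\<^sub>R f x)"
  have fni: "integrable lborel (fn n)" for n
    using square_integrable_imp_set_integrable[OF assms(1) f2] unfolding fn_def
      set_integrable_def by blast
  have [measurable]: "fn n \<in> borel_measurable borel" for n unfolding fn_def by measurable
  define g where "g = (\<lambda>\<xi>. exp (\<i> * of_real (\<xi> * a)) * complex_of_real (gauss s \<xi>))"
  have gi: "integrable lborel g" unfolding g_def by (rule modulated_gauss_integrable[OF s])
  have [measurable]: "g \<in> borel_measurable borel" using borel_measurable_integrable[OF gi] by simp
  have ng: "norm (g \<xi>) = gauss s \<xi>" for \<xi>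
    using gauss_bounds[of s \<xi>] by (simp add: g_def norm_mult)
  define k where "k = (\<lambda>x. 2 * pi / s * std_normal_density ((x - a) / s))"
  have km [measurable]: "k \<in> borel_measurable borel" unfolding k_def by measurable
  have k0: "k x \<ge> 0" for x using s by (simp add: k_def normal_density_nonneg)
  have ki: "integrable lborel k"
  proof (rule integrableI_nonneg)
    show "(\<integral>\<^sup>+x. ennreal (k x) \<partial>lborel) < \<infinity>"
      unfolding k_def nn_integral_scaled_normal(1)[OF s, of a] by simp
  qed (use k0 in auto)
  define M where "M = 2 * pi / s"
  have kM: "k x \<le> M" for x
  proof -
    have "std_normal_density y \<le> 1" for y
    proof -
      have "1 / sqrt (2 * pi) \<le> 1" using pi_ge_two by (simp add: real_le_rsqrt)
      moreover have "exp (- y\<^sup>2 / 2) \<le> 1" by simp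
      ultimately show ?thesis unfolding std_normal_density_def by (intro mult_le_one) auto
    qed
    then have "2 * pi / s * std_normal_density ((x - a) / s) \<le> 2 * pi / s * 1"
      using s by (intro mult_left_mono) auto
    then show ?thesis by (simp add: k_def M_def)
  qed
  have lhs: "(\<lambda>n. \<integral>x. fn n x * of_real (k x) \<partial>lborel) \<longlonglongrightarrow> (\<integral>x. f x * of_real (k x) \<partial>lborel)"
  proof (rule integral_dominated_convergence)
    \<comment> \<open>The kernel is integrable and bounded by \<open>M\<close>, so
      \<open>|f| \<le> 1 + |f|\<^sup>2\<close> makes the product with the merely square-integrable
      \<open>f\<close> integrable.\<close>
    show "integrable lborel (\<lambda>x. k x + M * (norm (f x))\<^sup>2)" using ki f2 by simp
    show "AE x in lborel. (\<lambda>n. fn n x * of_real (k x)) \<longlonglongrightarrow> f x * of_real (k x)"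
    proof (intro AE_I2 tendsto_mult tendsto_const tendsto_eventually)
      fix x
      obtain N where "\<bar>x\<bar> \<le> real N" using real_arch_simple by blast
      then show "\<forall>\<^sub>F n in sequentially. fn n x = f x"
        by (intro eventually_sequentiallyI[of N]) (auto simp: fn_def indicator_def abs_le_iff)
    qed
    show "AE x in lborel. norm (fn n x * of_real (k x)) \<le> k x + M * (norm (f x))\<^sup>2" for n
    proof (rule AE_I2)
      fix x
      have "norm (f x) \<le> 1 + (norm (f x))\<^sup>2" by (rule le_one_plus_square)
      have "norm (fn n x * of_real (k x)) \<le> norm (f x) * k x"
        using k0[of x] by (simp add: fn_def norm_mult indicator_def)
      also have "\<dots> \<le> (1 + (norm (f x))\<^sup>2) * k x" using k0 \<open>norm (f x) \<le> _\<close>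
        by (intro mult_right_mono)
      also have "\<dots> \<le> k x + M * (norm (f x))\<^sup>2"
        using mult_right_mono[OF kM[of x], of "(norm (f x))\<^sup>2"] by (simp add: algebra_simps)
      finally show "norm (fn n x * of_real (k x)) \<le> k x + M * (norm (f x))\<^sup>2" .
    qed
  qed measurable
  have Fg: "integrable lborel (\<lambda>\<xi>. F \<xi> * g \<xi>)"
    by (rule Bochner_Integration.integrable_bound[OF F])
      (use gauss_bounds(2) in \<open>auto simp: norm_mult ng intro!: mult_left_le\<close>)
  have fg: "integrable lborel (\<lambda>\<xi>. ft (fn n) \<xi> * g \<xi>)" for n
  proof (rule Bochner_Integration.integrable_bound)
    show "integrable lborel (\<lambda>\<xi>. (\<integral>x. norm (fn n x) \<partial>lborel) * norm (g \<xi>))" using gi by simp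
    show "AE \<xi> in lborel. norm (ft (fn n) \<xi> * g \<xi>)
      \<le> norm ((\<integral>x. norm (fn n x) \<partial>lborel) * norm (g \<xi>))"
      using norm_ft_le[of "fn n"] by (auto simp: norm_mult abs_mult intro!: mult_right_mono)
  qed measurable
  define u where "u = (\<lambda>n. \<integral>\<^sup>+\<xi>. ennreal ((norm (ft (fn n) \<xi> - F \<xi>))\<^sup>2) \<partial>lborel)"
  define B where "B = l2_sq g"
  have "B \<le> (\<integral>\<^sup>+\<xi>. ennreal (gauss s \<xi>) \<partial>lborel)"
    unfolding B_def ng
    by (intro nn_integral_mono ennreal_leI)
      (use gauss_bounds less_imp_le in \<open>auto simp: power2_eq_square intro!: mult_left_le\<close>)
  also have "\<dots> = ennreal (\<integral>\<xi>. gauss s \<xi> \<partial>lborel)"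
    by (intro nn_integral_eq_integral gauss_integrable s AE_I2 less_imp_le gauss_bounds)
  finally have B: "B < top" by (auto simp: less_top[symmetric] top_unique)
  have "(\<lambda>n. u n) \<longlonglongrightarrow> 0"
    unfolding u_def fn_def using filterlim_compose[OF lim filterlim_real_sequentially] .
  then have "(\<lambda>n. B * u n) \<longlonglongrightarrow> B * 0"
    using B by (intro ennreal_tendsto_cmult) auto
  then have Bu: "(\<lambda>n. B * u n) \<longlonglongrightarrow> 0" by simp
  have "ennreal ((norm ((\<integral>\<xi>. ft (fn n) \<xi> * g \<xi> \<partial>lborel) - (\<integral>\<xi>. F \<xi> * g \<xi> \<partial>lborel)))\<^sup>2)
    \<le> B * u n" for n
  proof -
    have "(\<integral>\<xi>. ft (fn n) \<xi> * g \<xi> \<partial>lborel) - (\<integral>\<xi>. F \<xi> * g \<xi> \<partial>lborel)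
      = (\<integral>\<xi>. (ft (fn n) \<xi> - F \<xi>) * g \<xi> \<partial>lborel)"
      using fg[of n] Fg by (simp add: algebra_simps)
    then have "ennreal ((norm ((\<integral>\<xi>. ft (fn n) \<xi> * g \<xi> \<partial>lborel) - (\<integral>\<xi>. F \<xi> * g \<xi> \<partial>lborel)))\<^sup>2)
      \<le> (\<integral>\<^sup>+\<xi>. ennreal (norm (ft (fn n) \<xi> - F \<xi>)) * ennreal (norm (g \<xi>)) \<partial>lborel)\<^sup>2"
      using norm_integral_le_nn_integral[where f = "\<lambda>\<xi>. (ft (fn n) \<xi> - F \<xi>) * g \<xi>" and M = lborel]
      by (simp add: ennreal_power[symmetric] norm_mult ennreal_mult power_mono)
    also have "\<dots> \<le> (\<integral>\<^sup>+\<xi>. (ennreal (norm (ft (fn n) \<xi> - F \<xi>)))\<^sup>2 \<partial>lborel)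
      * (\<integral>\<^sup>+\<xi>. (ennreal (norm (g \<xi>)))\<^sup>2 \<partial>lborel)"
      by (rule Cauchy_Schwarz_nn_integral) measurable
    also have "\<dots> = B * u n" unfolding B_def u_def by (simp add: ennreal_power mult.commute)
    finally show ?thesis .
  qed
  then have "(\<lambda>n. ennreal ((norm ((\<integral>\<xi>. ft (fn n) \<xi> * g \<xi> \<partial>lborel) - (\<integral>\<xi>. F \<xi>
    * g \<xi> \<partial>lborel)))\<^sup>2)) \<longlonglongrightarrow> 0"
    by (intro tendsto_sandwich[OF _ _ tendsto_const Bu] always_eventually allI) auto
  then have "(\<lambda>n. (norm ((\<integral>\<xi>. ft (fn n) \<xi> * g \<xi> \<partial>lborel) - (\<integral>\<xi>. F \<xi> * g \<xi> \<partial>lborel)))\<^sup>2) \<longlonglongrightarrow> 0"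
    unfolding ennreal_0[symmetric] by (subst (asm) tendsto_ennreal_iff) auto
  then have "(\<lambda>n. sqrt ((norm ((\<integral>\<xi>. ft (fn n) \<xi> * g \<xi> \<partial>lborel) - (\<integral>\<xi>. F \<xi>
    * g \<xi> \<partial>lborel)))\<^sup>2)) \<longlonglongrightarrow> sqrt 0"
    by (intro tendsto_real_sqrt)
  then have "(\<lambda>n. \<integral>\<xi>. ft (fn n) \<xi> * g \<xi> \<partial>lborel) \<longlonglongrightarrow> (\<integral>\<xi>. F \<xi> * g \<xi> \<partial>lborel)"
    by (simp add: tendsto_norm_zero_iff LIM_zero_iff)
  moreover have "(\<integral>\<xi>. ft (fn n) \<xi> * g \<xi> \<partial>lborel) = (\<integral>x. fn n x * of_real (k x) \<partial>lborel)" for n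
    unfolding g_def k_def by (rule gauss_pairing[OF fni s])
  ultimately have "(\<integral>x. f x * of_real (k x) \<partial>lborel) = (\<integral>\<xi>. F \<xi> * g \<xi> \<partial>lborel)"
    using LIMSEQ_unique[OF lhs] by simp
  also have "(\<integral>\<xi>. F \<xi> * g \<xi> \<partial>lborel) = of_real (2 * pi) * inv_ft (\<lambda>\<xi>. F \<xi> * of_real (gauss s \<xi>)) a"
    by (simp add: inv_ft_def ft_def g_def mult_ac)
  also have "(\<integral>x. f x * of_real (k x) \<partial>lborel)
    = \<bar>s\<bar> *\<^sub>R (\<integral>w. f (a + s * w) * of_real (k (a + s * w)) \<partial>lborel)"
    using s by (intro lborel_integral_real_affine) simp
  also have "\<dots> = (\<integral>w. s *\<^sub>R (f (a + s * w) * of_real (k (a + s * w))) \<partial>lborel)" using s by simp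
  also have "\<dots> = (\<integral>w. of_real (2 * pi) * (std_normal_density w *\<^sub>R f (a + s * w)) \<partial>lborel)"
    using s by (intro Bochner_Integration.integral_cong) (auto simp: k_def scaleR_conv_of_real)
  also have "\<dots> = of_real (2 * pi) * (\<integral>w. std_normal_density w *\<^sub>R f (a + s * w) \<partial>lborel)"
    by (rule integral_mult_right_zero)
  finally show ?thesis by simp
qed

text \<open>Letting the width of the Gaussian tend to \<open>0\<close> at a fixed point would call
  for Lebesgue points of \<open>f\<close>. After integration over an interval it suffices that the
  integral \<open>J\<close> over the shifted interval is bounded and continuous at \<open>0\<close>,
  which dominated convergence provides.\<close>

lemma plancherel_interval_integral:
  fixes f F :: "real \<Rightarrow> complex"
  assumes fm [measurable]: "f \<in> borel_measurable borel" and f2: "integrable lborel (\<lambda>x. (norm (f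
    x))\<^sup>2)"
    and F: "integrable lborel F"
    and lim: "((\<lambda>R. \<integral>\<^sup>+\<xi>. ennreal ((norm (ft (\<lambda>x. indicat_real {-R..R} x *\<^sub>R f x) \<xi> - F \<xi>))\<^sup>2)
      \<partial>lborel) \<longlongrightarrow> 0) at_top"
    and ab: "\<alpha> \<le> \<beta>"
  shows "(LINT x:{\<alpha>..\<beta>}|lborel. f x) = (LINT x:{\<alpha>..\<beta>}|lborel. inv_ft F x)"
proof -
  have Fm [measurable]: "F \<in> borel_measurable borel" using borel_measurable_integrable[OF F] by simp
  define I :: "real \<Rightarrow> real" where "I = indicator {\<alpha>..\<beta>}"
  have [measurable]: "I \<in> borel_measurable borel" unfolding I_def by measurable
  have Ii: "integrable lborel I"
    unfolding I_def by (simp add: integrable_indicator_iff emeasure_lborel_Icc_eq)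
  define \<epsilon> where "\<epsilon> = (\<lambda>n. 1 / real (Suc n))"
  have \<epsilon>: "\<epsilon> n > 0" "\<epsilon> n \<le> 1" for n by (auto simp: \<epsilon>_def)
  have \<epsilon>lim: "\<epsilon> \<longlonglongrightarrow> 0" unfolding \<epsilon>_def by (rule LIMSEQ_Suc[OF lim_1_over_n])
  define M where "M = (\<integral>x. I x \<partial>lborel) + (\<integral>x. (norm (f x))\<^sup>2 \<partial>lborel)"
  have M0: "M \<ge> 0" by (auto simp: M_def I_def
    intro!: add_nonneg_nonneg Bochner_Integration.integral_nonneg)
  have shift: "integrable lborel (\<lambda>a. (norm (f (a + w)))\<^sup>2)"
      "(\<integral>a. (norm (f (a + w)))\<^sup>2 \<partial>lborel) = (\<integral>x. (norm (f x))\<^sup>2 \<partial>lborel)" for w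
    using lborel_integrable_real_affine[OF f2, of 1 w] lborel_integral_real_affine[of 1 "\<lambda>x.
      (norm (f x))\<^sup>2" w]
    by (simp_all add: add.commute)
  have pw: "norm (I a *\<^sub>R f x) \<le> I a + (norm (f x))\<^sup>2" for a x
  proof -
    have "norm (f x) \<le> 1 + (norm (f x))\<^sup>2" by (rule le_one_plus_square)
    then show ?thesis by (auto simp: I_def indicator_def)
  qed
  have Ji: "integrable lborel (\<lambda>a. I a *\<^sub>R f (a + w))" for w
  proof (rule Bochner_Integration.integrable_bound)
    show "integrable lborel (\<lambda>a. I a + (norm (f (a + w)))\<^sup>2)" using Ii shift(1) by simp
    show "AE a in lborel. norm (I a *\<^sub>R f (a + w)) \<le> norm (I a + (norm (f (a + w)))\<^sup>2)"
      using pw abs_ge_self order_trans by (intro AE_I2) (simp only: real_norm_def, blast)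
  qed measurable
  have Jn: "(\<integral>a. norm (I a *\<^sub>R f (a + w)) \<partial>lborel) \<le> M" for w
  proof -
    have "(\<integral>a. norm (I a *\<^sub>R f (a + w)) \<partial>lborel) \<le> (\<integral>a. I a + (norm (f (a + w)))\<^sup>2 \<partial>lborel)"
      using Ji[of w] Ii shift(1) by (intro integral_mono integrable_norm
        Bochner_Integration.integrable_add pw)
    also have "\<dots> = M" using Ii shift by (simp add: M_def)
    finally show ?thesis .
  qed
  define J where "J = (\<lambda>w. \<integral>a. I a *\<^sub>R f (a + w) \<partial>lborel)"
  have Jm [measurable]: "J \<in> borel_measurable borel" unfolding J_def by measurable
  have JM: "norm (J w) \<le> M" for w
    unfolding J_def using order_trans[OF integral_norm_bound Jn] .
  have Jlim: "(\<lambda>n. J (\<epsilon> n * w)) \<longlonglongrightarrow> J 0" for w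
  proof -
    have Je: "J v = (\<integral>x. indicat_real {\<alpha> + v..\<beta> + v} x *\<^sub>R f x \<partial>lborel)" for v
    proof -
      have "(\<integral>x. indicat_real {\<alpha> + v..\<beta> + v} x *\<^sub>R f x \<partial>lborel)
          = (\<integral>a. indicat_real {\<alpha> + v..\<beta> + v} (v + 1 * a) *\<^sub>R f (v + 1 * a) \<partial>lborel)"
        by (subst lborel_integral_real_affine[where c = 1 and t = v]) auto
      also have "\<dots> = J v" unfolding J_def I_def
        by (intro Bochner_Integration.integral_cong) (auto simp: indicator_def add.commute)
      finally show ?thesis by simp
    qed
    have "(\<lambda>n. \<integral>x. indicat_real {\<alpha> + \<epsilon> n * w..\<beta> + \<epsilon> n * w} x *\<^sub>R f x \<partial>lborel)
        \<longlonglongrightarrow> (\<integral>x. indicat_real {\<alpha> + 0..\<beta> + 0} x *\<^sub>R f x \<partial>lborel)"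
    proof (rule integral_dominated_convergence)
      show "integrable lborel (\<lambda>x. norm (indicat_real {\<alpha> - \<bar>w\<bar>..\<beta> + \<bar>w\<bar>} x *\<^sub>R f x))"
        using square_integrable_imp_set_integrable[OF fm f2, of "\<alpha> - \<bar>w\<bar>" "\<beta> + \<bar>w\<bar>"]
        unfolding set_integrable_def by (rule integrable_norm)
      show "AE x in lborel. norm (indicat_real {\<alpha> + \<epsilon> n * w..\<beta> + \<epsilon> n * w} x *\<^sub>R f x)
          \<le> norm (indicat_real {\<alpha> - \<bar>w\<bar>..\<beta> + \<bar>w\<bar>} x *\<^sub>R f x)" for n
      proof (rule AE_I2)
        fix x
        have "\<bar>\<epsilon> n * w\<bar> \<le> \<bar>w\<bar>" using \<epsilon>[of n] by (simp add: abs_mult mult_left_le_one_le)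
        then have "- \<bar>w\<bar> \<le> \<epsilon> n * w" "\<epsilon> n * w \<le> \<bar>w\<bar>" by linarith+
        then show "norm (indicat_real {\<alpha> + \<epsilon> n * w..\<beta> + \<epsilon> n * w} x *\<^sub>R f x)
          \<le> norm (indicat_real {\<alpha> - \<bar>w\<bar>..\<beta> + \<bar>w\<bar>} x *\<^sub>R f x)"
          by (auto simp: indicator_def)
      qed
      show "AE x in lborel. (\<lambda>n. indicat_real {\<alpha> + \<epsilon> n * w..\<beta> + \<epsilon> n * w} x *\<^sub>R f x)
          \<longlonglongrightarrow> indicat_real {\<alpha> + 0..\<beta> + 0} x *\<^sub>R f x"
        using AE_lborel_singleton[of \<alpha>] AE_lborel_singleton[of \<beta>]
      proof eventually_elim
        case (elim x)
        have l: "(\<lambda>n. \<alpha> + \<epsilon> n * w) \<longlonglongrightarrow> \<alpha> + 0 * w" "(\<lambda>n. \<beta> + \<epsilon> n * w) \<longlonglongrightarrow> \<beta> + 0 * w"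
          by (intro tendsto_intros \<epsilon>lim)+
        have "\<forall>\<^sub>F n in sequentially. indicat_real {\<alpha> + \<epsilon> n * w..\<beta> + \<epsilon> n * w} x
          = indicat_real {\<alpha> + 0..\<beta> + 0} x"
        proof -
          consider "x < \<alpha>" | "x > \<beta>" | "\<alpha> < x" "x < \<beta>" using elim by linarith
          then show ?thesis
          proof cases
            case 1
            then show ?thesis using order_tendstoD(1)[OF l(1), of x]
              by (auto elim!: eventually_mono simp: indicator_def)
          next
            case 2
            then show ?thesis using order_tendstoD(2)[OF l(2), of x]
              by (auto elim!: eventually_mono simp: indicator_def)
          next
            case 3
            then have "\<forall>\<^sub>F n in sequentially. \<alpha> + \<epsilon> n * w < x" "\<forall>\<^sub>F n in sequentially. x < \<beta>
              + \<epsilon> n * w"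
              using order_tendstoD(2)[OF l(1), of x] order_tendstoD(1)[OF l(2), of x] by auto
            then show ?thesis
              by eventually_elim (use 3 in \<open>auto simp: indicator_def\<close>)
          qed
        qed
        then show ?case by (intro tendsto_scaleR tendsto_const tendsto_eventually)
      qed
    qed measurable
    then show ?thesis unfolding Je by simp
  qed
  have key: "(\<integral>a. I a *\<^sub>R inv_ft (\<lambda>\<xi>. F \<xi> * of_real (gauss (\<epsilon> n) \<xi>)) a \<partial>lborel)
      = (\<integral>w. std_normal_density w *\<^sub>R J (\<epsilon> n * w) \<partial>lborel)" for n
  proof -
    have "(\<integral>a. I a *\<^sub>R inv_ft (\<lambda>\<xi>. F \<xi> * of_real (gauss (\<epsilon> n) \<xi>)) a \<partial>lborel)
      = (\<integral>a. (\<integral>w. std_normal_density w *\<^sub>R (I a *\<^sub>R f (a + \<epsilon> n * w)) \<partial>lborel) \<partial>lborel)"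
      unfolding plancherel_gauss_identity[OF fm f2 F lim \<epsilon>(1), symmetric]
        integral_scaleR_right[symmetric]
      by (simp add: scaleR_scaleR[symmetric] mult.commute del: integral_scaleR_right scaleR_scaleR)
        (simp add: mult.commute)
    also have "\<dots> = (\<integral>w. (\<integral>a. std_normal_density w *\<^sub>R (I a *\<^sub>R f (a + \<epsilon> n * w)) \<partial>lborel) \<partial>lborel)"
    proof (rule lborel_pair.Fubini_integral, rule lborel_pair.Fubini_integrable)
      show "integrable lborel (\<lambda>w. \<integral>a. norm (case (w, a) of (w, a) \<Rightarrow> std_normal_density w *\<^sub>R (I
        a *\<^sub>R f (a + \<epsilon> n * w))) \<partial>lborel)"
      proof (rule Bochner_Integration.integrable_bound)
        show "integrable lborel (\<lambda>w. M * std_normal_density w)"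
          using std_normal_integral by (intro integrable_mult_right) (auto
            simp: has_bochner_integral_iff)
        show "AE w in lborel. norm (\<integral>a. norm (case (w, a) of (w, a) \<Rightarrow> std_normal_density w *\<^sub>R
          (I a *\<^sub>R f (a + \<epsilon> n * w))) \<partial>lborel)
            \<le> norm (M * std_normal_density w)"
        proof (rule AE_I2)
          fix w
          have "(\<integral>a. norm (case (w, a) of (w, a) \<Rightarrow> std_normal_density w *\<^sub>R (I a *\<^sub>R f (a
            + \<epsilon> n * w))) \<partial>lborel)
              = std_normal_density w * (\<integral>a. norm (I a *\<^sub>R f (a + \<epsilon> n * w)) \<partial>lborel)"
            by (simp add: normal_density_nonneg del: scaleR_scaleR)
          also have "\<bar>\<dots>\<bar> \<le> M * std_normal_density w"
            using mult_right_mono[OF Jn[of "\<epsilon> n * w"] normal_density_nonneg[of 0 1 w]]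
              Bochner_Integration.integral_nonneg[of lborel "\<lambda>a. norm (I a *\<^sub>R f (a + \<epsilon> n * w))"]
            by (simp add: normal_density_nonneg abs_mult mult.commute)
          finally show "norm (\<integral>a. norm (case (w, a) of (w, a) \<Rightarrow> std_normal_density w *\<^sub>R (I a
            *\<^sub>R f (a + \<epsilon> n * w))) \<partial>lborel)
            \<le> norm (M * std_normal_density w)" using M0
              by (simp add: normal_density_nonneg abs_mult)
        qed
      qed measurable
      show "AE w in lborel. integrable lborel (\<lambda>a. case (w, a) of (w, a) \<Rightarrow> std_normal_density w
        *\<^sub>R (I a *\<^sub>R f (a + \<epsilon> n * w)))"
        using Ji by (intro AE_I2) (simp only: prod.case, intro integrable_scaleR_right, blast)
    qed measurable
    also have "\<dots> = (\<integral>w. std_normal_density w *\<^sub>R J (\<epsilon> n * w) \<partial>lborel)"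
      unfolding J_def integral_scaleR_right ..
    finally show ?thesis .
  qed
  have "(\<lambda>n. \<integral>w. std_normal_density w *\<^sub>R J (\<epsilon> n
    * w) \<partial>lborel) \<longlonglongrightarrow> (\<integral>w. std_normal_density w *\<^sub>R J 0 \<partial>lborel)"
  proof (rule integral_dominated_convergence)
    show "integrable lborel (\<lambda>w. M * std_normal_density w)"
      using std_normal_integral by (intro integrable_mult_right) (auto
        simp: has_bochner_integral_iff)
    show "AE w in lborel. (\<lambda>n. std_normal_density w *\<^sub>R J (\<epsilon> n * w)) \<longlonglongrightarrow> std_normal_density w *\<^sub>R J 0"
      by (intro AE_I2 tendsto_intros Jlim)
    show "AE w in lborel. norm (std_normal_density w *\<^sub>R J (\<epsilon> n * w))
      \<le> M * std_normal_density w" for n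
      by (intro AE_I2) (simp add: normal_density_nonneg mult.commute[of M] mult_left_mono JM)
  qed measurable
  also have "(\<integral>w. std_normal_density w *\<^sub>R J 0 \<partial>lborel) = J 0"
    using std_normal_integral by (simp add: has_bochner_integral_iff)
  finally have l1: "(\<lambda>n. \<integral>a. I a *\<^sub>R inv_ft (\<lambda>\<xi>. F \<xi> * of_real (gauss (\<epsilon> n) \<xi>)) a \<partial>lborel) \<longlonglongrightarrow> J 0"
    unfolding key .
  have gF: "norm (F \<xi> * of_real (gauss s \<xi>)) \<le> norm (F \<xi>)" for s \<xi>
    using gauss_bounds[of s \<xi>] by (simp add: norm_mult mult_left_le)
  have l2: "(\<lambda>n. \<integral>a. I a *\<^sub>R inv_ft (\<lambda>\<xi>. F \<xi> * of_real (gauss (\<epsilon> n) \<xi>)) a \<partial>lborel) \<longlonglongrightarrow> (\<integral>a. I a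
    *\<^sub>R inv_ft F a \<partial>lborel)"
  proof (rule integral_dominated_convergence)
    show "integrable lborel (\<lambda>a. I a * (\<integral>\<xi>. norm (F \<xi>) \<partial>lborel))" using Ii by simp
    show "(\<lambda>a. I a *\<^sub>R inv_ft F a) \<in> borel_measurable lborel" unfolding inv_ft_def by measurable
    show "(\<lambda>a. I a *\<^sub>R inv_ft (\<lambda>\<xi>. F \<xi> * of_real (gauss (\<epsilon> n) \<xi>)) a)
      \<in> borel_measurable lborel" for n
      unfolding inv_ft_def by measurable
    show "AE a in lborel. (\<lambda>n. I a *\<^sub>R inv_ft (\<lambda>\<xi>. F \<xi>
      * of_real (gauss (\<epsilon> n) \<xi>)) a) \<longlonglongrightarrow> I a *\<^sub>R inv_ft F a"
      unfolding inv_ft_def ft_def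
    proof (intro AE_I2 tendsto_scaleR tendsto_const tendsto_divide)
      fix a
      show "(\<lambda>n. \<integral>x. phase (- a) x * (F x * of_real (gauss (\<epsilon> n) x)) \<partial>lborel)
        \<longlonglongrightarrow> (\<integral>x. phase (- a) x * F x \<partial>lborel)"
      proof (rule integral_dominated_convergence)
        show "integrable lborel (\<lambda>x. norm (F x))" using F by simp
        show "AE x in lborel. (\<lambda>n. phase (- a) x * (F x * of_real (gauss (\<epsilon> n) x)))
            \<longlonglongrightarrow> phase (- a) x * F x"
        proof (rule AE_I2)
          fix x
          have "(\<lambda>n. gauss (\<epsilon> n) x) \<longlonglongrightarrow> exp (- (0 * x)\<^sup>2 / 2)"
            unfolding gauss_def by (intro tendsto_intros \<epsilon>lim) simp
          then have "(\<lambda>n. phase (- a) x * (F x * of_real (gauss (\<epsilon> n) x)))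
            \<longlonglongrightarrow> phase (- a) x * (F x * of_real (exp (- (0 * x)\<^sup>2 / 2)))"
            by (intro tendsto_mult tendsto_const tendsto_of_real)
          then show "(\<lambda>n. phase (- a) x * (F x * of_real (gauss (\<epsilon> n) x)))
            \<longlonglongrightarrow> phase (- a) x * F x" by simp
        qed
        show "AE x in lborel. norm (phase (- a) x * (F x * of_real (gauss (\<epsilon> n) x)))
          \<le> norm (F x)" for n
          using gF[of _ "\<epsilon> n"] by (simp only: norm_mult norm_cis_exp mult_1 AE_I2)
      qed measurable
    qed simp
    show "AE a in lborel. norm (I a *\<^sub>R inv_ft (\<lambda>\<xi>. F \<xi> * of_real (gauss (\<epsilon> n) \<xi>)) a)
      \<le> I a * (\<integral>\<xi>. norm (F \<xi>) \<partial>lborel)" for n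
    proof (rule AE_I2)
      fix a
      have i: "integrable lborel (\<lambda>\<xi>. F \<xi> * of_real (gauss (\<epsilon> n) \<xi>))"
        by (rule Bochner_Integration.integrable_bound[OF F]) (use gF in auto)
      have "norm (inv_ft (\<lambda>\<xi>. F \<xi> * of_real (gauss (\<epsilon> n) \<xi>)) a)
        \<le> norm (ft (\<lambda>\<xi>. F \<xi> * of_real (gauss (\<epsilon> n) \<xi>)) (- a)) / 1"
        unfolding inv_ft_def norm_divide using pi_ge_two by (intro divide_left_mono) auto
      also have "\<dots> \<le> (\<integral>\<xi>. norm (F \<xi> * of_real (gauss (\<epsilon> n) \<xi>)) \<partial>lborel)" using norm_ft_le by simp
      also have "\<dots> \<le> (\<integral>\<xi>. norm (F \<xi>) \<partial>lborel)"
        using F i by (intro integral_mono integrable_norm gF)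
      finally show "norm (I a *\<^sub>R inv_ft (\<lambda>\<xi>. F \<xi> * of_real (gauss (\<epsilon> n) \<xi>)) a)
        \<le> I a * (\<integral>\<xi>. norm (F \<xi>) \<partial>lborel)"
        by (auto simp: I_def indicator_def)
    qed
  qed
  have "J 0 = (\<integral>a. I a *\<^sub>R inv_ft F a \<partial>lborel)" by (rule LIMSEQ_unique[OF l1 l2])
  then show ?thesis by (simp add: J_def I_def set_lebesgue_integral_def)
qed

section \<open>Integrals over low and high frequencies\<close>

lemma integrable_inverse_one_plus_square: "integrable lborel (\<lambda>x :: real. inverse (1 + x\<^sup>2))"
  using integrable_inverse_1_plus_square by (simp add: set_integrable_def einterval_def)

text \<open>A single term of the exponential series is at most the whole sum.\<close>

lemma power_exp_le:
  fixes c x :: real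
  assumes "c > 0" "x \<ge> 0"
  shows "x ^ n * exp (- (c * x)) \<le> fact n / c ^ n"
proof -
  have "(c * x) ^ n / fact n \<le> exp (c * x)"
  proof -
    have "(\<Sum>k\<in>{n}. (c * x) ^ k /\<^sub>R fact k) \<le> (\<Sum>k. (c * x) ^ k /\<^sub>R fact k)"
      using assms by (intro sum_le_suminf summable_exp_generic) auto
    then show ?thesis by (simp add: exp_def divide_inverse mult.commute)
  qed
  then have "(c * x) ^ n / fact n * exp (- (c * x)) \<le> exp (c * x) * exp (- (c * x))"
    by (intro mult_right_mono) auto
  then have "(c * x) ^ n / fact n * exp (- (c * x)) \<le> 1" by (simp add: exp_minus)
  then show ?thesis using assms by (simp add: power_mult_distrib field_simps)
qed

lemma moment_stretched_exp_finite:
  assumes c: "c > 0" and p: "p > 0"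
  shows "(\<integral>\<^sup>+x. ennreal (x ^ (2 * j) * exp (- (c * \<bar>x\<bar> ^ p))) \<partial>lborel) < \<infinity>"
proof -
  define B where "B = 2 + fact (2 * j) / c ^ (2 * j) + fact (2 * j + 2) / c ^ (2 * j + 2)"
  have B: "B \<ge> 0" using c unfolding B_def by (intro add_nonneg_nonneg divide_nonneg_nonneg) auto
  have "x ^ (2 * j) * exp (- (c * \<bar>x\<bar> ^ p)) \<le> B * inverse (1 + x\<^sup>2)" for x :: real
  proof -
    have "x ^ (2 * j) * (1 + x\<^sup>2) * exp (- (c * \<bar>x\<bar> ^ p)) \<le> B"
    proof (cases "\<bar>x\<bar> \<le> 1")
      case True
      have "x ^ (2 * j) * (1 + x\<^sup>2) * exp (- (c * \<bar>x\<bar> ^ p)) \<le> 1 * (1 + 1) * 1"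
        using True c power_le_one[of "\<bar>x\<bar>" "2 * j"] power_le_one[of "\<bar>x\<bar>" 2]
        by (intro mult_mono add_mono) (auto simp: power_even_abs)
      also have "\<dots> \<le> B" using c unfolding B_def by (auto intro!: add_increasing2 add_nonneg_nonneg)
      finally show ?thesis .
    next
      case False
      then have "\<bar>x\<bar> ^ 1 \<le> \<bar>x\<bar> ^ p" using p by (intro power_increasing) auto
      then have "exp (- (c * \<bar>x\<bar> ^ p)) \<le> exp (- (c * \<bar>x\<bar>))" using c by simp
      then have "x ^ (2 * j) * (1 + x\<^sup>2) * exp (- (c * \<bar>x\<bar> ^ p))
        \<le> x ^ (2 * j) * (1 + x\<^sup>2) * exp (- (c * \<bar>x\<bar>))"
        by (intro mult_left_mono) auto
      also have "\<dots> = \<bar>x\<bar> ^ (2 * j) * exp (- (c * \<bar>x\<bar>)) + \<bar>x\<bar> ^ (2 * j + 2) * exp (- (c * \<bar>x\<bar>))"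
        by (simp add: power_even_abs power_add algebra_simps power2_eq_square)
      also have "\<dots> \<le> fact (2 * j) / c ^ (2 * j) + fact (2 * j + 2) / c ^ (2 * j + 2)"
        using c by (intro add_mono power_exp_le) auto
      also have "\<dots> \<le> B" by (simp add: B_def)
      finally show ?thesis .
    qed
    then show ?thesis by (simp add: field_simps add_pos_nonneg)
  qed
  then have "(\<integral>\<^sup>+x. ennreal (x ^ (2 * j) * exp (- (c * \<bar>x\<bar> ^ p))) \<partial>lborel)
      \<le> (\<integral>\<^sup>+x. ennreal (B * inverse (1 + x\<^sup>2)) \<partial>lborel)"
    by (intro nn_integral_mono ennreal_leI)
  also have "\<dots> = ennreal (\<integral>x. B * inverse (1 + x\<^sup>2) \<partial>lborel)"
    using B integrable_inverse_one_plus_square by (intro nn_integral_eq_integral) auto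
  also have "\<dots> < \<infinity>" by simp
  finally show ?thesis .
qed

text \<open>Passing from \<open>t\<close> to \<open>1 + t\<close> costs only the factor
  \<open>exp c\<close> because \<open>y \<le> 1\<close>. This gives powers of \<open>1 + t\<close>,
  which stay bounded down to \<open>t = 0\<close>.\<close>

lemma exp_shift_bound:
  fixes c y t :: real
  assumes "c > 0" "0 \<le> y" "y \<le> 1"
  shows "exp (- c * y * t) \<le> exp c * exp (- (c * ((1 + t) * y)))"
proof -
  have "- c * y * t \<le> c + - (c * ((1 + t) * y))" using assms by (simp add: algebra_simps)
  then show ?thesis by (simp add: exp_add[symmetric])
qed

text \<open>The cut-off at \<open>1\<close> pays for replacing \<open>t\<close> by
  \<open>1 + t\<close>; then the integral is extended to the whole line. The substitution
  \<open>x = T * \<xi>\<close> with \<open>T ^ p = 1 + t\<close> makes the exponential independent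
  of \<open>t\<close>, and the moment together with the measure contributes \<open>2 * j + 1\<close>
  factors \<open>1 / T\<close>.\<close>

lemma low_frequency_integral:
  assumes c: "c > 0" and p: "p > 0"
  obtains K where "K > 0" "\<And>t. t \<ge> 0 \<Longrightarrow>
    (\<integral>\<^sup>+\<xi>. ennreal (indicator {-1..1} \<xi> * (\<xi> ^ (2 * j) * exp (- c * \<bar>\<xi>\<bar> ^ p * t))) \<partial>lborel)
      \<le> ennreal (K * (1 + t) powr (- (2 * real j + 1) / real p))"
proof -
  define I where "I = enn2real (\<integral>\<^sup>+x. ennreal (x ^ (2 * j) * exp (- (c * \<bar>x\<bar> ^ p))) \<partial>lborel)"
  have I: "(\<integral>\<^sup>+x. ennreal (x ^ (2 * j) * exp (- (c * \<bar>x\<bar> ^ p))) \<partial>lborel) = ennreal I" "I \<ge> 0"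
    using moment_stretched_exp_finite[OF c p, of j] by (auto simp: I_def less_top)
  show ?thesis
  proof (rule that[of "exp c * (I + 1)"])
    show "exp c * (I + 1) > 0" using I(2) by simp
    fix t :: real assume t: "t \<ge> 0"
    define T where "T = (1 + t) powr (1 / real p)"
    have T: "T > 0" using t by (simp add: T_def)
    have Tp: "T ^ p = 1 + t"
      using t p by (simp add: T_def powr_realpow[symmetric] powr_powr)
    have "(\<integral>\<^sup>+\<xi>. ennreal (indicator {-1..1} \<xi> * (\<xi> ^ (2 * j) * exp (- c * \<bar>\<xi>\<bar> ^ p * t))) \<partial>lborel)
      \<le> (\<integral>\<^sup>+\<xi>. ennreal (exp c) * ennreal (\<xi> ^ (2 * j) * exp (- (c * \<bar>T * \<xi>\<bar> ^ p))) \<partial>lborel)"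
    proof (intro nn_integral_mono)
      fix \<xi> :: real
      have "indicator {-1..1} \<xi> * (\<xi> ^ (2 * j) * exp (- c * \<bar>\<xi>\<bar> ^ p * t))
          \<le> exp c * (\<xi> ^ (2 * j) * exp (- (c * \<bar>T * \<xi>\<bar> ^ p)))"
      proof (cases "\<bar>\<xi>\<bar> \<le> 1")
        case True
        have "exp (- c * \<bar>\<xi>\<bar> ^ p * t) \<le> exp c * exp (- (c * ((1 + t) * \<bar>\<xi>\<bar> ^ p)))"
          using True by (intro exp_shift_bound c power_le_one) auto
        also have "(1 + t) * \<bar>\<xi>\<bar> ^ p = \<bar>T * \<xi>\<bar> ^ p" using T
          by (simp add: abs_mult power_mult_distrib Tp)
        finally have "\<xi> ^ (2 * j) * exp (- c * \<bar>\<xi>\<bar> ^ p * t)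
          \<le> \<xi> ^ (2 * j) * (exp c * exp (- (c * \<bar>T * \<xi>\<bar> ^ p)))"
          by (intro mult_left_mono) auto
        then show ?thesis using True by (simp add: indicator_def abs_le_iff mult_ac)
      qed (auto simp: indicator_def)
      then show "ennreal (indicator {-1..1} \<xi> * (\<xi> ^ (2 * j) * exp (- c * \<bar>\<xi>\<bar> ^ p * t)))
        \<le> ennreal (exp c) * ennreal (\<xi> ^ (2 * j) * exp (- (c * \<bar>T * \<xi>\<bar> ^ p)))"
        by (simp add: ennreal_mult[symmetric] ennreal_leI)
    qed
    also have "\<dots> = ennreal (exp c) * (\<integral>\<^sup>+\<xi>. ennreal (\<xi> ^ (2 * j) * exp (- (c * \<bar>T
      * \<xi>\<bar> ^ p))) \<partial>lborel)"
      by (intro nn_integral_cmult) measurable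
    also have "(\<integral>\<^sup>+\<xi>. ennreal (\<xi> ^ (2 * j) * exp (- (c * \<bar>T * \<xi>\<bar> ^ p))) \<partial>lborel)
        = ennreal \<bar>1 / T\<bar> * (\<integral>\<^sup>+x. ennreal ((0 + 1 / T * x) ^ (2 * j) * exp (- (c * \<bar>T * (0
          + 1 / T * x)\<bar> ^ p))) \<partial>lborel)"
      using T by (intro nn_integral_real_affine) auto
    also have "\<dots> = ennreal (1 / T) * (\<integral>\<^sup>+x. ennreal ((1 / T) ^ (2 * j)) * ennreal (x ^ (2 * j)
      * exp (- (c * \<bar>x\<bar> ^ p))) \<partial>lborel)"
      using T by (simp add: ennreal_mult[symmetric] power_mult_distrib power_divide mult.assoc)
    also have "\<dots> = ennreal (1 / T) * (ennreal ((1 / T) ^ (2 * j)) * ennreal I)"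
      unfolding I(1)[symmetric] by (subst nn_integral_cmult) auto
    also have "ennreal (exp c) * \<dots> = ennreal (exp c * I * (1 / T) ^ (2 * j + 1))"
      using T I(2) by (simp add: ennreal_mult[symmetric] mult_ac)
    also have "(1 / T) ^ (2 * j + 1) = (1 + t) powr (- (2 * real j + 1) / real p)"
    proof -
      have "1 / T = (1 + t) powr (- (1 / real p))" by (simp add: T_def powr_minus_divide)
      then have "(1 / T) ^ (2 * j + 1) = ((1 + t) powr (- (1 / real p))) powr real (2 * j + 1)"
        using t by (subst powr_realpow) auto
      also have "\<dots> = (1 + t) powr (- (2 * real j + 1) / real p)"
        unfolding powr_powr by (simp add: algebra_simps add_divide_distrib diff_divide_distrib)
      finally show ?thesis .
    qed
    also have "exp c * I * (1 + t) powr (- (2 * real j + 1) / real p)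
      \<le> exp c * (I + 1) * (1 + t) powr (- (2 * real j + 1) / real p)"
      by (intro mult_right_mono mult_left_mono) auto
    finally show "(\<integral>\<^sup>+\<xi>. ennreal (indicator {-1..1} \<xi> * (\<xi> ^ (2 * j) * exp (- c * \<bar>\<xi>\<bar> ^ p
      * t))) \<partial>lborel)
      \<le> ennreal (exp c * (I + 1) * (1 + t) powr (- (2 * real j + 1) / real p))"
      by (simp add: ennreal_leI)
  qed
qed

text \<open>For \<open>z = (1 + t) / |\<xi>| ^ q\<close> and \<open>s = 2 * l / q\<close>, the
  function \<open>z powr s * exp (- c * z)\<close> is bounded, and \<open>z powr (- s)\<close> is
  the product of a power of \<open>1 + t\<close> with \<open>\<xi> ^ (2 * l)\<close>. The real
  exponent is reduced to an integer one by \<open>z powr s \<le> 1 + z ^ (2 * l)\<close>.\<close>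

lemma high_frequency_bound:
  assumes c: "c > 0" and q: "q > 0"
  obtains K where "K > 0" "\<And>\<xi> t. \<bar>\<xi>\<bar> \<ge> 1 \<Longrightarrow> t \<ge> 0 \<Longrightarrow>
    exp (- c * (1 / \<bar>\<xi>\<bar> ^ q) * t) \<le> K * (1 + t) powr (- (2 * real l) / real q) * \<xi> ^ (2 * l)"
proof (rule that[of "exp c * (1 + fact (2 * l) / c ^ (2 * l))"])
  show "exp c * (1 + fact (2 * l) / c ^ (2 * l)) > 0" using c by (simp add: add_pos_nonneg)
  fix \<xi> t :: real assume \<xi>: "\<bar>\<xi>\<bar> \<ge> 1" and t: "t \<ge> 0"
  define y where "y = 1 / \<bar>\<xi>\<bar> ^ q"
  define s where "s = 2 * real l / real q"
  define z where "z = (1 + t) * y"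
  have y: "0 < y" "y \<le> 1" using \<xi> by (auto simp: y_def divide_le_eq intro: one_le_power)
  have z: "z > 0" using y t by (simp add: z_def)
  have "s \<le> 2 * real l" using q by (simp add: s_def divide_le_eq mult_ge1_I mult_le_cancel_left1)
  have zs: "z powr s \<le> 1 + z ^ (2 * l)"
  proof (cases "z \<le> 1")
    case True
    then have "z powr s \<le> 1" using z by (intro powr_le1) (auto simp: s_def)
    then show ?thesis using z by (simp add: add_increasing2)
  next
    case False
    then have "z powr s \<le> z powr (2 * real l)" using \<open>s \<le> 2 * real l\<close> by (intro powr_mono) auto
    also have "\<dots> = z ^ (2 * l)" using z by (simp add: powr_realpow[symmetric])
    finally show ?thesis by simp
  qed
  have "z powr s * exp (- (c * z)) \<le> (1 + z ^ (2 * l)) * exp (- (c * z))"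
    by (intro mult_right_mono zs) auto
  also have "\<dots> = exp (- (c * z)) + z ^ (2 * l) * exp (- (c * z))" by (simp add: algebra_simps)
  also have "\<dots> \<le> 1 + fact (2 * l) / c ^ (2 * l)"
    using z c by (intro add_mono power_exp_le) auto
  finally have b: "z powr s * exp (- (c * z)) \<le> 1 + fact (2 * l) / c ^ (2 * l)" .
  have ys: "y powr (- s) = \<xi> ^ (2 * l)"
  proof -
    have "y powr (- s) = (\<bar>\<xi>\<bar> ^ q) powr s"
      by (simp add: y_def powr_minus powr_divide)
    also have "\<dots> = (\<bar>\<xi>\<bar> powr real q) powr s" using \<xi> by (subst powr_realpow) auto
    also have "\<dots> = \<bar>\<xi>\<bar> powr real (2 * l)" using q by (simp add: powr_powr s_def)
    also have "\<dots> = \<bar>\<xi>\<bar> ^ (2 * l)" using \<xi> by (subst powr_realpow) auto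
    finally show ?thesis by (simp add: power_even_abs)
  qed
  have "exp (- c * y * t) \<le> exp c * exp (- (c * z))"
    unfolding z_def using y by (intro exp_shift_bound c) auto
  also have "exp (- (c * z)) = (z powr s * exp (- (c * z))) * z powr (- s)"
    using z by (simp add: powr_minus)
  also have "exp c * \<dots> \<le> exp c * ((1 + fact (2 * l) / c ^ (2 * l)) * z powr (- s))"
    by (intro mult_left_mono mult_right_mono b) auto
  also have "z powr (- s) = (1 + t) powr (- s) * y powr (- s)"
    unfolding z_def using t y by (simp add: powr_mult)
  finally show "exp (- c * (1 / \<bar>\<xi>\<bar> ^ q) * t)
      \<le> exp c * (1 + fact (2 * l) / c ^ (2 * l)) * (1
        + t) powr (- (2 * real l) / real q) * \<xi> ^ (2 * l)"
    unfolding ys by (simp add: y_def s_def mult_ac)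
qed

section \<open>The Fourier transform and weak derivatives of vector-valued functions\<close>

lemma borel_measurable_vec_nth [measurable (raw)]:
  fixes f :: "'a \<Rightarrow> complex ^ 'n"
  assumes "f \<in> borel_measurable M" shows "(\<lambda>x. f x $ i) \<in> borel_measurable M"
  by (rule measurable_compose[OF assms borel_measurable_continuous_onI[OF
          linear_continuous_on[OF bounded_linear_vec_nth]]])

lemma borel_measurable_vecI:
  fixes f :: "'a \<Rightarrow> complex ^ 'n"
  assumes [measurable]: "\<And>i. (\<lambda>x. f x $ i) \<in> borel_measurable M" shows "f \<in> borel_measurable M"
  unfolding borel_measurable_euclidean_space[where f = f]
  by (auto simp: Basis_vec_def inner_axis)

lemma norm_square_vec: "(norm (v :: complex ^ 'n))\<^sup>2 = (\<Sum>i\<in>UNIV. (norm (v $ i))\<^sup>2)"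
  by (simp add: norm_vec_def L2_set_def sum_nonneg)

lemma nn_integral_weighted_norm_square_vec:
  fixes h :: "real \<Rightarrow> complex ^ 'n"
  assumes [measurable]: "h \<in> borel_measurable borel" "w
    \<in> borel_measurable borel" and w: "\<And>x. w x \<ge> 0"
  shows "(\<integral>\<^sup>+x. ennreal (w x * (norm (h x))\<^sup>2) \<partial>lborel)
    = (\<Sum>i\<in>UNIV. \<integral>\<^sup>+x. ennreal (w x * (norm (h x $ i))\<^sup>2) \<partial>lborel)"
proof -
  have "ennreal (w x * (norm (h x))\<^sup>2) = (\<Sum>i\<in>UNIV. ennreal (w x * (norm (h x $ i))\<^sup>2))" for x
    unfolding norm_square_vec sum_distrib_left using w by (subst sum_ennreal) auto
  then show ?thesis by (simp add: nn_integral_sum)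
qed

lemma norm_smult_vec: "norm (c *s (v :: complex ^ 'n)) = norm c * norm v"
  by (simp add: norm_vec_def norm_mult L2_set_right_distrib)

lemma integrable_phase_vec:
  fixes f :: "real \<Rightarrow> complex ^ 8"
  assumes "integrable lborel f"
  shows "integrable lborel (\<lambda>x. phase \<xi> x *s f x)"
proof (rule Bochner_Integration.integrable_bound[OF assms])
  have [measurable]: "f \<in> borel_measurable borel" using borel_measurable_integrable[OF assms]
    by simp
  show "(\<lambda>x. phase \<xi> x *s f x) \<in> borel_measurable lborel"
    by (rule borel_measurable_vecI) simp
qed (simp add: norm_smult_vec)

lemma fourier_nth:
  assumes "integrable lborel f"
  shows "fourier f \<xi> $ i = ft (\<lambda>x. f x $ i) \<xi>"
  unfolding fourier_def ft_def
  by (subst integral_bounded_linear[OF bounded_linear_vec_nth integrable_phase_vec[OF assms],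
    symmetric]) simp

lemma norm_fourier_le:
  assumes "integrable lborel f" shows "norm (fourier f \<xi>) \<le> L1_norm f"
  unfolding fourier_def L1_norm_def
  by (rule order_trans[OF integral_norm_bound]) (simp add: norm_smult_vec)

lemma integrable_vec_nth:
  "integrable M f \<Longrightarrow> integrable M (\<lambda>x. f x $ i)" for f :: "'a \<Rightarrow> complex ^ 'n"
  by (rule integrable_bounded_linear[OF bounded_linear_vec_nth])

lemma fourier_measurable [measurable]:
  assumes "integrable lborel f" shows "fourier f \<in> borel_measurable borel"
proof (rule borel_measurable_vecI)
  have [measurable]: "f \<in> borel_measurable borel" using borel_measurable_integrable[OF assms]
    by simp
  show "(\<lambda>\<xi>. fourier f \<xi> $ i) \<in> borel_measurable borel" for i
    unfolding fourier_nth[OF assms] by measurable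
qed

lemma set_integrable_vec_nth:
  fixes f :: "real \<Rightarrow> complex ^ 8"
  assumes "locally_integrable f" shows "set_integrable lborel {a..b} (\<lambda>x. f x $ i)"
  using integrable_vec_nth[of lborel "\<lambda>x. indicat_real {a..b} x *\<^sub>R f x" i] assms
  by (simp add: locally_integrable_def set_integrable_def)

lemma integral_test_function_nth:
  fixes f :: "real \<Rightarrow> complex ^ 8"
  assumes "test_function \<phi>" "locally_integrable f"
  shows "(\<integral>x. \<phi> x *\<^sub>R f x \<partial>lborel) $ i = (\<integral>x. \<phi> x *\<^sub>R (f x $ i) \<partial>lborel)"
  using integral_bounded_linear[OF bounded_linear_vec_nth integrable_test_function_mult[OF
    assms(1), of f], of i] assms(2)
  by (simp add: locally_integrable_def)

lemma square_integrable_imp_locally_integrable: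
  "square_integrable f \<Longrightarrow> locally_integrable f"
  using square_integrable_imp_set_integrable[of f]
  by (simp add: square_integrable_def locally_integrable_def)

proposition fourier_weak_deriv_bound:
  assumes f: "integrable lborel f" and w: "has_weak_deriv m f g"
  shows "(\<integral>\<^sup>+\<xi>. ennreal (\<xi> ^ (2 * m) * (norm (fourier f \<xi>))\<^sup>2) \<partial>lborel)
    \<le> ennreal (2 * pi) * l2_sq g"
proof -
  have l: "locally_integrable f" "locally_integrable g" using w by (auto simp: has_weak_deriv_def)
  have [measurable]: "g \<in> borel_measurable borel" by (rule locally_integrable_measurable[OF l(2)])
  have b: "(\<integral>\<^sup>+\<xi>. ennreal (\<xi> ^ (2 * m) * (norm (ft (\<lambda>x. f x $ i) \<xi>))\<^sup>2) \<partial>lborel)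
      \<le> ennreal (2 * pi) * (\<integral>\<^sup>+x. ennreal ((norm (g x $ i))\<^sup>2) \<partial>lborel)" for i
  proof (rule ft_weak_derivative_bound)
    show "integrable lborel (\<lambda>x. f x $ i)" by (rule integrable_vec_nth[OF f])
    show "set_integrable lborel {a..b} (\<lambda>x. g x $ i)" for a b
      by (rule set_integrable_vec_nth[OF l(2)])
    fix \<phi> assume t: "test_function \<phi>"
    have "(\<integral>x. (deriv ^^ m) \<phi> x *\<^sub>R f x \<partial>lborel) = (- 1) ^ m *\<^sub>R (\<integral>x. \<phi> x *\<^sub>R g x \<partial>lborel)"
      using w t by (simp add: has_weak_deriv_def)
    then have "(\<integral>x. (deriv ^^ m) \<phi> x *\<^sub>R f x \<partial>lborel) $ i
      = (- 1) ^ m *\<^sub>R (\<integral>x. \<phi> x *\<^sub>R g x \<partial>lborel) $ i"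
      by simp
    then show "(\<integral>x. (deriv ^^ m) \<phi> x *\<^sub>R (f x $ i) \<partial>lborel)
      = (- 1) ^ m *\<^sub>R (\<integral>x. \<phi> x *\<^sub>R (g x $ i) \<partial>lborel)"
      unfolding integral_test_function_nth[OF t l(2)]
        integral_test_function_nth[OF test_function_funpow_deriv[OF t] l(1)] .
  qed measurable
  note [measurable] = fourier_measurable[OF f]
  have "(\<integral>\<^sup>+\<xi>. ennreal (\<xi> ^ (2 * m) * (norm (fourier f \<xi>))\<^sup>2) \<partial>lborel)
      = (\<Sum>i\<in>UNIV. \<integral>\<^sup>+\<xi>. ennreal (\<xi> ^ (2 * m) * (norm (ft (\<lambda>x. f x $ i) \<xi>))\<^sup>2) \<partial>lborel)"
    by (subst nn_integral_weighted_norm_square_vec) (simp_all add: fourier_nth[OF f])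
  also have "\<dots> \<le> (\<Sum>i\<in>UNIV. ennreal (2 * pi) * (\<integral>\<^sup>+x. ennreal ((norm (g x $ i))\<^sup>2) \<partial>lborel))"
    by (intro sum_mono b)
  also have "\<dots> = ennreal (2 * pi) * (\<integral>\<^sup>+x. ennreal (1 * (norm (g x))\<^sup>2) \<partial>lborel)"
    by (subst nn_integral_weighted_norm_square_vec) (simp_all add: sum_distrib_left)
  finally show ?thesis by simp
qed

text \<open>The moment of order \<open>Suc n\<close> ensures integrability: with
  \<open>A = 1 + \<xi>\<^sup>2\<close> one has \<open>x \<le> 1 / A + A * x\<^sup>2\<close>, so
  finiteness of two consecutive moments makes \<open>\<xi> ^ m * F\<close> integrable for
  \<open>m \<le> n\<close>. The inverse integrals \<open>h m\<close> are then the candidates for the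
  derivatives.\<close>

proposition L2_fourier_weak_deriv:
  assumes u: "has_L2_fourier u F"
    and fin: "\<And>m. m \<le> Suc n \<Longrightarrow> (\<integral>\<^sup>+\<xi>. ennreal (\<xi> ^ (2 * m) * (norm (F \<xi>))\<^sup>2) \<partial>lborel) < \<infinity>"
  obtains h where "square_integrable h" "has_weak_deriv n u h"
    "l2_sq h
      \<le> ennreal (1 / (2 * pi)) * (\<integral>\<^sup>+\<xi>. ennreal (\<xi> ^ (2 * n) * (norm (F \<xi>))\<^sup>2) \<partial>lborel)"
proof -
  have um [measurable]: "u \<in> borel_measurable borel" and Fm [measurable]: "F
    \<in> borel_measurable borel"
    and u2: "square_integrable u"
    and lim: "((\<lambda>R. \<integral>\<^sup>+\<xi>. ennreal ((norm (fourier (\<lambda>x. indicat_real {- R..R} x *\<^sub>R u x) \<xi> - F \<xi>))\<^sup>2)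
        \<partial>lborel) \<longlongrightarrow> 0) at_top"
    using u by (auto simp: has_L2_fourier_def square_integrable_def)
  have lu: "locally_integrable u" by (rule square_integrable_imp_locally_integrable[OF u2])
  define G where "G = (\<lambda>m i \<xi>. (\<i> * complex_of_real \<xi>) ^ m * F \<xi> $ i)"
  have [measurable]: "G m i \<in> borel_measurable borel" for m i unfolding G_def by measurable
  have nG: "(norm (G m i \<xi>))\<^sup>2 = \<xi> ^ (2 * m) * (norm (F \<xi> $ i))\<^sup>2" for m i \<xi>
    by (simp add: G_def norm_mult norm_power power_mult_distrib power_mult[symmetric]
      mult.commute[of m] power_even_abs)
  have comp: "(norm (F \<xi> $ i))\<^sup>2 \<le> (norm (F \<xi>))\<^sup>2" for \<xi> i
    by (intro power_mono Finite_Cartesian_Product.norm_nth_le) auto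
  have Gi: "integrable lborel (G m i)" if m: "m \<le> n" for m i
  proof (rule integrableI_bounded)
    have "(\<integral>\<^sup>+\<xi>. ennreal (norm (G m i \<xi>)) \<partial>lborel)
      \<le> (\<integral>\<^sup>+\<xi>. ennreal (inverse (1 + \<xi>\<^sup>2)) + (ennreal (\<xi> ^ (2 * m) * (norm (F \<xi>))\<^sup>2)
          + ennreal (\<xi> ^ (2 * Suc m) * (norm (F \<xi>))\<^sup>2)) \<partial>lborel)"
    proof (intro nn_integral_mono)
      fix \<xi> :: real
      define x where "x = norm (G m i \<xi>)"
      define A where "A = 1 + \<xi>\<^sup>2"
      have A: "A > 0" by (simp add: A_def add_pos_nonneg)
      have "x \<le> inverse A + A * x\<^sup>2"
      proof (cases "A * x \<le> 1")
        case True
        then have "x \<le> inverse A" using A by (simp add: field_simps)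
        then show ?thesis using A by (simp add: add_increasing2)
      next
        case False
        then have "1 * x \<le> (A * x) * x" by (intro mult_right_mono) (auto simp: x_def)
        then show ?thesis using A by (simp add: power2_eq_square mult.assoc add_increasing)
      qed
      also have "A * x\<^sup>2 \<le> A * (\<xi> ^ (2 * m) * (norm (F \<xi>))\<^sup>2)"
        unfolding x_def nG using A comp by (intro mult_left_mono) auto
      also have "\<dots> = \<xi> ^ (2 * m) * (norm (F \<xi>))\<^sup>2 + \<xi> ^ (2 * Suc m) * (norm (F \<xi>))\<^sup>2"
        by (simp add: A_def algebra_simps power2_eq_square)
      finally have "ennreal (norm (G m i \<xi>)) \<le> ennreal (inverse (1 + \<xi>\<^sup>2)
        + (\<xi> ^ (2 * m) * (norm (F \<xi>))\<^sup>2
          + \<xi> ^ (2 * Suc m) * (norm (F \<xi>))\<^sup>2))"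
        by (intro ennreal_leI) (simp add: x_def A_def)
      also have "\<dots> = ennreal (inverse (1 + \<xi>\<^sup>2)) + (ennreal (\<xi> ^ (2 * m) * (norm (F \<xi>))\<^sup>2)
          + ennreal (\<xi> ^ (2 * Suc m) * (norm (F \<xi>))\<^sup>2))"
      proof -
        have e: "ennreal (a + (b + c)) = ennreal a + (ennreal b + ennreal c)" if "0 \<le> a" "0
          \<le> b" "0 \<le> c" for a b c :: real
          using that by simp
        then show ?thesis
          using A by (intro e mult_nonneg_nonneg zero_le_even_power zero_le_power2) (simp_all
            add: A_def)
      qed
      finally show "ennreal (norm (G m i \<xi>)) \<le> ennreal (inverse (1 + \<xi>\<^sup>2))
        + (ennreal (\<xi> ^ (2 * m) * (norm (F \<xi>))\<^sup>2)
          + ennreal (\<xi> ^ (2 * Suc m) * (norm (F \<xi>))\<^sup>2))" .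
    qed
    also have "\<dots> = (\<integral>\<^sup>+\<xi>. ennreal (inverse (1 + \<xi>\<^sup>2)) \<partial>lborel)
      + ((\<integral>\<^sup>+\<xi>. ennreal (\<xi> ^ (2 * m) * (norm (F \<xi>))\<^sup>2) \<partial>lborel)
          + (\<integral>\<^sup>+\<xi>. ennreal (\<xi> ^ (2 * Suc m) * (norm (F \<xi>))\<^sup>2) \<partial>lborel))"
      by (subst nn_integral_add, simp, simp, subst nn_integral_add) auto
    also have "\<dots> < \<infinity>"
      using fin[of m] fin[of "Suc m"] m integrable_inverse_one_plus_square
      by (subst nn_integral_eq_integral) (auto simp: less_top[symmetric])
    finally show "(\<integral>\<^sup>+\<xi>. ennreal (norm (G m i \<xi>)) \<partial>lborel) < \<infinity>" .
  qed measurable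
  define h where "h = (\<lambda>m x. \<chi> i. inv_ft (G m i) x)"
  have hm [measurable]: "h m \<in> borel_measurable borel" for m
  proof (rule borel_measurable_vecI)
    fix i
    have "(\<lambda>x. ft (G m i) (- x) / of_real (2 * pi)) \<in> borel_measurable borel" by measurable
    then show "(\<lambda>x. h m x $ i) \<in> borel_measurable borel"
      by (simp only: h_def inv_ft_def vec_lambda_beta)
  qed
  have hb: "l2_sq (h m)
      \<le> ennreal (1 / (2 * pi)) * (\<integral>\<^sup>+\<xi>. ennreal (\<xi> ^ (2 * m)
        * (norm (F \<xi>))\<^sup>2) \<partial>lborel)" if m: "m \<le> n" for m
  proof -
    have "(\<integral>\<^sup>+x. ennreal (1 * (norm (h m x))\<^sup>2) \<partial>lborel)
      = (\<Sum>i\<in>UNIV. \<integral>\<^sup>+x. ennreal ((norm (inv_ft (G m i) x))\<^sup>2) \<partial>lborel)"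
      by (subst nn_integral_weighted_norm_square_vec[OF hm]) (simp_all add: h_def)
    also have "\<dots> \<le> (\<Sum>i\<in>UNIV. ennreal (1 / (2 * pi)) * l2_sq (G m i))"
      by (intro sum_mono inv_ft_bessel Gi m)
    also have "\<dots> = ennreal (1 / (2 * pi)) * (\<integral>\<^sup>+\<xi>. ennreal (\<xi> ^ (2 * m) * (norm (F \<xi>))\<^sup>2) \<partial>lborel)"
      unfolding nG by (subst nn_integral_weighted_norm_square_vec) (simp_all add: sum_distrib_left)
    finally show ?thesis by simp
  qed
  have hs: "square_integrable (h m)" if m: "m \<le> n" for m
    unfolding square_integrable_def
  proof (intro conjI integrableI_nonneg)
    have "ennreal (1 / (2 * pi)) * (\<integral>\<^sup>+\<xi>. ennreal (\<xi> ^ (2 * m) * (norm (F \<xi>))\<^sup>2) \<partial>lborel) < \<infinity>"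
      using fin[of m] m by (auto intro!: ennreal_mult_less_top[THEN iffD2])
    then show "l2_sq (h m) < \<infinity>" using hb[OF m] by (rule order.strict_trans1[rotated])
  qed simp_all
  have lh: "locally_integrable (h m)" if "m \<le> n" for m
    by (rule square_integrable_imp_locally_integrable[OF hs[OF that]])
  \<comment> \<open>Since \<open>u\<close> is linked to \<open>F\<close> only by an
    \<open>L\<^sup>2\<close> limit, it is identified with the inverse integral through equal
    integrals over all bounded intervals.\<close>
  have "AE x in lborel. u x - h 0 x = 0"
  proof (rule AE_zero_of_interval_integrals)
    show "locally_integrable (\<lambda>x. u x - h 0 x)"
      using lu lh[of 0] by (auto simp: locally_integrable_def)
    fix a b :: real assume ab: "a \<le> b"
    have si: "set_integrable lborel {a..b} u" "set_integrable lborel {a..b} (h 0)"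
      using lu lh[of 0] by (auto simp: locally_integrable_def)
    have "(LINT x:{a..b}|lborel. u x) $ i = (LINT x:{a..b}|lborel. h 0 x) $ i" for i
    proof -
      have c: "(LINT x:{a..b}|lborel. f x) $ i = (LINT x:{a..b}|lborel. f x $ i)"
        if "set_integrable lborel {a..b} f" for f :: "real \<Rightarrow> complex ^ 8"
        using integral_bounded_linear[OF bounded_linear_vec_nth that[unfolded
          set_integrable_def], of i]
        by (simp add: set_lebesgue_integral_def)
      have "(LINT x:{a..b}|lborel. u x $ i) = (LINT x:{a..b}|lborel. inv_ft (\<lambda>\<xi>. F \<xi> $ i) x)"
      proof (rule plancherel_interval_integral[OF _ _ _ _ ab])
        show "(\<lambda>x. u x $ i) \<in> borel_measurable borel" by measurable
        show "integrable lborel (\<lambda>x. (norm (u x $ i))\<^sup>2)"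
        proof (rule Bochner_Integration.integrable_bound)
          show "integrable lborel (\<lambda>x. (norm (u x))\<^sup>2)" using u2
            by (simp add: square_integrable_def)
          show "AE x in lborel. norm ((norm (u x $ i))\<^sup>2) \<le> norm ((norm (u x))\<^sup>2)"
            by (auto intro!: power_mono Finite_Cartesian_Product.norm_nth_le)
        qed measurable
        show "integrable lborel (\<lambda>\<xi>. F \<xi> $ i)" using Gi[of 0 i] by (simp add: G_def)
        show "((\<lambda>R. \<integral>\<^sup>+\<xi>. ennreal ((norm (ft (\<lambda>x. indicat_real {-R..R} x *\<^sub>R (u x $ i)) \<xi> - F \<xi>
          $ i))\<^sup>2) \<partial>lborel) \<longlongrightarrow> 0) at_top"
        proof (rule tendsto_sandwich[OF _ _ tendsto_const lim])
          have "norm (ft (\<lambda>x. indicat_real {-R..R} x *\<^sub>R (u x $ i)) \<xi> - F \<xi> $ i)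
              \<le> norm (fourier (\<lambda>x. indicat_real {- R..R} x *\<^sub>R u x) \<xi> - F \<xi>)" for R \<xi>
          proof -
            have "integrable lborel (\<lambda>x. indicat_real {- R..R} x *\<^sub>R u x)"
              using lu by (simp add: locally_integrable_def set_integrable_def)
            from fourier_nth[OF this, of \<xi> i] show ?thesis
              using Finite_Cartesian_Product.norm_nth_le[of "fourier (\<lambda>x. indicat_real {- R..R}
                x *\<^sub>R u x) \<xi> - F \<xi>" i] by simp
          qed
          then show "\<forall>\<^sub>F R in at_top. (\<integral>\<^sup>+\<xi>. ennreal ((norm (ft (\<lambda>x. indicat_real {-R..R} x *\<^sub>R
            (u x $ i)) \<xi> - F \<xi> $ i))\<^sup>2) \<partial>lborel)
              \<le> (\<integral>\<^sup>+\<xi>. ennreal ((norm (fourier (\<lambda>x. indicat_real {- R..R} x *\<^sub>R u x) \<xi> - F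
                \<xi>))\<^sup>2) \<partial>lborel)"
            by (intro always_eventually allI nn_integral_mono ennreal_leI power_mono) auto
        qed simp
      qed
      also have "(\<lambda>\<xi>. F \<xi> $ i) = G 0 i" by (simp add: G_def)
      finally show ?thesis unfolding c[OF si(1)] c[OF si(2)] by (simp add: h_def)
    qed
    then have "(LINT x:{a..b}|lborel. u x) = (LINT x:{a..b}|lborel. h 0 x)"
      by (simp add: vec_eq_iff)
    then show "(LINT x:{a..b}|lborel. u x - h 0 x) = 0"
      using set_integral_diff(2)[OF si] by simp
  qed
  then have ae: "AE x in lborel. u x = h 0 x" by simp
  have "has_weak_deriv n u (h n)"
    unfolding has_weak_deriv_def
  proof (intro conjI allI impI lu lh order_refl)
    fix \<phi> assume t: "test_function \<phi>"
    note t' = test_function_funpow_deriv[OF t, of n]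
    have "(\<integral>x. (deriv ^^ n) \<phi> x *\<^sub>R u x \<partial>lborel) = (\<integral>x. (deriv ^^ n) \<phi> x *\<^sub>R h 0 x \<partial>lborel)"
    proof (rule integral_cong_AE)
      have [measurable]: "(deriv ^^ n) \<phi> \<in> borel_measurable borel"
        by (rule test_function_measurable[OF t'])
      show "(\<lambda>x. (deriv ^^ n) \<phi> x *\<^sub>R u x) \<in> borel_measurable lborel"
        "(\<lambda>x. (deriv ^^ n) \<phi> x *\<^sub>R h 0 x) \<in> borel_measurable lborel" by measurable
      show "AE x in lborel. (deriv ^^ n) \<phi> x *\<^sub>R u x = (deriv ^^ n) \<phi> x *\<^sub>R h 0 x"
        using ae by eventually_elim simp
    qed
    also have "\<dots> = (- 1) ^ n *\<^sub>R (\<integral>x. \<phi> x *\<^sub>R h n x \<partial>lborel)"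
      unfolding vec_eq_iff vector_scaleR_component integral_test_function_nth[OF t' lh[OF le0]]
        integral_test_function_nth[OF t lh[OF order_refl]]
    proof
      fix i
      have g0: "G 0 i = (\<lambda>\<xi>. F \<xi> $ i)" by (simp add: G_def)
      show "(\<integral>x. (deriv ^^ n) \<phi> x *\<^sub>R (h 0 x $ i) \<partial>lborel)
        = (- 1) ^ n *\<^sub>R (\<integral>x. \<phi> x *\<^sub>R (h n x $ i) \<partial>lborel)"
        using inv_ft_weak_derivative[OF Gi[of 0 i, unfolded g0] Gi[of n i, unfolded G_def] t]
        by (simp add: h_def g0) (simp add: G_def)
    qed
    finally show "(\<integral>x. (deriv ^^ n) \<phi> x *\<^sub>R u x \<partial>lborel)
      = (- 1) ^ n *\<^sub>R (\<integral>x. \<phi> x *\<^sub>R h n x \<partial>lborel)" .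
  qed
  then show ?thesis using that[OF hs[OF order_refl] _ hb[OF order_refl]] by blast
qed

section \<open>Decay of the solution\<close>

lemma L2_norm_eq_enn2real:
  assumes "square_integrable g"
  shows "ennreal ((L2_norm g)\<^sup>2) = l2_sq g" "L2_norm g \<ge> 0"
proof -
  have "(\<integral>x. (norm (g x))\<^sup>2 \<partial>lborel) \<ge> 0" by (intro Bochner_Integration.integral_nonneg) simp
  then show "ennreal ((L2_norm g)\<^sup>2) = l2_sq g" "L2_norm g \<ge> 0"
    using assms unfolding L2_norm_def square_integrable_def
    by (auto simp: nn_integral_eq_integral)
qed

lemma L1_norm_nonneg: "L1_norm f \<ge> 0"
  unfolding L1_norm_def by (intro Bochner_Integration.integral_nonneg) simp

lemma sobolev_H_weak_deriv:
  assumes "f \<in> sobolev_H N" "n \<le> N"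
  obtains g where "square_integrable g" "has_weak_deriv n f g" "L2_norm (weak_deriv n f)
    = L2_norm g"
  using assms L2_norm_weak_deriv unfolding sobolev_H_def by blast

text \<open>The exponents \<open>p\<close> and \<open>q\<close> are parameters, so that all six
  estimates of the theorem are instances. The squared norm is estimated, and the square root halves
  the exponents supplied by the two frequency regions.\<close>

lemma sobolev_decay:
  assumes k: "k1 > 0" "k2 > 0" "k3 > 0" "k4 > 0" "k5 > 0" and \<gamma>: "\<gamma> \<noteq> 0" and \<epsilon>: "\<epsilon>0 \<in> {0, 1}"
    and l: "l > 0" and jN: "j + l \<le> N"
    and cases: "\<tau> = (1, 0, 0) \<and> k2 \<noteq> k3 \<and> p = 4 + 2 * \<epsilon>0 \<and> q = 4 \<or>
      \<tau> \<in> {(0, 1, 0), (0, 0, 1)} \<and> p = 2 + 2 * \<epsilon>0 \<and> (k1 = k2 \<and> k2 = k3 \<and> q = 2 \<or> q = 6)"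
  obtains c0 where "c0 > 0" "\<And>U0 U t. U0 \<in> sobolev_H N \<Longrightarrow> integrable lborel U0 \<Longrightarrow>
    cauchy_solution k1 k2 k3 k4 k5 \<gamma> \<tau> \<epsilon>0 U0 U \<Longrightarrow> t \<ge> 0 \<Longrightarrow>
    U t \<in> sobolev_H j \<and> L2_norm (weak_deriv j (U t))
      \<le> c0 * (1 + t) powr (- (2 * real j + 1) / (2 * real p)) * L1_norm U0
        + c0 * (1 + t) powr (- real l / real q) * L2_norm (weak_deriv (j + l) U0)"
proof -
  obtain C c where C: "C > 0" and c: "c > 0" and decay:
    "\<And>\<xi> w t. \<xi> \<noteq> 0 \<Longrightarrow> t \<ge> 0 \<Longrightarrow> (norm (flow k1 k2 k3 k4 k5 \<gamma> \<tau> \<epsilon>0 \<xi> w t))\<^sup>2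
      \<le> C * exp (- c * (if \<bar>\<xi>\<bar> \<le> 1 then \<bar>\<xi>\<bar> ^ p else 1 / \<bar>\<xi>\<bar> ^ q) * t) * (norm w)\<^sup>2"
    by (rule flow_decay[OF k \<gamma> \<epsilon> cases]) blast
  have pq: "p > 0" "q > 0" using cases by auto
  obtain K1 where K1: "K1 > 0" "\<And>t. t \<ge> 0 \<Longrightarrow>
    (\<integral>\<^sup>+\<xi>. ennreal (indicator {-1..1} \<xi> * (\<xi> ^ (2 * j) * exp (- c * \<bar>\<xi>\<bar> ^ p * t))) \<partial>lborel)
      \<le> ennreal (K1 * (1 + t) powr (- (2 * real j + 1) / real p))"
    by (rule low_frequency_integral[OF c pq(1)]) blast
  obtain K2 where K2: "K2 > 0" "\<And>\<xi> t. \<bar>\<xi>\<bar> \<ge> 1 \<Longrightarrow> t \<ge> 0 \<Longrightarrow>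
    exp (- c * (1 / \<bar>\<xi>\<bar> ^ q) * t) \<le> K2 * (1 + t) powr (- (2 * real l) / real q) * \<xi> ^ (2 * l)"
    by (rule high_frequency_bound[OF c pq(2)]) blast
  define c0 where "c0 = sqrt (C * K1) + sqrt (C * K2)"
  have c0: "c0 > 0" using C K1 K2 by (auto simp: c0_def intro!: add_pos_pos)
  show ?thesis
  proof (rule that[OF c0])
    fix U0 U and t :: real
    assume U0: "U0 \<in> sobolev_H N" and i: "integrable lborel U0"
      and sol: "cauchy_solution k1 k2 k3 k4 k5 \<gamma> \<tau> \<epsilon>0 U0 U" and t: "t \<ge> 0"
    define F where "F = (\<lambda>\<xi>. flow k1 k2 k3 k4 k5 \<gamma> \<tau> \<epsilon>0 \<xi> (fourier U0 \<xi>) t)"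
    have uF: "has_L2_fourier (U t) F"
      using sol t unfolding cauchy_solution_def F_def flow_def by blast
    have [measurable]: "F \<in> borel_measurable borel" using uF
      by (simp add: has_L2_fourier_def square_integrable_def)
    note [measurable] = fourier_measurable[OF i]
    have ne0: "AE \<xi> in lborel. \<xi> \<noteq> (0 :: real)" by (rule AE_lborel_singleton)
    have Fle: "(norm (F \<xi>))\<^sup>2 \<le> C * (norm (fourier U0 \<xi>))\<^sup>2" if "\<xi> \<noteq> 0" for \<xi>
    proof -
      let ?r = "if \<bar>\<xi>\<bar> \<le> 1 then \<bar>\<xi>\<bar> ^ p else 1 / \<bar>\<xi>\<bar> ^ q"
      have "exp (- c * ?r * t) \<le> 1" using c t by simp
      then have "C * exp (- c * ?r * t) * (norm (fourier U0 \<xi>))\<^sup>2 \<le> C * 1 * (norm (fourier U0 \<xi>))\<^sup>2"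
        using C by (intro mult_right_mono mult_left_mono) auto
      then show ?thesis unfolding F_def using decay[OF that t, of "fourier U0 \<xi>"] by simp
    qed
    have fin: "(\<integral>\<^sup>+\<xi>. ennreal (\<xi> ^ (2 * m) * (norm (F \<xi>))\<^sup>2) \<partial>lborel) < \<infinity>" if m: "m \<le> N" for m
    proof -
      obtain g where g: "square_integrable g" "has_weak_deriv m U0 g"
        using sobolev_H_weak_deriv[OF U0 m] by metis
      have "(\<integral>\<^sup>+\<xi>. ennreal (\<xi> ^ (2 * m) * (norm (F \<xi>))\<^sup>2) \<partial>lborel)
          \<le> (\<integral>\<^sup>+\<xi>. ennreal C * ennreal (\<xi> ^ (2 * m) * (norm (fourier U0 \<xi>))\<^sup>2) \<partial>lborel)"
      proof (rule nn_integral_mono_AE)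
        show "AE \<xi> in lborel. ennreal (\<xi> ^ (2 * m) * (norm (F \<xi>))\<^sup>2)
          \<le> ennreal C * ennreal (\<xi> ^ (2 * m) * (norm (fourier U0 \<xi>))\<^sup>2)"
          using ne0
        proof eventually_elim
          case (elim \<xi>)
          have "\<xi> ^ (2 * m) * (norm (F \<xi>))\<^sup>2 \<le> \<xi> ^ (2 * m) * (C * (norm (fourier U0 \<xi>))\<^sup>2)"
            by (intro mult_left_mono Fle elim) simp
          then have "ennreal (\<xi> ^ (2 * m) * (norm (F \<xi>))\<^sup>2)
            \<le> ennreal (C * (\<xi> ^ (2 * m) * (norm (fourier U0 \<xi>))\<^sup>2))"
            by (intro ennreal_leI) (simp add: mult.left_commute)
          also have "\<dots> = ennreal C * ennreal (\<xi> ^ (2 * m) * (norm (fourier U0 \<xi>))\<^sup>2)"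
            using C by (intro ennreal_mult) auto
          finally show ?case .
        qed
      qed
      also have "\<dots> = ennreal C * (\<integral>\<^sup>+\<xi>. ennreal (\<xi> ^ (2 * m) * (norm (fourier U0 \<xi>))\<^sup>2) \<partial>lborel)"
        by (intro nn_integral_cmult) measurable
      also have "\<dots> \<le> ennreal C * (ennreal (2 * pi) * ennreal ((L2_norm g)\<^sup>2))"
        unfolding L2_norm_eq_enn2real(1)[OF g(1)]
          by (intro mult_left_mono fourier_weak_deriv_bound i g(2)) simp
      also have "\<dots> < \<infinity>" by (simp add: ennreal_mult_less_top)
      finally show ?thesis .
    qed
    have deriv: "\<exists>h. square_integrable h \<and> has_weak_deriv n (U t) h \<and> l2_sq h
        \<le> ennreal (1 / (2 * pi)) * (\<integral>\<^sup>+\<xi>. ennreal (\<xi> ^ (2 * n)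
          * (norm (F \<xi>))\<^sup>2) \<partial>lborel)" if n: "n \<le> j" for n
    proof -
      have "m \<le> N" if "m \<le> Suc n" for m using that n l jN by simp
      then show ?thesis using L2_fourier_weak_deriv[OF uF fin, of n] by blast
    qed
    have H: "U t \<in> sobolev_H j"
      using deriv uF unfolding sobolev_H_def has_L2_fourier_def by blast
    obtain h where h: "square_integrable h" "has_weak_deriv j (U t) h"
      and hb: "l2_sq h
        \<le> ennreal (1 / (2 * pi)) * (\<integral>\<^sup>+\<xi>. ennreal (\<xi> ^ (2 * j) * (norm (F \<xi>))\<^sup>2) \<partial>lborel)"
      using deriv[of j] by blast
    obtain g where g: "square_integrable g" "has_weak_deriv (j
      + l) U0 g" "L2_norm (weak_deriv (j + l) U0) = L2_norm g"
      using sobolev_H_weak_deriv[OF U0 jN] by metis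
    define A where "A = L1_norm U0"
    define P where "P = (1 + t) powr (- (2 * real j + 1) / real p)"
    define Q where "Q = (1 + t) powr (- (2 * real l) / real q)"
    have A: "A \<ge> 0" and P: "P \<ge> 0" and Q: "Q \<ge> 0" using L1_norm_nonneg
      by (auto simp: A_def P_def Q_def)
    let ?low = "\<lambda>\<xi>. indicator {-1..1} \<xi> * (\<xi> ^ (2 * j) * exp (- c * \<bar>\<xi>\<bar> ^ p * t)) :: real"
    let ?high = "\<lambda>\<xi>. \<xi> ^ (2 * (j + l)) * (norm (fourier U0 \<xi>))\<^sup>2"
    have "(\<integral>\<^sup>+\<xi>. ennreal (\<xi> ^ (2 * j) * (norm (F \<xi>))\<^sup>2) \<partial>lborel)
        \<le> (\<integral>\<^sup>+\<xi>. ennreal (C * A\<^sup>2) * ennreal (?low \<xi>)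
          + ennreal (C * K2 * Q) * ennreal (?high \<xi>) \<partial>lborel)"
    proof (rule nn_integral_mono_AE)
      show "AE \<xi> in lborel. ennreal (\<xi> ^ (2 * j) * (norm (F \<xi>))\<^sup>2)
        \<le> ennreal (C * A\<^sup>2) * ennreal (?low \<xi>) + ennreal (C * K2 * Q) * ennreal (?high \<xi>)"
        using ne0
      proof eventually_elim
        case (elim \<xi>)
        have f: "(norm (fourier U0 \<xi>))\<^sup>2 \<le> A\<^sup>2"
          unfolding A_def by (intro power_mono norm_fourier_le i) simp
        have low0: "?low \<xi> \<ge> 0" by (auto simp: indicator_def)
        have high0: "?high \<xi> \<ge> 0" by (intro mult_nonneg_nonneg zero_le_even_power) auto
        have "\<xi> ^ (2 * j) * (norm (F \<xi>))\<^sup>2 \<le> (C * A\<^sup>2) * ?low \<xi> + (C * K2 * Q) * ?high \<xi>"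
        proof (cases "\<bar>\<xi>\<bar> \<le> 1")
          case True
          then have "(norm (F \<xi>))\<^sup>2 \<le> C * exp (- c * \<bar>\<xi>\<bar> ^ p * t) * (norm (fourier U0 \<xi>))\<^sup>2"
            using decay[OF elim t] by (simp add: F_def)
          also have "\<dots> \<le> C * exp (- c * \<bar>\<xi>\<bar> ^ p * t) * A\<^sup>2"
            using C by (intro mult_left_mono f) auto
          finally have "\<xi> ^ (2 * j) * (norm (F \<xi>))\<^sup>2
            \<le> \<xi> ^ (2 * j) * (C * exp (- c * \<bar>\<xi>\<bar> ^ p * t) * A\<^sup>2)"
            by (intro mult_left_mono) auto
          also have "\<dots> = (C * A\<^sup>2) * ?low \<xi>" using True by (simp add: indicator_def abs_le_iff)
          also have "\<dots> \<le> (C * A\<^sup>2) * ?low \<xi> + (C * K2 * Q) * ?high \<xi>" using C K2 Q high0 by simp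
          finally show ?thesis .
        next
          case False
          then have "(norm (F \<xi>))\<^sup>2 \<le> C * exp (- c * (1 / \<bar>\<xi>\<bar> ^ q) * t) * (norm (fourier U0 \<xi>))\<^sup>2"
            using decay[OF elim t] by (simp add: F_def)
          also have "\<dots> \<le> C * (K2 * Q * \<xi> ^ (2 * l)) * (norm (fourier U0 \<xi>))\<^sup>2"
            unfolding Q_def using C False t by (intro mult_right_mono mult_left_mono K2(2)) auto
          finally have "\<xi> ^ (2 * j) * (norm (F \<xi>))\<^sup>2
              \<le> \<xi> ^ (2 * j) * (C * (K2 * Q * \<xi> ^ (2 * l)) * (norm (fourier U0 \<xi>))\<^sup>2)"
            by (intro mult_left_mono) auto
          also have "\<dots> = (C * K2 * Q) * ?high \<xi>" by (simp add: power_add algebra_simps)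
          also have "\<dots> \<le> (C * A\<^sup>2) * ?low \<xi> + (C * K2 * Q) * ?high \<xi>" using C low0 by simp
          finally show ?thesis .
        qed
        then show ?case
          using C K2 Q low0 high0
          by (simp only: ennreal_mult[symmetric] mult_nonneg_nonneg less_imp_le zero_le_power2
            ennreal_plus[symmetric] ennreal_leI)
      qed
    qed
    also have "\<dots> = ennreal (C * A\<^sup>2) * (\<integral>\<^sup>+\<xi>. ennreal (?low \<xi>) \<partial>lborel)
        + ennreal (C * K2 * Q) * (\<integral>\<^sup>+\<xi>. ennreal (?high \<xi>) \<partial>lborel)"
      by (subst nn_integral_add) (simp_all add: nn_integral_cmult)
    also have "\<dots> \<le> ennreal (C * A\<^sup>2) * ennreal (K1 * P)
      + ennreal (C * K2 * Q) * (ennreal (2 * pi) * ennreal ((L2_norm g)\<^sup>2))"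
      unfolding L2_norm_eq_enn2real(1)[OF g(1)] P_def
      by (intro add_mono mult_left_mono K1(2) t fourier_weak_deriv_bound i g(2)) auto
    also have "\<dots> = ennreal (C * K1 * P * A\<^sup>2 + 2 * pi * (C * K2 * Q * (L2_norm g)\<^sup>2))"
      using C K1(1) K2(1) P Q
      by (simp add: ennreal_mult[symmetric] ennreal_plus[symmetric] mult_ac del: ennreal_plus)
    finally have F2: "(\<integral>\<^sup>+\<xi>. ennreal (\<xi> ^ (2 * j) * (norm (F \<xi>))\<^sup>2) \<partial>lborel)
        \<le> ennreal (C * K1 * P * A\<^sup>2 + 2 * pi * (C * K2 * Q * (L2_norm g)\<^sup>2))" .
    have nn: "0 \<le> C * K1 * P * A\<^sup>2" "0 \<le> C * K2 * Q * (L2_norm g)\<^sup>2"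
      using C K1(1) K2(1) P Q by auto
    have "ennreal ((L2_norm h)\<^sup>2) \<le> ennreal (1 / (2 * pi)) * ennreal (C * K1 * P * A\<^sup>2
      + 2 * pi * (C * K2 * Q * (L2_norm g)\<^sup>2))"
      unfolding L2_norm_eq_enn2real(1)[OF h(1)]
      by (rule order_trans[OF hb]) (intro mult_left_mono F2, simp)
    also have "\<dots> = ennreal (1 / (2 * pi) * (C * K1 * P * A\<^sup>2
      + 2 * pi * (C * K2 * Q * (L2_norm g)\<^sup>2)))"
      using nn by (subst ennreal_mult) auto
    finally have "(L2_norm h)\<^sup>2 \<le> 1 / (2 * pi) * (C * K1 * P * A\<^sup>2
      + 2 * pi * (C * K2 * Q * (L2_norm g)\<^sup>2))"
      using nn by (subst (asm) ennreal_le_iff) auto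
    also have "\<dots> = 1 / (2 * pi) * (C * K1 * P * A\<^sup>2) + C * K2 * Q * (L2_norm g)\<^sup>2"
      by (simp add: distrib_left)
    \<comment> \<open>The factor \<open>2 * pi\<close> from Bessel's inequality for the datum has
      cancelled the one of the inversion in the high-frequency part; in the low-frequency part
      \<open>1 / (2 * pi)\<close> is estimated by \<open>1\<close>.\<close>
    also have "1 / (2 * pi) * (C * K1 * P * A\<^sup>2) \<le> 1 * (C * K1 * P * A\<^sup>2)"
      using pi_ge_two nn by (intro mult_right_mono) auto
    finally have sq: "(L2_norm h)\<^sup>2 \<le> C * K1 * P * A\<^sup>2 + C * K2 * Q * (L2_norm g)\<^sup>2" by simp
    have sP: "sqrt P = (1 + t) powr (- (2 * real j + 1) / (2 * real p))"
      unfolding P_def powr_half_sqrt[symmetric, OF powr_ge_zero] powr_powr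
        by (simp add: field_simps)
    have sQ: "sqrt Q = (1 + t) powr (- real l / real q)"
      unfolding Q_def powr_half_sqrt[symmetric, OF powr_ge_zero] powr_powr
        by (simp add: field_simps)
    have "L2_norm h = sqrt ((L2_norm h)\<^sup>2)" using L2_norm_eq_enn2real(2)[OF h(1)] by simp
    also have "\<dots> \<le> sqrt (C * K1 * P * A\<^sup>2 + C * K2 * Q * (L2_norm g)\<^sup>2)"
      by (rule real_sqrt_le_mono[OF sq])
    also have "\<dots> \<le> sqrt (C * K1 * P * A\<^sup>2) + sqrt (C * K2 * Q * (L2_norm g)\<^sup>2)"
      using nn by (intro sqrt_add_le_add_sqrt)
    also have "\<dots> = sqrt (C * K1) * sqrt P * A + sqrt (C * K2) * sqrt Q * L2_norm g"
      using A L2_norm_eq_enn2real(2)[OF g(1)] by (simp add: real_sqrt_mult)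
    also have "\<dots> \<le> c0 * sqrt P * A + c0 * sqrt Q * L2_norm g"
      using A L2_norm_eq_enn2real(2)[OF g(1)] C K1(1) K2(1) P Q
      by (intro add_mono mult_right_mono) (auto simp: c0_def)
    finally show "U t \<in> sobolev_H j \<and> L2_norm (weak_deriv j (U t))
      \<le> c0 * (1 + t) powr (- (2 * real j + 1) / (2 * real p)) * L1_norm U0
        + c0 * (1 + t) powr (- real l / real q) * L2_norm (weak_deriv (j + l) U0)"
      using H unfolding sP sQ A_def g(3) L2_norm_weak_deriv[OF h(2)] by simp
  qed
qed

theorem theorem5p2:
  fixes k1 k2 k3 k4 k5 \<gamma> :: real and \<tau> :: "real \<times> real \<times> real" and \<epsilon>0 N l j :: nat
  assumes "k1 > 0" "k2 > 0" "k3 > 0" "k4 > 0" "k5 > 0" and "\<gamma> \<noteq> 0"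
    and "\<tau> \<in> {(1, 0, 0), (0, 1, 0), (0, 0, 1)}" and "\<epsilon>0 \<in> {0, 1}"
    and "N > 0" "l > 0" "l \<le> N" and "j \<in> {0..N - l}"
  shows "\<exists>c0>0. \<forall>U0 U. U0 \<in> sobolev_H N \<longrightarrow> integrable lborel U0 \<longrightarrow>
    cauchy_solution k1 k2 k3 k4 k5 \<gamma> \<tau> \<epsilon>0 U0 U \<longrightarrow>
    (\<forall>t\<ge>0.
      let bound = (\<lambda>a b :: real. U t \<in> sobolev_H j \<and>
            L2_norm (weak_deriv j (U t))
              \<le> c0 * (1 + t) powr a * L1_norm U0
                + c0 * (1 + t) powr b * L2_norm (weak_deriv (j + l) U0))
      in
       (\<tau> = (1, 0, 0) \<and> k3 - k2 \<noteq> 0 \<longrightarrow>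
          (\<epsilon>0 = 1 \<longrightarrow> bound (- 1 / 12 - real j / 6) (- real l / 4)) \<and>
          (\<epsilon>0 = 0 \<longrightarrow> bound (- 1 / 8 - real j / 4) (- real l / 4))) \<and>
       (\<tau> \<in> {(0, 1, 0), (0, 0, 1)} \<and> (k1 = k2 \<and> k2 = k3) \<longrightarrow>
          (\<epsilon>0 = 1 \<longrightarrow> bound (- 1 / 8 - real j / 4) (- real l / 2)) \<and>
          (\<epsilon>0 = 0 \<longrightarrow> bound (- 1 / 4 - real j / 2) (- real l / 2))) \<and>
       (\<tau> \<in> {(0, 1, 0), (0, 0, 1)} \<and> \<not> (k1 = k2 \<and> k2 = k3) \<longrightarrow>
          (\<epsilon>0 = 1 \<longrightarrow> bound (- 1 / 8 - real j / 4) (- real l / 6)) \<and>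
          (\<epsilon>0 = 0 \<longrightarrow> bound (- 1 / 4 - real j / 2) (- real l / 6))))"
proof (cases "\<tau> = (1, 0, 0) \<and> k3 - k2 = 0")
  \<comment> \<open>Coupling through \<open>u\<close> with \<open>k2 = k3\<close> falls under none
    of the three cases, so any positive constant serves.\<close>
  case True
  then show ?thesis by (intro exI[of _ 1]) (simp add: Let_def)
next
  case False
  define p where "p = (if \<tau> = (1, 0, 0) then 4 + 2 * \<epsilon>0 else 2 + 2 * \<epsilon>0)"
  define q :: nat where "q = (if \<tau> = (1, 0, 0) then 4 else if k1 = k2 \<and> k2 = k3 then 2 else 6)"
  have jN: "j + l \<le> N" using assms by auto
  have cases: "\<tau> = (1, 0, 0) \<and> k2 \<noteq> k3 \<and> p = 4 + 2 * \<epsilon>0 \<and> q = 4 \<or>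
      \<tau> \<in> {(0, 1, 0), (0, 0, 1)} \<and> p = 2 + 2 * \<epsilon>0 \<and> (k1 = k2 \<and> k2 = k3 \<and> q = 2 \<or> q = 6)"
    using False assms(7) by (auto simp: p_def q_def)
  obtain c0 where c0: "c0 > 0" "\<And>U0 U t. U0 \<in> sobolev_H N \<Longrightarrow> integrable lborel U0 \<Longrightarrow>
    cauchy_solution k1 k2 k3 k4 k5 \<gamma> \<tau> \<epsilon>0 U0 U \<Longrightarrow> t \<ge> 0 \<Longrightarrow>
    U t \<in> sobolev_H j \<and> L2_norm (weak_deriv j (U t))
      \<le> c0 * (1 + t) powr (- (2 * real j + 1) / (2 * real p)) * L1_norm U0
        + c0 * (1 + t) powr (- real l / real q) * L2_norm (weak_deriv (j + l) U0)"
    by (rule sobolev_decay[OF assms(1-6,8,10) jN cases]) blast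
  have a: "- (2 * real j + 1) / (2 * real p) = - 1 / real (2 * p) - real j / real p"
  proof -
    have "real p > 0" using cases by auto
    then show ?thesis by (simp add: field_simps)
  qed
  show ?thesis
  proof (intro exI[of _ c0] conjI c0(1) allI impI)
    fix U0 U and t :: real
    assume "U0 \<in> sobolev_H N" "integrable lborel U0" "cauchy_solution k1 k2 k3 k4 k5 \<gamma> \<tau> \<epsilon>0 U0
      U" "t \<ge> 0"
    from c0(2)[OF this, unfolded a] show "let bound = (\<lambda>a b :: real. U t \<in> sobolev_H j \<and>
            L2_norm (weak_deriv j (U t))
              \<le> c0 * (1 + t) powr a * L1_norm U0
                + c0 * (1 + t) powr b * L2_norm (weak_deriv (j + l) U0))
      in
       (\<tau> = (1, 0, 0) \<and> k3 - k2 \<noteq> 0 \<longrightarrow>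
          (\<epsilon>0 = 1 \<longrightarrow> bound (- 1 / 12 - real j / 6) (- real l / 4)) \<and>
          (\<epsilon>0 = 0 \<longrightarrow> bound (- 1 / 8 - real j / 4) (- real l / 4))) \<and>
       (\<tau> \<in> {(0, 1, 0), (0, 0, 1)} \<and> (k1 = k2 \<and> k2 = k3) \<longrightarrow>
          (\<epsilon>0 = 1 \<longrightarrow> bound (- 1 / 8 - real j / 4) (- real l / 2)) \<and>
          (\<epsilon>0 = 0 \<longrightarrow> bound (- 1 / 4 - real j / 2) (- real l / 2))) \<and>
       (\<tau> \<in> {(0, 1, 0), (0, 0, 1)} \<and> \<not> (k1 = k2 \<and> k2 = k3) \<longrightarrow>
          (\<epsilon>0 = 1 \<longrightarrow> bound (- 1 / 8 - real j / 4) (- real l / 6)) \<and>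
          (\<epsilon>0 = 0 \<longrightarrow> bound (- 1 / 4 - real j / 2) (- real l / 6)))"
      unfolding p_def q_def Let_def by auto
  qed
qed

end
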